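(* Let $d \geq 3$ and $p \in [1, d-1)$. There exist a $d$-dimensional smooth manifold $M$ and a Riemannian metric $g$ on $M$ such that $g, g^{-1} \in L^\infty$, $g \in W^{1,p}_{\mathrm{loc}}(M)$, and such that: (i) there exists a test plan $\boldsymbol{\pi}$ on $(M,\mathsf d_g,\mathrm{vol}_g)$ which gives positive measure to the set of curves $\gamma$ for which the metric speed satisfies $|\dot\gamma_t| < |\dot\gamma_t|_g$ for almost every $t \in [0,1]$; (ii) there exists a function $f \in C^1(M)$ such that $|Df| > |\nabla_g f|_g$ and $|Df|_w > |\nabla_g f|_g$ on a set of positive $\mathrm{vol}_g$-measure.
   Context: For a measurable Riemannian metric $g$ on $M$ with $g,g^{-1}\in L^\infty_{\mathrm{loc}}$, the volume measure is locally ${\rm d}\mathrm{vol}_g=\sqrt{\det g}\,{\rm d}\mathcal L^d$, and the distance is $\mathsf d_g(x,y)=\sup\{w(x)-w(y): w \text{ Lipschitz}, |\nabla_g w|_g\le 1 \text{ a.e.}\}$ (equivalently the limit as $\varepsilon\to0$ of the length distances of the mollified continuous metrics $g_\varepsilon=\rho_\varepsilon * g$, where for continuous $h$ the distance $\mathsf d_h(x,y)$ is the infimum of $\int_0^1|\dot\gamma_t|_h\,dt$ over piecewise smooth curves from $x$ to $y$). For an absolutely continuous curve $\gamma:[0,1]\to M$ (w.r.t. $\mathsf d_g$), the metric speed is $|\dot\gamma_t|=\lim_{h\to0}\mathsf d_g(\gamma_{t+h},\gamma_t)/|h|$ (exists for a.e. $t$), and $|\dot\gamma_t|_g=\sqrt{g(\dot\gamma_t,\dot\gamma_t)}$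 is the $g$-norm of the derivative. A test plan is a Borel probability measure $\boldsymbol\pi$ on $C([0,1],M)$ such that $(e_t)_\#\boldsymbol\pi\le C\,\mathrm{vol}_g$ for all $t\in[0,1]$ for some constant $C$ (where $e_t(\gamma)=\gamma_t$), and $\int\int_0^1|\dot\gamma_t|^2\,dt\,d\boldsymbol\pi(\gamma)<\infty$ (with the integral $=\infty$ for non-absolutely-continuous $\gamma$). The slope of $f$ is $|Df|(x)=\limsup_{y\to x}|f(y)-f(x)|/\mathsf d_g(x,y)$. A measurable $G\ge0$ is a weak upper gradient of $f$ if $\int|f(\gamma_1)-f(\gamma_0)|\,d\boldsymbol\pi\le\int\int_0^1G(\gamma_t)|\dot\gamma_t|\,dt\,d\boldsymbol\pi<\infty$ for all test plans $\boldsymbol\pi$; $|Df|_w$ denotes the $\mathrm{vol}_g$-a.e. minimal weak upper gradient. $\nabla_g f$ is the $g$-gradient. *)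

theory Defs
  imports "HOL-Analysis.Analysis" "HOL-Probability.Probability"
begin

fun Ck_fun :: "nat \<Rightarrow> (real^'n \<Rightarrow> real) \<Rightarrow> bool" where
  "Ck_fun 0 \<phi> = continuous_on UNIV \<phi>"
| "Ck_fun (Suc k) \<phi> = (\<exists>D. (\<forall>x. (\<phi> has_derivative (\<lambda>v. D x \<bullet> v)) (at x))
                          \<and> (\<forall>i. Ck_fun k (\<lambda>x. D x $ i)))"

definition smooth_fun :: "(real^'n \<Rightarrow> real) \<Rightarrow> bool" where
  "smooth_fun \<phi> \<longleftrightarrow> (\<forall>k. Ck_fun k \<phi>)"

definition test_fun :: "(real^'n) set \<Rightarrow> (real^'n \<Rightarrow> real) \<Rightarrow> bool" where
  "test_fun U \<phi> \<longleftrightarrow> smooth_fun \<phi> \<and> compact (closure {x. \<phi> x \<noteq> 0})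
      \<and> closure {x. \<phi> x \<noteq> 0} \<subseteq> U"

definition Lp_loc :: "(real^'n) set \<Rightarrow> real \<Rightarrow> (real^'n \<Rightarrow> real) \<Rightarrow> bool" where
  "Lp_loc U p f \<longleftrightarrow> f \<in> borel_measurable (restrict_space lebesgue U)
     \<and> (\<forall>K. compact K \<and> K \<subseteq> U \<longrightarrow> set_integrable lebesgue K (\<lambda>x. \<bar>f x\<bar> powr p))"

definition weak_partial :: "(real^'n) set \<Rightarrow> (real^'n \<Rightarrow> real) \<Rightarrow> 'n \<Rightarrow> (real^'n \<Rightarrow> real) \<Rightarrow> bool" where
  "weak_partial U f i h \<longleftrightarrow> (\<forall>\<phi>. test_fun U \<phi> \<longrightarrow>
      (LINT x:U|lebesgue. f x * frechet_derivative \<phi> (at x) (axis i 1))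
        = - (LINT x:U|lebesgue. h x * \<phi> x))"

definition W1p_loc :: "(real^'n) set \<Rightarrow> real \<Rightarrow> (real^'n \<Rightarrow> real) \<Rightarrow> bool" where
  "W1p_loc U p f \<longleftrightarrow> Lp_loc U p f \<and> (\<forall>i. \<exists>h. Lp_loc U p h \<and> weak_partial U f i h)"

definition riem_metric :: "(real^'n) set \<Rightarrow> (real^'n \<Rightarrow> real^'n^'n) \<Rightarrow> bool" where
  "riem_metric U g \<longleftrightarrow>
     (\<forall>i j. (\<lambda>x. g x $ i $ j) \<in> borel_measurable (restrict_space lebesgue U))
     \<and> (\<forall>x\<in>U. transpose (g x) = g x \<and> (\<forall>v. v \<noteq> 0 \<longrightarrow> v \<bullet> (g x *v v) > 0))"

definition metric_Linf :: "(real^'n) set \<Rightarrow> (real^'n \<Rightarrow> real^'n^'n) \<Rightarrow> bool" where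
  "metric_Linf U g \<longleftrightarrow> (\<exists>C. AE x in lebesgue. x \<in> U \<longrightarrow>
      (\<forall>i j. \<bar>g x $ i $ j\<bar> \<le> C \<and> \<bar>matrix_inv (g x) $ i $ j\<bar> \<le> C))"

definition vol_g :: "(real^'n) set \<Rightarrow> (real^'n \<Rightarrow> real^'n^'n) \<Rightarrow> (real^'n) measure" where
  "vol_g U g = density (restrict_space lebesgue U) (\<lambda>x. ennreal (sqrt (det (g x))))"

text \<open>squared g-norm of the g-gradient of w at x, given the Euclidean gradient D\<close>
definition grad_norm_sq :: "(real^'n \<Rightarrow> real^'n^'n) \<Rightarrow> real^'n \<Rightarrow> real^'n \<Rightarrow> real" where
  "grad_norm_sq g x D = D \<bullet> (matrix_inv (g x) *v D)"

definition dist_g :: "(real^'n) set \<Rightarrow> (real^'n \<Rightarrow> real^'n^'n) \<Rightarrow> real^'n \<Rightarrow> real^'n \<Rightarrow> real" where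
  "dist_g U g x y = Sup {w x - w y | w. (\<exists>L. L-lipschitz_on U w) \<and>
      (AE z in lebesgue. z \<in> U \<longrightarrow>
         (\<exists>D. (w has_derivative (\<lambda>v. D \<bullet> v)) (at z) \<and> grad_norm_sq g z D \<le> 1))}"

definition curves :: "(real^'n) set \<Rightarrow> (real \<Rightarrow> real^'n) set" where
  "curves U = {\<gamma>. \<gamma> \<in> extensional {0..1} \<and> continuous_on {0..1} \<gamma> \<and> \<gamma> ` {0..1} \<subseteq> U}"

text \<open>Borel sigma algebra on C([0,1],M), generated by the evaluation maps\<close>
definition curve_space :: "(real^'n) set \<Rightarrow> (real \<Rightarrow> real^'n) measure" where
  "curve_space U = restrict_space (Pi\<^sub>M {0..1::real} (\<lambda>_. borel)) (curves U)"

definition abs_cont_g :: "(real^'n) set \<Rightarrow> (real^'n \<Rightarrow> real^'n^'n) \<Rightarrow> (real \<Rightarrow> real^'n) \<Rightarrow> bool" where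
  "abs_cont_g U g \<gamma> \<longleftrightarrow> (\<exists>m. set_integrable lborel {0..1::real} m \<and>
     (\<forall>s t. 0 \<le> s \<longrightarrow> s \<le> t \<longrightarrow> t \<le> 1 \<longrightarrow>
        dist_g U g (\<gamma> s) (\<gamma> t) \<le> (LINT r:{s..t}|lborel. m r)))"

definition metric_speed :: "(real^'n) set \<Rightarrow> (real^'n \<Rightarrow> real^'n^'n) \<Rightarrow> (real \<Rightarrow> real^'n) \<Rightarrow> real \<Rightarrow> real" where
  "metric_speed U g \<gamma> t = Lim (at t within {0..1}) (\<lambda>s. dist_g U g (\<gamma> s) (\<gamma> t) / \<bar>s - t\<bar>)"

definition g_speed :: "(real^'n \<Rightarrow> real^'n^'n) \<Rightarrow> (real \<Rightarrow> real^'n) \<Rightarrow> real \<Rightarrow> real" where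
  "g_speed g \<gamma> t = (let v = vector_derivative \<gamma> (at t within {0..1}) in sqrt (v \<bullet> (g (\<gamma> t) *v v)))"

definition energy :: "(real^'n) set \<Rightarrow> (real^'n \<Rightarrow> real^'n^'n) \<Rightarrow> (real \<Rightarrow> real^'n) \<Rightarrow> ennreal" where
  "energy U g \<gamma> = (if abs_cont_g U g \<gamma>
      then (\<integral>\<^sup>+ t\<in>{0..1}. ennreal ((metric_speed U g \<gamma> t)\<^sup>2) \<partial>lborel) else \<infinity>)"

definition test_plan :: "(real^'n) set \<Rightarrow> (real^'n \<Rightarrow> real^'n^'n) \<Rightarrow> (real \<Rightarrow> real^'n) measure \<Rightarrow> bool" where
  "test_plan U g \<pi> \<longleftrightarrow> prob_space \<pi> \<and> sets \<pi> = sets (curve_space U)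
     \<and> (\<exists>C. \<forall>t\<in>{0..1}. \<forall>A\<in>sets borel.
           emeasure \<pi> {\<gamma>\<in>space \<pi>. \<gamma> t \<in> A} \<le> ennreal C * emeasure (vol_g U g) (A \<inter> U))
     \<and> (\<integral>\<^sup>+ \<gamma>. energy U g \<gamma> \<partial>\<pi>) < \<infinity>"

definition slope :: "(real^'n) set \<Rightarrow> (real^'n \<Rightarrow> real^'n^'n) \<Rightarrow> (real^'n \<Rightarrow> real) \<Rightarrow> real^'n \<Rightarrow> ereal" where
  "slope U g f x = Limsup (at x within U) (\<lambda>y. ereal (\<bar>f y - f x\<bar> / dist_g U g x y))"

definition weak_upper_gradient :: "(real^'n) set \<Rightarrow> (real^'n \<Rightarrow> real^'n^'n) \<Rightarrow> (real^'n \<Rightarrow> real) \<Rightarrow> (real^'n \<Rightarrow> real) \<Rightarrow> bool" where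
  "weak_upper_gradient U g f G \<longleftrightarrow> G \<in> borel_measurable (restrict_space lebesgue U) \<and> (\<forall>x\<in>U. 0 \<le> G x) \<and>
     (\<forall>\<pi>. test_plan U g \<pi> \<longrightarrow>
        (\<integral>\<^sup>+ \<gamma>. ennreal \<bar>f (\<gamma> 1) - f (\<gamma> 0)\<bar> \<partial>\<pi>)
          \<le> (\<integral>\<^sup>+ \<gamma>. (\<integral>\<^sup>+ t\<in>{0..1}. ennreal (G (\<gamma> t) * metric_speed U g \<gamma> t) \<partial>lborel) \<partial>\<pi>)
        \<and> (\<integral>\<^sup>+ \<gamma>. (\<integral>\<^sup>+ t\<in>{0..1}. ennreal (G (\<gamma> t) * metric_speed U g \<gamma> t) \<partial>lborel) \<partial>\<pi>) < \<infinity>)"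

definition minimal_wug :: "(real^'n) set \<Rightarrow> (real^'n \<Rightarrow> real^'n^'n) \<Rightarrow> (real^'n \<Rightarrow> real) \<Rightarrow> (real^'n \<Rightarrow> real) \<Rightarrow> bool" where
  "minimal_wug U g f G \<longleftrightarrow> weak_upper_gradient U g f G \<and>
     (\<forall>G'. weak_upper_gradient U g f G' \<longrightarrow> (AE x in vol_g U g. G x \<le> G' x))"

end

theory Submission
  imports Defs
begin

text \<open>
  Take \<open>M = \<real>\<^sup>d\<close> with the conformal metric \<open>g = \<psi> I\<close>, where \<open>\<psi> = 1/4 + 3/4 exp (- u)\<close> and
  \<open>u = \<Sum>\<^sub>j 4\<^sup>-\<^sup>j ln (1 + 1/\<sigma>\<^sub>j\<^sup>2)\<close>, with \<open>\<sigma>\<^sub>j\<close> the distance to the \<open>j\<close>-th line of a dense sequence of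
  parallel lines of direction \<open>e\<close>. Near such a line \<open>|\<nabla>u|\<close> grows only like \<open>1/\<sigma>\<^sub>j\<close>, whose \<open>p\<close>-th power is
  integrable because \<open>p < d - 1\<close> is less than the codimension of the line; hence \<open>\<psi> \<in> W\<^sup>1\<^sup>,\<^sup>p\<close>. On the other
  hand \<open>u\<close> tends to infinity at the lines, so in thin tubes around them \<open>\<psi>\<close> is close to \<open>1/4\<close>, and since
  the tubes are dense, every point can use them as highways: \<open>d\<^sub>g(x, x + s e) = |s|/2\<close>, whereas
  \<open>\<psi> > 1/4\<close> everywhere. So curves of direction \<open>e\<close> have metric speed \<open>1/2\<close> but \<open>g\<close>-speed
  \<open>\<surd>\<psi> > 1/2\<close>, and \<open>f(x) = x \<bullet> e\<close> has slope and minimal weak upper gradient \<open>2\<close> (test it with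
  plans translating compact sets in direction \<open>e\<close>) but \<open>|\<nabla>\<^sub>g f|\<^sub>g = 1/\<surd>\<psi> < 2\<close>.

  That the constant \<open>2\<close> is a weak upper gradient rests on the almost everywhere existence of the
  metric derivative of absolutely continuous curves. Since the energy is not known to be measurable,
  it is bounded below by the integral of the largest difference quotient of the curve, which is a
  measurable function of the curve and whose finiteness forces absolute continuity.
\<close>

text \<open>The lines themselves are null sets and the distance sees gradients only almost
  everywhere, so a small value of \<open>\<psi>\<close> on a line alone would be invisible. The
  tubes have positive measure, and a Lipschitz competitor can be integrated along a parallel line
  inside a tube that avoids the exceptional set. The bounds 1/4 and 1 on \<open>\<psi>\<close> place
  the distance between half the Euclidean one and the Euclidean one; in direction \<open>e\<close>
  the lower bound is attained, whence the values 1/2 and 2. The weight 4^-j is a product of two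
  factors 2^-j: the first makes the sum of the powers \<open>\<sigma> j x powr - p\<close> locally
  integrable, the second is left over as a geometric series when the bound on the single terms is
  turned into a bound on the whole gradient. The two halves of minimality are uneven: that 2 is a
  weak upper gradient concerns every test plan, and thus arbitrary curves, while the lower bound on
  every other weak upper gradient needs only explicit segments.\<close>

section \<open>Differentiation of measures on the line\<close>

text \<open>Vitali covering: disjoint balls are selected whose fivefold enlargements cover
  \<open>E\<close>. An enlarged ball has length 10 r, at most 10 / c times the mass of the original
  ball, and the masses of disjoint balls add up to at most that of \<open>U\<close>. The same mass
  condition bounds the radii, as the covering lemma requires. Since \<open>E\<close> may fail to be
  measurable, a Borel superset is estimated.\<close>

lemma covering_weak_type:
  fixes \<nu> :: "real measure"
  assumes sets: "sets \<nu> = sets borel" and fin: "emeasure \<nu> U < \<infinity>" and U: "open U" and c: "0 < c"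
    and ex: "\<And>t. t \<in> E \<Longrightarrow> \<exists>r>0. cball t r \<subseteq> U \<and> ennreal (c * r) \<le> emeasure \<nu> (cball t r)"
  shows "\<exists>E'\<in>sets borel. E \<subseteq> E' \<and> emeasure lborel E' \<le> ennreal (10 / c) * emeasure \<nu> U"
proof -
  obtain r where r: "\<And>t. t \<in> E \<Longrightarrow> 0 < r t \<and> cball t (r t) \<subseteq> U \<and> ennreal (c * r t) \<le> emeasure \<nu> (cball t (r t))"
    using ex by metis
  have Um: "U \<in> sets \<nu>"
    using U by (simp add: sets)
  have bound: "0 < r t \<and> r t \<le> measure \<nu> U / c" if "t \<in> E" for t
  proof -
    have "ennreal (c * r t) \<le> emeasure \<nu> U"
      using r[OF that] emeasure_mono[of "cball t (r t)" U \<nu>] Um by force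
    also have "\<dots> = ennreal (measure \<nu> U)"
      using fin by (simp add: emeasure_eq_ennreal_measure less_top)
    finally have "c * r t \<le> measure \<nu> U"
      by (simp add: ennreal_le_iff)
    then show ?thesis
      using c r[OF that] by (simp add: field_simps)
  qed
  have "E \<subseteq> (\<Union>i\<in>E. cball i (r i))"
    using r by (force intro: less_imp_le)
  then obtain C where C: "countable C" "C \<subseteq> E"
    "pairwise (\<lambda>i j. disjnt (cball i (r i)) (cball j (r j))) C"
    "E \<subseteq> (\<Union>i\<in>C. cball i (5 * r i))"
    by (rule Vitali_covering_lemma_cballs[where a = "\<lambda>x. x", OF _ bound])
  define J where "J = to_nat_on C ` C"
  define h where "h = from_nat_into C"
  have hC: "h n \<in> C" if "n \<in> J" for n
    using that C(1) by (auto simp: J_def h_def)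
  have hinj: "h m \<noteq> h n" if "m \<in> J" "n \<in> J" "m \<noteq> n" for m n
    using that C(1) by (auto simp: J_def h_def)
  define A where "A n = (if n \<in> J then cball (h n) (5 * r (h n)) else {})" for n
  define B where "B n = (if n \<in> J then cball (h n) (r (h n)) else {})" for n
  have Am: "range A \<subseteq> sets lborel" and Bm: "range B \<subseteq> sets \<nu>"
    by (auto simp: A_def B_def sets)
  have AB: "emeasure lborel (A n) \<le> ennreal (10 / c) * emeasure \<nu> (B n)" for n
  proof (cases "n \<in> J")
    case True
    then have hE: "h n \<in> E" using hC C(2) by auto
    have "emeasure lborel (A n) = ennreal (10 * r (h n))"
      using True r[OF hE] by (simp add: A_def cball_eq_atLeastAtMost)
    also have "\<dots> = ennreal (10 / c) * ennreal (c * r (h n))"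
      using c r[OF hE] by (simp add: ennreal_mult[symmetric])
    also have "\<dots> \<le> ennreal (10 / c) * emeasure \<nu> (B n)"
      using True r[OF hE] by (auto simp: B_def intro!: mult_left_mono)
    finally show ?thesis .
  qed (simp add: A_def)
  have disj: "disjoint_family B"
    using C(3) hC hinj by (auto simp: disjoint_family_on_def B_def pairwise_def disjnt_def)
  have "emeasure lborel (\<Union>n. A n) \<le> (\<Sum>n. emeasure lborel (A n))"
    by (rule emeasure_subadditive_countably[OF Am])
  also have "\<dots> \<le> (\<Sum>n. ennreal (10 / c) * emeasure \<nu> (B n))"
    by (intro suminf_le AB) auto
  also have "\<dots> = ennreal (10 / c) * (\<Sum>n. emeasure \<nu> (B n))"
    by simp
  also have "\<dots> = ennreal (10 / c) * emeasure \<nu> (\<Union>n. B n)"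
    by (simp add: suminf_emeasure[OF Bm disj])
  also have "\<dots> \<le> ennreal (10 / c) * emeasure \<nu> U"
  proof (intro mult_left_mono emeasure_mono Um)
    show "(\<Union>n. B n) \<subseteq> U"
      using r hC C(2) by (force simp: B_def split: if_splits)
  qed auto
  finally have le: "emeasure lborel (\<Union>n. A n) \<le> ennreal (10 / c) * emeasure \<nu> U" .
  have sub: "E \<subseteq> (\<Union>n. A n)"
  proof
    fix x assume "x \<in> E"
    then obtain i where i: "i \<in> C" "x \<in> cball i (5 * r i)" using C(4) by auto
    have "to_nat_on C i \<in> J" "h (to_nat_on C i) = i"
      using i C(1) by (auto simp: J_def h_def)
    then have "x \<in> A (to_nat_on C i)" using i by (simp add: A_def)
    then show "x \<in> (\<Union>n. A n)" by blast
  qed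
  have "(\<Union>n. A n) \<in> sets borel"
    using Am by auto
  then show ?thesis
    using sub le by blast
qed

lemma null_superset:
  fixes E :: "real set"
  assumes "\<And>\<epsilon>::real. 0 < \<epsilon> \<Longrightarrow> \<exists>E'\<in>sets borel. E \<subseteq> E' \<and> emeasure lborel E' \<le> ennreal \<epsilon>"
  shows "\<exists>N\<in>null_sets lborel. E \<subseteq> N"
proof -
  have "\<forall>n::nat. \<exists>E'\<in>sets borel. E \<subseteq> E' \<and> emeasure lborel E' \<le> ennreal (1 / Suc n)"
    using assms by simp
  then obtain F where F: "\<And>n::nat. F n \<in> sets borel \<and> E \<subseteq> F n \<and> emeasure lborel (F n) \<le> ennreal (1 / Suc n)"
    by metis
  define N where "N = (\<Inter>n. F n)"
  have Nm: "N \<in> sets lborel" using F by (auto simp: N_def)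
  have "emeasure lborel N \<le> ennreal (1 / Suc n)" for n
    using F[of n] emeasure_mono[of N "F n" lborel] by (force simp: N_def)
  then have "emeasure lborel N \<le> 0"
  proof (intro LIMSEQ_le_const[where X = "\<lambda>n. ennreal (1 / Suc n)"])
    show "(\<lambda>n. ennreal (1 / Suc n)) \<longlonglongrightarrow> 0"
      using tendsto_ennrealI[OF LIMSEQ_inverse_real_of_nat] by (simp add: inverse_eq_divide)
  qed auto
  then show ?thesis
    using Nm F by (intro bexI[of _ N]) (auto simp: N_def null_sets_def)
qed

lemma open_outer_null:
  fixes \<nu> :: "real measure"
  assumes "sets \<nu> = sets borel" "emeasure \<nu> (space \<nu>) < \<infinity>" "A \<in> sets borel" "emeasure \<nu> A = 0" "0 < (\<epsilon>::real)"
  shows "\<exists>U. open U \<and> A \<subseteq> U \<and> emeasure \<nu> U \<le> ennreal \<epsilon>"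
proof -
  have "(INF U\<in>{U. A \<subseteq> U \<and> open U}. emeasure \<nu> U) = 0"
    using outer_regular[of \<nu> A] assms by auto
  then have "(INF U\<in>{U. A \<subseteq> U \<and> open U}. emeasure \<nu> U) < ennreal \<epsilon>"
    using assms by simp
  then show ?thesis
    unfolding INF_less_iff by (auto intro: less_imp_le)
qed

text \<open>For rational q the exceptional points with \<open>g t \<le> q\<close> lie in a set that
  the measure with density max (g - q) 0 does not charge. An open neighbourhood of small mass
  contains, around each exceptional point, an interval whose mass is at least a fixed multiple of
  its length, so the weak-type estimate makes the exceptional set null.\<close>

lemma lebesgue_upper_differentiation:
  fixes g :: "real \<Rightarrow> real"
  assumes g: "integrable lborel g"
  shows "AE t in lborel. t \<in> {0..1} \<longrightarrow> (\<forall>\<epsilon>>0. \<exists>\<delta>>0. \<forall>a b. a \<le> t \<longrightarrow> t \<le> b \<longrightarrow> a < b \<longrightarrow> b - a < \<delta> \<longrightarrow>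
     (LINT r:{a..b}|lborel. g r) \<le> (g t + \<epsilon>) * (b - a))"
proof -
  have gm[measurable]: "g \<in> borel_measurable borel"
    using g by (simp add: borel_measurable_integrable)
  define E where "E q n = {t\<in>{0..1}. g t \<le> q \<and> (\<forall>\<delta>>0. \<exists>a b. a \<le> t \<and> t \<le> b \<and> a < b \<and> b - a < \<delta> \<and>
      (LINT r:{a..b}|lborel. g r) > (q + 1 / real (Suc n)) * (b - a))}" for q n
  have Enull: "\<exists>N\<in>null_sets lborel. E q n \<subseteq> N" for q n
  proof (rule null_superset)
    fix \<epsilon> :: real assume \<epsilon>: "0 < \<epsilon>"
    define c where "c = 1 / real (Suc n)"
    have c: "0 < c" by (simp add: c_def)
    \<comment> \<open>The cut-off keeps the density integrable when q is negative. The intervals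
      considered meet [0,1] and are shorter than 1, so they stay inside [-1,2].\<close>
    define k where "k r = max (g r - q) 0 * indicator {-1..2} r" for r
    have km[measurable]: "k \<in> borel_measurable borel" by (simp add: k_def[abs_def])
    have k0: "0 \<le> k r" for r by (simp add: k_def)
    have kint: "integrable lborel k"
    proof (rule Bochner_Integration.integrable_bound[where f = "\<lambda>r. \<bar>g r\<bar> + \<bar>q\<bar> * indicator {-1..2} r"])
      show "integrable lborel (\<lambda>r. \<bar>g r\<bar> + \<bar>q\<bar> * indicator {-1..2::real} r)"
        using g by (intro Bochner_Integration.integrable_add integrable_abs integrable_mult_right) auto
    qed (auto simp: k_def indicator_def)
    define \<nu> where "\<nu> = density lborel (\<lambda>r. ennreal (k r))"
    have \<nu>s: "sets \<nu> = sets borel" by (simp add: \<nu>_def)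
    have \<nu>fin: "emeasure \<nu> (space \<nu>) < \<infinity>"
      using kint k0 by (simp add: \<nu>_def emeasure_density nn_integral_eq_integral)
    have \<nu>fin': "emeasure \<nu> V < \<infinity>" for V
      using emeasure_space[of \<nu> V] \<nu>fin by (simp add: le_less_trans)
    define A where "A = {t\<in>{0..1}. g t \<le> q}"
    have Am: "A \<in> sets borel" by (simp add: A_def)
    have "emeasure \<nu> A = (\<integral>\<^sup>+ r. ennreal (k r) * indicator A r \<partial>lborel)"
      unfolding \<nu>_def using Am by (subst emeasure_density) auto
    also have "\<dots> = (\<integral>\<^sup>+ (r::real). 0 \<partial>lborel)"
      by (intro nn_integral_cong) (auto simp: A_def k_def indicator_def)
    finally have A0: "emeasure \<nu> A = 0" by simp
    obtain V where V: "open V" "A \<subseteq> V" "emeasure \<nu> V \<le> ennreal (\<epsilon> * c / 10)"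
      using open_outer_null[OF \<nu>s \<nu>fin Am A0, of "\<epsilon> * c / 10"] \<epsilon> c by auto
    have "\<exists>E'\<in>sets borel. E q n \<subseteq> E' \<and> emeasure lborel E' \<le> ennreal (10 / c) * emeasure \<nu> V"
    proof (rule covering_weak_type[OF \<nu>s \<nu>fin' V(1) c])
      fix t assume t: "t \<in> E q n"
      then have "t \<in> V" "t \<in> {0..1}" using V(2) by (auto simp: E_def A_def)
      then obtain e where e: "0 < e" "cball t e \<subseteq> V" using V(1) open_contains_cball by blast
      obtain a b where ab: "a \<le> t" "t \<le> b" "a < b" "b - a < min e 1"
        "(LINT r:{a..b}|lborel. g r) > (q + c) * (b - a)"
        using t e unfolding E_def c_def by (auto dest!: spec[of _ "min e 1"])
      \<comment> \<open>The point t need not be the centre of the interval; the ball of radius b - a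
        contains the interval in any case, at the cost of a constant factor.\<close>
      have sub: "{a..b} \<subseteq> cball t (b - a)" "{a..b} \<subseteq> {-1..2}"
        using ab \<open>t \<in> {0..1}\<close> by (auto simp: dist_real_def)
      have gi: "set_integrable lborel {a..b} g"
        using g unfolding set_integrable_def by (intro integrable_mult_indicator) auto
      have ki: "set_integrable lborel {a..b} k"
        using kint unfolding set_integrable_def by (intro integrable_mult_indicator) auto
      have qi: "set_integrable lborel {a..b} (\<lambda>r. q)"
        unfolding set_integrable_def by (intro integrable_scaleR_left integrable_real_indicator) (use ab in auto)
      have "(LINT r:{a..b}|lborel. g r) \<le> (LINT r:{a..b}|lborel. q + k r)"
        using sub(2) by (intro set_integral_mono gi set_integral_add ki qi) (auto simp: k_def)
      also have "\<dots> = (LINT r:{a..b}|lborel. q) + (LINT r:{a..b}|lborel. k r)"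
        by (intro set_integral_add ki qi)
      also have "(LINT r:{a..b}|lborel. q) = q * (b - a)"
        using ab by (simp add: set_lebesgue_integral_def)
      finally have "c * (b - a) \<le> (LINT r:{a..b}|lborel. k r)"
        using ab by (simp add: algebra_simps)
      then have "ennreal (c * (b - a)) \<le> ennreal (LINT r:{a..b}|lborel. k r)"
        by (rule ennreal_leI)
      also have "\<dots> = emeasure \<nu> {a..b}"
        unfolding \<nu>_def set_lebesgue_integral_def
        using ki k0 by (subst emeasure_density)
          (auto simp: set_integrable_def nn_integral_eq_integral[symmetric] indicator_def intro!: nn_integral_cong)
      also have "\<dots> \<le> emeasure \<nu> (cball t (b - a))"
        by (intro emeasure_mono sub) (simp add: \<nu>s)
      finally show "\<exists>r>0. cball t r \<subseteq> V \<and> ennreal (c * r) \<le> emeasure \<nu> (cball t r)"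
        using ab e subset_cball[of "b - a" e t] by (intro exI[of _ "b - a"]) auto
    qed
    moreover have "ennreal (10 / c) * emeasure \<nu> V \<le> ennreal \<epsilon>"
    proof -
      have "ennreal (10 / c) * emeasure \<nu> V \<le> ennreal (10 / c) * ennreal (\<epsilon> * c / 10)"
        using V(3) by (intro mult_left_mono) auto
      also have "\<dots> = ennreal \<epsilon>"
        using c \<epsilon> by (simp add: ennreal_mult[symmetric])
      finally show ?thesis .
    qed
    ultimately show "\<exists>E'\<in>sets borel. E q n \<subseteq> E' \<and> emeasure lborel E' \<le> ennreal \<epsilon>"
      using order_trans by blast
  qed
  have "AE t in lborel. t \<notin> E q n" for q n
  proof -
    obtain N where "N \<in> null_sets lborel" "E q n \<subseteq> N" using Enull by blast
    then show ?thesis using AE_not_in[of N lborel] by (auto elim!: eventually_mono)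
  qed
  then have "AE t in lborel. \<forall>q::rat. \<forall>n. t \<notin> E (of_rat q) n"
    by (simp add: AE_all_countable)
  then show ?thesis
  proof eventually_elim
    case (elim t)
    show ?case
    proof (intro impI allI)
      fix \<epsilon> :: real assume t: "t \<in> {0..1}" and \<epsilon>: "0 < \<epsilon>"
      obtain n where n: "1 / real (Suc n) < \<epsilon> / 2"
        using \<epsilon> reals_Archimedean[of "\<epsilon> / 2"] by (auto simp: inverse_eq_divide)
      obtain q where q: "g t < of_rat q" "of_rat q < g t + \<epsilon> / 2"
        using of_rat_dense[of "g t" "g t + \<epsilon> / 2"] \<epsilon> by auto
      from elim have "t \<notin> E (of_rat q) n" by blast
      then have "\<exists>\<delta>>0. \<forall>a b. \<not> (a \<le> t \<and> t \<le> b \<and> a < b \<and> b - a < \<delta> \<and>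
          (LINT r:{a..b}|lborel. g r) > (of_rat q + 1 / real (Suc n)) * (b - a))"
        using t q(1) unfolding E_def by fastforce
      then obtain \<delta> where \<delta>: "\<delta> > 0" "\<And>a b. a \<le> t \<Longrightarrow> t \<le> b \<Longrightarrow> a < b \<Longrightarrow> b - a < \<delta> \<Longrightarrow>
          (LINT r:{a..b}|lborel. g r) \<le> (of_rat q + 1 / real (Suc n)) * (b - a)"
        by (meson linorder_not_less)
      have "(of_rat q + 1 / real (Suc n)) * (b - a) \<le> (g t + \<epsilon>) * (b - a)" if "a < b" for a b
        using that n q by (intro mult_right_mono) auto
      then show "\<exists>\<delta>>0. \<forall>a b. a \<le> t \<longrightarrow> t \<le> b \<longrightarrow> a < b \<longrightarrow> b - a < \<delta> \<longrightarrow>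
          (LINT r:{a..b}|lborel. g r) \<le> (g t + \<epsilon>) * (b - a)"
        using \<delta> order_trans by blast
    qed
  qed
qed

lemma lebesgue_differentiation:
  fixes g :: "real \<Rightarrow> real"
  assumes g: "integrable lborel g"
  shows "AE t in lborel. t \<in> {0..1} \<longrightarrow> (\<forall>\<epsilon>>0. \<exists>\<delta>>0. \<forall>a b. a \<le> t \<longrightarrow> t \<le> b \<longrightarrow> a < b \<longrightarrow> b - a < \<delta> \<longrightarrow>
     \<bar>(LINT r:{a..b}|lborel. g r) - g t * (b - a)\<bar> \<le> \<epsilon> * (b - a))"
proof -
  have "integrable lborel (\<lambda>t. - g t)" using g by simp
  from lebesgue_upper_differentiation[OF g] lebesgue_upper_differentiation[OF this]
  show ?thesis
  proof eventually_elim
    case (elim t)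
    show ?case
    proof (intro impI allI)
      fix \<epsilon> :: real assume t: "t \<in> {0..1}" and \<epsilon>: "0 < \<epsilon>"
      obtain \<delta>1 where 1: "\<delta>1 > 0" "\<And>a b. a \<le> t \<Longrightarrow> t \<le> b \<Longrightarrow> a < b \<Longrightarrow> b - a < \<delta>1 \<Longrightarrow>
          (LINT r:{a..b}|lborel. g r) \<le> (g t + \<epsilon>) * (b - a)"
        using elim(1) t \<epsilon> by blast
      obtain \<delta>2 where 2: "\<delta>2 > 0" "\<And>a b. a \<le> t \<Longrightarrow> t \<le> b \<Longrightarrow> a < b \<Longrightarrow> b - a < \<delta>2 \<Longrightarrow>
          (LINT r:{a..b}|lborel. - g r) \<le> (- g t + \<epsilon>) * (b - a)"
        using elim(2) t \<epsilon> by blast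
      show "\<exists>\<delta>>0. \<forall>a b. a \<le> t \<longrightarrow> t \<le> b \<longrightarrow> a < b \<longrightarrow> b - a < \<delta> \<longrightarrow>
         \<bar>(LINT r:{a..b}|lborel. g r) - g t * (b - a)\<bar> \<le> \<epsilon> * (b - a)"
      proof (intro exI[of _ "min \<delta>1 \<delta>2"] conjI allI impI)
        fix a b assume ab: "a \<le> t" "t \<le> b" "a < b" "b - a < min \<delta>1 \<delta>2"
        have "(LINT r:{a..b}|lborel. - g r) = - (LINT r:{a..b}|lborel. g r)"
          by (simp add: set_lebesgue_integral_def)
        then show "\<bar>(LINT r:{a..b}|lborel. g r) - g t * (b - a)\<bar> \<le> \<epsilon> * (b - a)"
          using 1(2)[of a b] 2(2)[of a b] ab by (simp add: abs_le_iff algebra_simps)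
      qed (use 1 2 in auto)
    qed
  qed
qed

text \<open>The sum of the two Stieltjes measures agrees with \<open>\<nu>\<close> on half-open
  intervals, which form an intersection-stable generator, hence on all Borel sets. Dropping the
  nonnegative second summand leaves the inequality.\<close>

lemma emeasure_interval_measure_le:
  assumes F: "\<And>x y. x \<le> y \<Longrightarrow> F x \<le> F y" "continuous_on UNIV F"
    and G: "\<And>x y. x \<le> y \<Longrightarrow> G x \<le> G y" "continuous_on UNIV G"
    and sets: "sets \<nu> = sets borel"
    and \<nu>: "\<And>a b. a \<le> b \<Longrightarrow> emeasure \<nu> {a<..b} = ennreal (F b - F a) + ennreal (G b - G a)"
    and A: "A \<in> sets borel"
  shows "emeasure (interval_measure F) A \<le> emeasure \<nu> A"
proof -
  let ?\<mu> = "\<lambda>A. emeasure (interval_measure F) A + emeasure (interval_measure G) A"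
  define S where "S = measure_of UNIV (sets borel) ?\<mu>"
  have S: "emeasure S B = ?\<mu> B" if "B \<in> sets borel" for B
    unfolding S_def
  proof (rule emeasure_measure_of_sigma)
    show "countably_additive (sets borel) ?\<mu>"
    proof (rule countably_additiveI)
      fix B :: "nat \<Rightarrow> real set" assume "range B \<subseteq> sets borel" "disjoint_family B" "\<Union> (range B) \<in> sets borel"
      then show "(\<Sum>i. ?\<mu> (B i)) = ?\<mu> (\<Union> (range B))"
        by (subst suminf_add[symmetric]) (auto simp: suminf_emeasure)
    qed
  qed (use that in \<open>auto simp: positive_def sets.sigma_algebra_axioms sets.sigma_algebra_axioms[of borel, simplified]\<close>)
  have [simp]: "sets S = sets borel"
    unfolding S_def using sets.sets_measure_of_eq[of borel] by simp
  have Ioc: "emeasure S {a<..b} = ennreal (F b - F a) + ennreal (G b - G a)" if "a \<le> b" for a b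
  proof -
    have "continuous (at_right a) F" "continuous (at_right a) G" for a
      using F(2) G(2) by (auto simp: continuous_on_eq_continuous_within intro: continuous_at_imp_continuous_within)
    then show ?thesis
      using F(1) G(1) that by (subst S) (simp_all add: emeasure_interval_measure_Ioc)
  qed
  have "S = \<nu>"
  proof (rule measure_eqI_generator_eq_countable)
    let ?E = "range (\<lambda>(a, b). {a <.. b::real})"
    show "Int_stable ?E"
    proof (rule Int_stableI)
      fix a b assume "a \<in> ?E" "b \<in> ?E"
      then obtain p q p' q' where "a = {p<..q}" "b = {p'<..q'}" by auto
      then have "a \<inter> b = (\<lambda>(a, b). {a <.. b}) (max p p', min q q')" by auto
      then show "a \<inter> b \<in> ?E" by blast
    qed
    show "?E \<subseteq> Pow UNIV" by auto
    show "emeasure S X = emeasure \<nu> X" if "X \<in> ?E" for X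
    proof -
      obtain a b where X: "X = {a<..b}" using \<open>X \<in> ?E\<close> by auto
      show ?thesis
      proof (cases "a \<le> b")
        case True then show ?thesis using Ioc \<nu> X by simp
      qed (use X in simp)
    qed
    show "sets S = sigma_sets UNIV ?E" "sets \<nu> = sigma_sets UNIV ?E"
      using sets by (simp_all add: borel_sigma_sets_Ioc)
    show "(\<lambda>n::nat. {- real n<..real n}) ` UNIV \<subseteq> ?E" by (auto simp: image_iff)
    show "\<Union> ((\<lambda>n::nat. {- real n<..real n}) ` UNIV) = UNIV"
    proof (intro equalityI subsetI)
      fix x :: real
      obtain n where "\<bar>x\<bar> < real n" using reals_Archimedean2 by blast
      then show "x \<in> \<Union> ((\<lambda>n::nat. {- real n<..real n}) ` UNIV)" by (auto intro!: exI[of _ n])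
    qed auto
    show "emeasure S a \<noteq> \<infinity>" if "a \<in> (\<lambda>n::nat. {- real n<..real n}) ` UNIV" for a
      using that Ioc by auto
  qed auto
  then show ?thesis using S[OF A] by simp
qed

text \<open>With \<open>M\<close> the primitive of \<open>m\<close>, both \<open>M + \<phi>\<close> and \<open>M - \<phi>\<close> are nondecreasing and their Stieltjes
  measures add up to \<open>2 m\<close> times Lebesgue measure; Radon-Nikodym yields the density of \<open>\<phi>\<close>.\<close>

lemma dominated_increments_absolutely_continuous:
  fixes \<phi> m :: "real \<Rightarrow> real"
  assumes m: "set_integrable lborel {0..1} m"
    and dom: "\<And>s t. 0 \<le> s \<Longrightarrow> s \<le> t \<Longrightarrow> t \<le> 1 \<Longrightarrow> \<bar>\<phi> t - \<phi> s\<bar> \<le> (LINT r:{s..t}|lborel. m r)"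
  shows "\<exists>\<delta>. integrable lborel \<delta> \<and>
    (\<forall>s t. 0 \<le> s \<longrightarrow> s \<le> t \<longrightarrow> t \<le> 1 \<longrightarrow> \<phi> t - \<phi> s = (LINT r:{s..t}|lborel. \<delta> r)) \<and>
    (AE t in lborel. t \<in> {0..1} \<longrightarrow> (\<phi> has_real_derivative \<delta> t) (at t within {0..1})) \<and>
    (AE t in lborel. t \<in> {0..1} \<longrightarrow> \<bar>\<delta> t\<bar> \<le> \<bar>m t\<bar>)"
proof -
  \<comment> \<open>Cutting off outside the unit interval and taking absolute values makes
    \<open>\<nu>\<close> a finite measure, so that its distribution function can serve as the
    primitive.\<close>
  define m' where "m' r = \<bar>indicator {0..1} r * m r\<bar>" for r
  have m'int: "integrable lborel m'"
    using m unfolding m'_def set_integrable_def by simp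
  have m'0: "0 \<le> m' r" for r by (simp add: m'_def)
  have m'm[measurable]: "m' \<in> borel_measurable borel"
    using m'int by (simp add: borel_measurable_integrable)
  have m'set: "set_integrable lborel A m'" if "A \<in> sets borel" for A
    using m'int that unfolding set_integrable_def by (intro integrable_mult_indicator) auto
  define \<nu> where "\<nu> = density lborel (\<lambda>r. ennreal (m' r))"
  have \<nu>s[simp]: "sets \<nu> = sets borel" "space \<nu> = UNIV" by (simp_all add: \<nu>_def)
  have \<nu>eq: "emeasure \<nu> A = ennreal (LINT r:A|lborel. m' r)" if "A \<in> sets borel" for A
    unfolding \<nu>_def set_lebesgue_integral_def
    using m'set[OF that] m'0 that by (subst emeasure_density)
      (auto simp: set_integrable_def nn_integral_eq_integral[symmetric] indicator_def intro!: nn_integral_cong)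
  have \<nu>fin: "finite_measure \<nu>"
    by (rule finite_measureI) (simp add: \<nu>eq)
  interpret \<nu>: finite_borel_measure \<nu>
    using \<nu>fin by (simp add: finite_borel_measure_def finite_borel_measure_axioms_def)
  have \<nu>meas: "measure \<nu> A = (LINT r:A|lborel. m' r)" if "A \<in> sets borel" for A
    unfolding measure_def \<nu>eq[OF that] set_lebesgue_integral_def
    by (intro enn2real_ennreal integral_nonneg) (auto simp: m'0)
  define M where "M = cdf \<nu>"
  have null: "measure \<nu> {x} = 0" for x
  proof -
    have "emeasure \<nu> {x} = (\<integral>\<^sup>+ r\<in>{x}. ennreal (m' r) \<partial>lborel)"
      unfolding \<nu>_def by (subst emeasure_density) auto
    also have "\<dots> = 0"
      by (rule nn_integral_null_set) (simp add: null_sets_def)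
    finally show ?thesis by (simp add: measure_def)
  qed
  have Mcont: "isCont M x" for x
    unfolding M_def using \<nu>.isCont_cdf null by blast
  have Mdiff: "M t - M s = (LINT r:{s..t}|lborel. m' r)" if "s \<le> t" for s t
  proof (cases "s = t")
    case True
    then show ?thesis using \<nu>meas[of "{t}"] null by simp
  next
    case False
    then have "M t - M s = measure \<nu> {s<..t}"
      using that unfolding M_def by (subst \<nu>.cdf_diff_eq) auto
    also have "\<dots> = measure \<nu> {s<..t} + measure \<nu> {s}" by (simp add: null)
    also have "\<dots> = measure \<nu> ({s<..t} \<union> {s})"
      by (intro \<nu>.finite_measure_Union[symmetric]) auto
    also have "{s<..t} \<union> {s} = {s..t}" using that by auto
    finally show ?thesis by (simp add: \<nu>meas)
  qed
  \<comment> \<open>Freezing the time outside the unit interval extends the increments of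
    \<open>\<phi>\<close> to the whole line while they stay dominated by those of
    \<open>M\<close>.\<close>
  define c :: "real \<Rightarrow> real" where "c t = max 0 (min 1 t)" for t
  have step: "\<bar>\<phi> (c t) - \<phi> (c s)\<bar> \<le> M t - M s" if "s \<le> t" for s t
  proof -
    have c: "0 \<le> c s" "c s \<le> c t" "c t \<le> 1" using that by (auto simp: c_def)
    have "\<bar>\<phi> (c t) - \<phi> (c s)\<bar> \<le> (LINT r:{c s..c t}|lborel. m r)" using dom c by blast
    also have "\<dots> \<le> (LINT r:{c s..c t}|lborel. m' r)"
    proof (rule set_integral_mono)
      show "set_integrable lborel {c s..c t} m"
        using c by (intro set_integrable_subset[OF m]) auto
      show "set_integrable lborel {c s..c t} m'" by (simp add: m'set)
      show "m r \<le> m' r" if "r \<in> {c s..c t}" for r using that c by (simp add: m'_def)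
    qed
    also have "\<dots> = measure \<nu> {c s..c t}" by (simp add: \<nu>meas)
    also have "\<dots> = M (c t) - M (c s)" using c by (simp add: Mdiff \<nu>meas)
    also have "\<dots> \<le> M t - M s"
    proof (cases "0 \<le> t \<and> s \<le> 1")
      case True
      then have "{c s..c t} \<subseteq> {s..t}" by (auto simp: c_def)
      then show ?thesis
        using c that \<nu>.finite_measure_mono[of "{c s..c t}" "{s..t}"] by (simp add: Mdiff \<nu>meas)
    next
      case False
      then have "c s = c t" using that by (auto simp: c_def)
      moreover have "M s \<le> M t" using that unfolding M_def by (simp add: \<nu>.cdf_nondecreasing)
      ultimately show ?thesis by simp
    qed
    finally show ?thesis .
  qed
  have stepa: "\<bar>\<phi> (c t) - \<phi> (c s)\<bar> \<le> \<bar>M t - M s\<bar>" for s t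
    using step[of s t] step[of t s] by linarith
  have \<phi>cont: "isCont (\<lambda>t. \<phi> (c t)) x" for x
  proof -
    have "((\<lambda>t. \<bar>M t - M x\<bar>) \<longlongrightarrow> \<bar>M x - M x\<bar>) (at x)"
      using Mcont[of x] unfolding isCont_def by (intro tendsto_intros)
    then have "((\<lambda>t. \<bar>M t - M x\<bar>) \<longlongrightarrow> 0) (at x)" by simp
    then have "((\<lambda>t. \<phi> (c t) - \<phi> (c x)) \<longlongrightarrow> 0) (at x)"
      by (rule Lim_null_comparison[rotated]) (use stepa in auto)
    then show ?thesis
      unfolding isCont_def by (simp add: LIM_zero_iff)
  qed
  define F where "F t = M t + \<phi> (c t)" for t
  define G where "G t = M t - \<phi> (c t)" for t
  have F: "x \<le> y \<Longrightarrow> F x \<le> F y" and G: "x \<le> y \<Longrightarrow> G x \<le> G y" for x y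
    using step[of x y] by (auto simp: F_def G_def)
  have Fc: "continuous_on UNIV F" and Gc: "continuous_on UNIV G"
    unfolding F_def[abs_def] G_def[abs_def]
    by (intro continuous_intros continuous_at_imp_continuous_on ballI Mcont \<phi>cont)+
  define \<nu>2 where "\<nu>2 = density lborel (\<lambda>r. ennreal (2 * m' r))"
  have \<nu>2: "emeasure \<nu>2 A = ennreal 2 * emeasure \<nu> A" if "A \<in> sets borel" for A
    unfolding \<nu>2_def \<nu>_def using that
    by (subst (1 2) emeasure_density) (auto simp: ennreal_mult' nn_integral_cmult mult.assoc)
  have "emeasure (interval_measure F) A \<le> emeasure \<nu>2 A" if A: "A \<in> sets borel" for A
  proof (rule emeasure_interval_measure_le[OF F Fc G Gc _ _ A])
    show "sets \<nu>2 = sets borel" by (simp add: \<nu>2_def)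
    fix a b :: real assume ab: "a \<le> b"
    have "emeasure \<nu> {a<..b} = ennreal (M b - M a)"
    proof (cases "a = b")
      case False
      then show ?thesis using ab unfolding M_def
        by (subst \<nu>.cdf_diff_eq) (auto simp: \<nu>.emeasure_eq_measure)
    qed simp
    then have "emeasure \<nu>2 {a<..b} = ennreal (2 * (M b - M a))"
      using \<nu>2[of "{a<..b}"] ennreal_mult'[of 2 "M b - M a"] by simp
    also have "2 * (M b - M a) = (F b - F a) + (G b - G a)" by (simp add: F_def G_def)
    finally show "emeasure \<nu>2 {a<..b} = ennreal (F b - F a) + ennreal (G b - G a)"
      using F[OF ab] G[OF ab] by simp
  qed
  note le = this
  have "absolutely_continuous lborel (interval_measure F)"
    unfolding absolutely_continuous_def
  proof
    fix N :: "real set" assume N: "N \<in> null_sets lborel"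
    then have "emeasure \<nu>2 N = 0"
      unfolding \<nu>2_def by (subst emeasure_density) (auto simp: null_sets_def intro!: nn_integral_null_set)
    then show "N \<in> null_sets (interval_measure F)"
      using le[of N] N by (auto simp: null_sets_def)
  qed
  then obtain f where f[measurable]: "f \<in> borel_measurable borel" and fd: "density lborel f = interval_measure F"
    using sigma_finite_measure.Radon_Nikodym[OF sigma_finite_lborel, of "interval_measure F"] by auto
  have "(\<integral>\<^sup>+ r. f r \<partial>lborel) = emeasure (interval_measure F) UNIV"
    unfolding fd[symmetric] by (subst emeasure_density) auto
  also have "\<dots> \<le> emeasure \<nu>2 UNIV" by (intro le) simp
  also have "\<dots> < \<infinity>" by (simp add: \<nu>2 \<nu>eq ennreal_mult_less_top)
  finally have ffin: "(\<integral>\<^sup>+ r. f r \<partial>lborel) < \<infinity>" .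
  then have fae: "AE r in lborel. f r \<noteq> \<infinity>" by (intro nn_integral_PInf_AE) auto
  define h where "h r = enn2real (f r)" for r
  have hm[measurable]: "h \<in> borel_measurable borel" by (simp add: h_def[abs_def])
  have hf: "AE r in lborel. f r = ennreal (h r)"
    using fae by eventually_elim (simp add: h_def less_top)
  have hint: "integrable lborel h"
  proof (rule integrableI_bounded)
    have "(\<integral>\<^sup>+ r. ennreal (norm (h r)) \<partial>lborel) = (\<integral>\<^sup>+ r. f r \<partial>lborel)"
      by (rule nn_integral_cong_AE) (use hf in \<open>eventually_elim, simp add: h_def\<close>)
    then show "(\<integral>\<^sup>+ r. ennreal (norm (h r)) \<partial>lborel) < \<infinity>" using ffin by simp
  qed simp
  have hset: "set_integrable lborel A h" if "A \<in> sets borel" for A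
    using hint that unfolding set_integrable_def by (intro integrable_mult_indicator) auto
  have Fdiff: "F t - F s = (LINT r:{s..t}|lborel. h r)" if st: "s \<le> t" for s t
  proof -
    have "ennreal (F t - F s) = emeasure (interval_measure F) {s..t}"
      using emeasure_interval_measure_Icc[OF st F Fc] by simp
    also have "\<dots> = (\<integral>\<^sup>+ r. f r * indicator {s..t} r \<partial>lborel)"
      unfolding fd[symmetric] by (subst emeasure_density) auto
    also have "\<dots> = (\<integral>\<^sup>+ r. ennreal (indicator {s..t} r *\<^sub>R h r) \<partial>lborel)"
      by (rule nn_integral_cong_AE) (use hf in \<open>eventually_elim, simp add: indicator_def\<close>)
    also have "\<dots> = ennreal (LINT r:{s..t}|lborel. h r)"
      unfolding set_lebesgue_integral_def using hset[of "{s..t}"]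
      by (subst nn_integral_eq_integral) (auto simp: set_integrable_def h_def)
    finally show ?thesis
      using F[OF st] by (subst (asm) ennreal_inj)
        (auto simp: set_lebesgue_integral_def h_def intro!: integral_nonneg)
  qed
  define \<delta> where "\<delta> r = h r - m' r" for r
  have \<delta>int: "integrable lborel \<delta>" unfolding \<delta>_def using hint m'int by simp
  have rep: "\<phi> t - \<phi> s = (LINT r:{s..t}|lborel. \<delta> r)" if "0 \<le> s" "s \<le> t" "t \<le> 1" for s t
  proof -
    have "(LINT r:{s..t}|lborel. \<delta> r) = (F t - F s) - (M t - M s)"
      using that unfolding \<delta>_def by (simp add: Fdiff Mdiff set_integral_diff hset m'set)
    also have "\<dots> = \<phi> t - \<phi> s" using that by (simp add: F_def c_def)
    finally show ?thesis by simp
  qed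
  have der: "AE t in lborel. t \<in> {0..1} \<longrightarrow> (\<phi> has_real_derivative \<delta> t) (at t within {0..1})"
    using lebesgue_differentiation[OF \<delta>int]
  proof eventually_elim
    case (elim t)
    show ?case
    proof
      assume t: "t \<in> {0..1}"
      show "(\<phi> has_real_derivative \<delta> t) (at t within {0..1})"
        unfolding has_field_derivative_def has_derivative_within_alt
      proof (intro conjI allI impI)
        show "bounded_linear ((*) (\<delta> t))" by (rule bounded_linear_mult_right)
        fix \<epsilon> :: real assume "0 < \<epsilon>"
        then obtain d where d: "d > 0" "\<And>a b. a \<le> t \<Longrightarrow> t \<le> b \<Longrightarrow> a < b \<Longrightarrow> b - a < d \<Longrightarrow>
           \<bar>(LINT r:{a..b}|lborel. \<delta> r) - \<delta> t * (b - a)\<bar> \<le> \<epsilon> * (b - a)"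
          using elim t by blast
        show "\<exists>d>0. \<forall>y\<in>{0..1}. norm (y - t) < d \<longrightarrow> norm (\<phi> y - \<phi> t - \<delta> t * (y - t)) \<le> \<epsilon> * norm (y - t)"
        proof (intro exI[of _ d] conjI ballI impI d(1))
          fix y :: real assume y: "y \<in> {0..1}" "norm (y - t) < d"
          consider "y = t" | "y < t" | "t < y" by linarith
          then show "norm (\<phi> y - \<phi> t - \<delta> t * (y - t)) \<le> \<epsilon> * norm (y - t)"
          proof cases
            case 2
            then show ?thesis using d(2)[of y t] rep[of y t] y t by (simp add: algebra_simps abs_if split: if_splits)
          next
            case 3
            then show ?thesis using d(2)[of t y] rep[of t y] y t by (simp add: algebra_simps)
          qed simp
        qed
      qed
    qed
  qed
  have bnd: "AE t in lborel. t \<in> {0..1} \<longrightarrow> \<bar>\<delta> t\<bar> \<le> \<bar>m t\<bar>"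
    using lebesgue_differentiation[OF \<delta>int] lebesgue_differentiation[OF m'int]
  proof eventually_elim
    case (elim t)
    show ?case
    proof
      assume t: "t \<in> {0..1}"
      have "\<bar>\<delta> t\<bar> \<le> m' t + \<epsilon>" if \<epsilon>: "0 < \<epsilon>" for \<epsilon>
      proof -
        have \<epsilon>2: "0 < \<epsilon> / 2" using \<epsilon> by simp
        obtain d1 where d1: "d1 > 0" "\<And>a b. a \<le> t \<Longrightarrow> t \<le> b \<Longrightarrow> a < b \<Longrightarrow> b - a < d1 \<Longrightarrow>
           \<bar>(LINT r:{a..b}|lborel. \<delta> r) - \<delta> t * (b - a)\<bar> \<le> \<epsilon> / 2 * (b - a)"
          using elim(1) t \<epsilon>2 by blast
        obtain d2 where d2: "d2 > 0" "\<And>a b. a \<le> t \<Longrightarrow> t \<le> b \<Longrightarrow> a < b \<Longrightarrow> b - a < d2 \<Longrightarrow>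
           \<bar>(LINT r:{a..b}|lborel. m' r) - m' t * (b - a)\<bar> \<le> \<epsilon> / 2 * (b - a)"
          using elim(2) t \<epsilon>2 by blast
        \<comment> \<open>With d at most 1/2, one of the intervals [t, t + d] and [t - d, t] lies in
          [0,1]; the differentiation theorem admits one-sided intervals.\<close>
        define d where "d = min (min d1 d2) 1 / 2"
        have d: "0 < d" "d < d1" "d < d2" "d \<le> 1 / 2" using d1 d2 by (auto simp: d_def)
        obtain a b where ab: "a \<le> t" "t \<le> b" "a < b" "b - a = d" "0 \<le> a" "b \<le> 1"
        proof (cases "t \<le> 1 / 2")
          case True then show ?thesis using that[of t "t + d"] d t by auto
        next
          case False then show ?thesis using that[of "t - d" t] d t by auto
        qed
        have "\<bar>LINT r:{a..b}|lborel. \<delta> r\<bar> \<le> (LINT r:{a..b}|lborel. m' r)"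
          using rep[of a b] dom[of a b] step[of a b] Mdiff[of a b] ab by (simp add: c_def)
        moreover have "\<bar>(LINT r:{a..b}|lborel. \<delta> r) - \<delta> t * d\<bar> \<le> \<epsilon> * d / 2"
          using d1(2)[of a b] ab d by simp
        moreover have "\<bar>(LINT r:{a..b}|lborel. m' r) - m' t * d\<bar> \<le> \<epsilon> * d / 2"
          using d2(2)[of a b] ab d by simp
        ultimately have "\<bar>\<delta> t * d\<bar> \<le> m' t * d + \<epsilon> * d"
          by linarith
        then have "\<bar>\<delta> t\<bar> * d \<le> (m' t + \<epsilon>) * d"
          using d by (simp add: abs_mult algebra_simps)
        then show ?thesis using d by simp
      qed
      then have "\<bar>\<delta> t\<bar> \<le> m' t" by (rule field_le_epsilon)
      then show "\<bar>\<delta> t\<bar> \<le> \<bar>m t\<bar>" using t by (simp add: m'_def)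
    qed
  qed
  show ?thesis
    using \<delta>int rep der bnd by (intro exI[of _ \<delta>]) blast
qed

section \<open>Metric derivatives of absolutely continuous curves\<close>

text \<open>The distances \<open>D n\<close> to a dense sequence are real functions whose increments
  have supremum d, so their derivatives should have supremum equal to the speed. Each derivative
  bounds the difference quotient from below in the limit. Conversely, the supremum \<open>S\<close>
  integrates to an upper bound for d, and Lebesgue differentiation of \<open>S\<close> gives the
  matching upper limit.\<close>

lemma metric_derivative_exists:
  fixes d :: "'a \<Rightarrow> 'a \<Rightarrow> real" and \<gamma> :: "real \<Rightarrow> 'a" and q :: "nat \<Rightarrow> 'a"
  assumes sym: "\<And>x y. d x y = d y x"
    and tri: "\<And>x y z. d x z \<le> d x y + d y z"
    and dense: "\<And>x e. 0 < e \<Longrightarrow> \<exists>n. d x (q n) < e"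
    and m: "set_integrable lborel {0..1::real} m"
    and dom: "\<And>s t. 0 \<le> s \<Longrightarrow> s \<le> t \<Longrightarrow> t \<le> 1 \<Longrightarrow> d (\<gamma> s) (\<gamma> t) \<le> (LINT r:{s..t}|lborel. m r)"
  shows "\<exists>S. integrable lborel S \<and> (\<forall>r. 0 \<le> S r) \<and>
     (\<forall>s t. 0 \<le> s \<longrightarrow> s \<le> t \<longrightarrow> t \<le> 1 \<longrightarrow> d (\<gamma> s) (\<gamma> t) \<le> (LINT r:{s..t}|lborel. S r)) \<and>
     (AE t in lborel. t \<in> {0..1} \<longrightarrow> ((\<lambda>s. d (\<gamma> s) (\<gamma> t) / \<bar>s - t\<bar>) \<longlongrightarrow> S t) (at t within {0..1}))"
proof -
  define D where "D n t = d (\<gamma> t) (q n)" for n t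
  have Dlip: "\<bar>D n t - D n s\<bar> \<le> d (\<gamma> s) (\<gamma> t)" for n s t
    using tri[of "\<gamma> t" "q n" "\<gamma> s"] tri[of "\<gamma> s" "q n" "\<gamma> t"] sym[of "\<gamma> s" "\<gamma> t"] by (simp add: D_def)
  have Dsup: "\<exists>n. d (\<gamma> s) (\<gamma> t) - e < \<bar>D n t - D n s\<bar>" if e: "0 < e" for s t e
  proof -
    obtain n where n: "d (\<gamma> s) (q n) < e / 2" using dense[of "e / 2"] e by auto
    have "d (\<gamma> s) (\<gamma> t) \<le> d (\<gamma> s) (q n) + d (\<gamma> t) (q n)"
      using tri[of "\<gamma> s" "\<gamma> t" "q n"] sym by metis
    then have "d (\<gamma> s) (\<gamma> t) - e < D n t - D n s" using n by (simp add: D_def)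
    then show ?thesis by (intro exI[of _ n]) linarith
  qed
  have dom': "\<bar>D n t - D n s\<bar> \<le> (LINT r:{s..t}|lborel. m r)" if "0 \<le> s" "s \<le> t" "t \<le> 1" for n s t
    using Dlip dom[OF that] by (rule order_trans)
  have "\<forall>n. \<exists>\<delta>. integrable lborel \<delta> \<and>
    (\<forall>s t. 0 \<le> s \<longrightarrow> s \<le> t \<longrightarrow> t \<le> 1 \<longrightarrow> D n t - D n s = (LINT r:{s..t}|lborel. \<delta> r)) \<and>
    (AE t in lborel. t \<in> {0..1} \<longrightarrow> (D n has_real_derivative \<delta> t) (at t within {0..1})) \<and>
    (AE t in lborel. t \<in> {0..1} \<longrightarrow> \<bar>\<delta> t\<bar> \<le> \<bar>m t\<bar>)"
    by (intro allI dominated_increments_absolutely_continuous[OF m] dom')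
  from choice[OF this] obtain \<delta> where \<delta>: "\<forall>n. integrable lborel (\<delta> n) \<and>
    (\<forall>s t. 0 \<le> s \<longrightarrow> s \<le> t \<longrightarrow> t \<le> 1 \<longrightarrow> D n t - D n s = (LINT r:{s..t}|lborel. \<delta> n r)) \<and>
    (AE t in lborel. t \<in> {0..1} \<longrightarrow> (D n has_real_derivative \<delta> n t) (at t within {0..1})) \<and>
    (AE t in lborel. t \<in> {0..1} \<longrightarrow> \<bar>\<delta> n t\<bar> \<le> \<bar>m t\<bar>)" ..
  then have \<delta>int: "integrable lborel (\<delta> n)"
    and rep: "\<And>s t. 0 \<le> s \<Longrightarrow> s \<le> t \<Longrightarrow> t \<le> 1 \<Longrightarrow> D n t - D n s = (LINT r:{s..t}|lborel. \<delta> n r)"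
    and der: "AE t in lborel. t \<in> {0..1} \<longrightarrow> (D n has_real_derivative \<delta> n t) (at t within {0..1})"
    and bnd: "AE t in lborel. t \<in> {0..1} \<longrightarrow> \<bar>\<delta> n t\<bar> \<le> \<bar>m t\<bar>" for n
    by blast+
  have \<delta>m[measurable]: "\<delta> n \<in> borel_measurable borel" for n
    using \<delta>int[of n] by (simp add: borel_measurable_integrable)
  \<comment> \<open>Where the supremum is infinite, \<open>enn2real\<close> returns 0; on the unit
    interval the supremum is almost everywhere at most |m t|.\<close>
  define S where "S t = enn2real (SUP n. ennreal \<bar>indicator {0..1} t * \<delta> n t\<bar>)" for t
  have Sm[measurable]: "S \<in> borel_measurable borel" by (simp add: S_def[abs_def])
  have S0: "0 \<le> S t" for t by (simp add: S_def)
  have bnd': "AE t in lborel. \<forall>n. t \<in> {0..1} \<longrightarrow> \<bar>\<delta> n t\<bar> \<le> \<bar>m t\<bar>"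
    unfolding AE_all_countable using bnd by blast
  then have S: "AE t in lborel. t \<in> {0..1} \<longrightarrow> (\<forall>n. \<bar>\<delta> n t\<bar> \<le> S t) \<and> (\<forall>B\<ge>0. (\<forall>n. \<bar>\<delta> n t\<bar> \<le> B) \<longrightarrow> S t \<le> B)"
  proof eventually_elim
    case (elim t)
    show ?case
    proof (intro impI conjI allI)
      assume t: "t \<in> {0..1}"
      have "(SUP n. ennreal \<bar>indicator {0..1} t * \<delta> n t\<bar>) \<le> ennreal \<bar>m t\<bar>"
        using elim t by (intro SUP_least ennreal_leI) simp
      then have fin: "(SUP n. ennreal \<bar>indicator {0..1} t * \<delta> n t\<bar>) < top"
        using le_less_trans ennreal_less_top by blast
      fix n
      have "ennreal \<bar>\<delta> n t\<bar> \<le> (SUP n. ennreal \<bar>indicator {0..1} t * \<delta> n t\<bar>)"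
        using t by (intro SUP_upper2[of n]) auto
      also have "\<dots> = ennreal (S t)" using fin by (simp add: S_def)
      finally show "\<bar>\<delta> n t\<bar> \<le> S t" using S0 by (simp add: ennreal_le_iff)
    next
      fix B :: real assume "t \<in> {0..1}" "0 \<le> B" "\<forall>n. \<bar>\<delta> n t\<bar> \<le> B"
      then have "(SUP n. ennreal \<bar>indicator {0..1} t * \<delta> n t\<bar>) \<le> ennreal B"
        by (intro SUP_least ennreal_leI) simp
      then show "S t \<le> B" unfolding S_def using \<open>0 \<le> B\<close> by (metis enn2real_ennreal enn2real_mono ennreal_less_top)
    qed
  qed
  have Sint: "integrable lborel S"
  proof (rule Bochner_Integration.integrable_bound)
    show "integrable lborel (\<lambda>t. indicator {0..1} t *\<^sub>R m t)" using m by (simp add: set_integrable_def)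
    show "AE t in lborel. norm (S t) \<le> norm (indicator {0..1} t *\<^sub>R m t)"
      using S bnd'
    proof eventually_elim
      case (elim t)
      then show ?case
      proof (cases "t \<in> {0..1}")
        case False
        then have "indicator {0..1} t = (0::real)" by (simp add: indicator_def)
        then have "S t = 0" unfolding S_def by simp
        then show ?thesis by simp
      qed (use S0 in auto)
    qed
  qed simp
  have setint: "set_integrable lborel A f" if "integrable lborel f" "A \<in> sets borel" for f :: "real \<Rightarrow> real" and A
    using that unfolding set_integrable_def by (intro integrable_mult_indicator) auto
  have dS: "d (\<gamma> s) (\<gamma> t) \<le> (LINT r:{s..t}|lborel. S r)" if st: "0 \<le> s" "s \<le> t" "t \<le> 1" for s t
  proof (rule field_le_epsilon)
    fix e :: real assume "0 < e"
    then obtain n where n: "d (\<gamma> s) (\<gamma> t) - e < \<bar>D n t - D n s\<bar>" using Dsup by blast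
    have "\<bar>D n t - D n s\<bar> \<le> (LINT r:{s..t}|lborel. \<bar>\<delta> n r\<bar>)"
      unfolding rep[OF st] set_lebesgue_integral_def
      using integral_abs_bound[of lborel "\<lambda>r. indicator {s..t} r *\<^sub>R \<delta> n r"] by (simp add: abs_mult)
    also have "\<dots> \<le> (LINT r:{s..t}|lborel. S r)"
      using S st \<delta>int unfolding set_lebesgue_integral_def
      by (intro integral_mono_AE integrable_mult_indicator Sint) (auto elim!: eventually_mono simp: indicator_def)
    finally show "d (\<gamma> s) (\<gamma> t) \<le> (LINT r:{s..t}|lborel. S r) + e" using n by simp
  qed
  have der': "AE t in lborel. \<forall>n. t \<in> {0..1} \<longrightarrow> (D n has_real_derivative \<delta> n t) (at t within {0..1})"
    unfolding AE_all_countable using der by blast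
  have lim: "AE t in lborel. t \<in> {0..1} \<longrightarrow> ((\<lambda>s. d (\<gamma> s) (\<gamma> t) / \<bar>s - t\<bar>) \<longlongrightarrow> S t) (at t within {0..1})"
    using der' S lebesgue_differentiation[OF Sint]
  proof eventually_elim
    case (elim t)
    show ?case
    proof
      assume t: "t \<in> {0..1}"
      show "((\<lambda>s. d (\<gamma> s) (\<gamma> t) / \<bar>s - t\<bar>) \<longlongrightarrow> S t) (at t within {0..1})"
      proof (rule order_tendstoI)
        fix a assume a: "a < S t"
        \<comment> \<open>A negative a is exceeded by every index. Otherwise a bound a on all
          derivatives would also bound their supremum \<open>S t\<close>.\<close>
        have "\<exists>n. max a 0 < \<bar>\<delta> n t\<bar> \<or> a < 0"
        proof (rule ccontr)
          assume "\<nexists>n. max a 0 < \<bar>\<delta> n t\<bar> \<or> a < 0"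
          then have "0 \<le> a" "\<forall>n. \<bar>\<delta> n t\<bar> \<le> a" by (auto simp: not_less max_def split: if_splits)
          then show False using elim(2) t a by force
        qed
        then obtain n where n: "a < \<bar>\<delta> n t\<bar>" by force
        have "((\<lambda>s. (D n s - D n t) / (s - t)) \<longlongrightarrow> \<delta> n t) (at t within {0..1})"
          using elim(1) t by (simp add: has_field_derivative_iff)
        then have "((\<lambda>s. \<bar>(D n s - D n t) / (s - t)\<bar>) \<longlongrightarrow> \<bar>\<delta> n t\<bar>) (at t within {0..1})"
          by (rule tendsto_rabs)
        then have "\<forall>\<^sub>F s in at t within {0..1}. a < \<bar>(D n s - D n t) / (s - t)\<bar>"
          using n by (rule order_tendstoD)
        then show "\<forall>\<^sub>F s in at t within {0..1}. a < d (\<gamma> s) (\<gamma> t) / \<bar>s - t\<bar>"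
        proof eventually_elim
          case (elim s)
          have "\<bar>(D n s - D n t) / (s - t)\<bar> \<le> d (\<gamma> s) (\<gamma> t) / \<bar>s - t\<bar>"
            using Dlip[of n s t] sym[of "\<gamma> t"] by (simp add: abs_divide divide_right_mono)
          then show ?case using elim by linarith
        qed
      next
        fix a assume a: "S t < a"
        define \<epsilon> where "\<epsilon> = (a - S t) / 2"
        have \<epsilon>: "0 < \<epsilon>" using a by (simp add: \<epsilon>_def)
        then obtain \<eta> where \<eta>: "\<eta> > 0" "\<And>a b. a \<le> t \<Longrightarrow> t \<le> b \<Longrightarrow> a < b \<Longrightarrow> b - a < \<eta> \<Longrightarrow>
           \<bar>(LINT r:{a..b}|lborel. S r) - S t * (b - a)\<bar> \<le> \<epsilon> * (b - a)"
          using elim(3) t by blast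
        have "d (\<gamma> s) (\<gamma> t) / \<bar>s - t\<bar> < a" if s: "s \<in> {0..1}" "s \<noteq> t" "\<bar>s - t\<bar> < \<eta>" for s
        proof -
          have "d (\<gamma> s) (\<gamma> t) \<le> (LINT r:{min s t..max s t}|lborel. S r)"
            using dS[of s t] dS[of t s] s t sym[of "\<gamma> s"] by (cases "s \<le> t") auto
          also have "\<dots> \<le> (S t + \<epsilon>) * \<bar>s - t\<bar>"
            using \<eta>(2)[of "min s t" "max s t"] s by (cases "s \<le> t") (auto simp: algebra_simps)
          finally have "d (\<gamma> s) (\<gamma> t) / \<bar>s - t\<bar> \<le> S t + \<epsilon>"
            using s by (simp add: divide_le_eq)
          also have "\<dots> < a" using a by (simp add: \<epsilon>_def field_simps)
          finally show ?thesis .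
        qed
        then show "\<forall>\<^sub>F s in at t within {0..1}. d (\<gamma> s) (\<gamma> t) / \<bar>s - t\<bar> < a"
          unfolding eventually_at using \<eta>(1) by (auto simp: dist_real_def intro!: exI[of _ \<eta>])
      qed
    qed
  qed
  show ?thesis
    using Sint S0 dS lim by (intro exI[of _ S]) blast
qed

text \<open>By the arithmetic-geometric mean inequality a difference quotient above \<open>\<kappa>\<close> forces \<open>S\<^sup>2\<close> to have
  average at least \<open>\<kappa>\<^sup>2/4\<close> on some interval; the resulting weak-type bound decays like \<open>\<kappa>\<^sup>-\<^sup>2\<close> and can
  be summed over dyadic \<open>\<kappa>\<close>.\<close>

lemma maximal_quotient_energy:
  fixes \<gamma> :: "real \<Rightarrow> 'a::metric_space"
  assumes S: "integrable lborel S" "\<And>r. 0 \<le> S r"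
    and dom: "\<And>s t. 0 \<le> s \<Longrightarrow> s \<le> t \<Longrightarrow> t \<le> 1 \<Longrightarrow> dist (\<gamma> s) (\<gamma> t) \<le> 2 * (LINT r:{s..t}|lborel. S r)"
    and \<mu>: "\<mu> \<in> borel_measurable borel"
    and small: "\<And>t B. t \<in> {0..1} \<Longrightarrow> 0 \<le> B \<Longrightarrow> (\<And>s. s \<in> {0..1} \<Longrightarrow> dist (\<gamma> s) (\<gamma> t) \<le> B * \<bar>s - t\<bar>) \<Longrightarrow> \<mu> t \<le> ennreal B"
  shows "(\<integral>\<^sup>+ t\<in>{0..1}. \<mu> t \<partial>lborel) \<le> 1 + 80 * (\<integral>\<^sup>+ t\<in>{0..1}. ennreal ((S t)\<^sup>2) \<partial>lborel)"
proof (cases "(\<integral>\<^sup>+ t\<in>{0..1}. ennreal ((S t)\<^sup>2) \<partial>lborel) = \<infinity>")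
  case False
  have Sm[measurable]: "S \<in> borel_measurable borel" using S by (simp add: borel_measurable_integrable)
  note [measurable] = \<mu>
  define \<nu> where "\<nu> = density lborel (\<lambda>r. ennreal ((S r)\<^sup>2) * indicator {0..1} r)"
  define I where "I = (\<integral>\<^sup>+ t\<in>{0..1}. ennreal ((S t)\<^sup>2) \<partial>lborel)"
  have \<nu>s: "sets \<nu> = sets borel" by (simp add: \<nu>_def)
  have \<nu>U: "emeasure \<nu> UNIV = I"
    unfolding \<nu>_def I_def by (subst emeasure_density) auto
  define W where "W \<kappa> = {t\<in>{0..1}. ennreal \<kappa> < \<mu> t}" for \<kappa>
  have Wm[measurable]: "W \<kappa> \<in> sets borel" for \<kappa> by (simp add: W_def)
  have weak: "emeasure lborel (W \<kappa>) \<le> ennreal (40 / \<kappa>\<^sup>2) * I" if \<kappa>: "0 < \<kappa>" for \<kappa>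
  proof -
    have "\<exists>E'\<in>sets borel. W \<kappa> \<subseteq> E' \<and> emeasure lborel E' \<le> ennreal (10 / (\<kappa>\<^sup>2 / 4)) * emeasure \<nu> UNIV"
    proof (rule covering_weak_type[OF \<nu>s])
      show "emeasure \<nu> UNIV < \<infinity>" using False \<nu>U by (simp add: I_def less_top)
      show "open (UNIV::real set)" "0 < \<kappa>\<^sup>2 / 4" using \<kappa> by auto
      fix t assume t: "t \<in> W \<kappa>"
      then obtain s where s: "s \<in> {0..1}" "\<kappa> * \<bar>s - t\<bar> < dist (\<gamma> s) (\<gamma> t)"
        using small[of t \<kappa>] \<kappa> unfolding W_def by (force simp: not_le[symmetric])
      have t1: "t \<in> {0..1}" using t by (simp add: W_def)
      define a b where "a = min s t" and "b = max s t"
      have st: "s \<noteq> t" using s by auto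
      have ab: "0 \<le> a" "a < b" "b \<le> 1" "\<bar>s - t\<bar> = b - a" using st s t1 by (auto simp: a_def b_def)
      have d: "dist (\<gamma> s) (\<gamma> t) = dist (\<gamma> a) (\<gamma> b)" by (auto simp: a_def b_def min_def max_def dist_commute)
      have Sset: "set_integrable lborel {a..b} S"
        using S(1) unfolding set_integrable_def by (intro integrable_mult_indicator) auto
      have "ennreal (LINT r:{a..b}|lborel. S r) = (\<integral>\<^sup>+ r\<in>{a..b}. ennreal (S r) \<partial>lborel)"
        using Sset S(2) unfolding set_lebesgue_integral_def set_integrable_def
        by (subst nn_integral_eq_integral[symmetric]) (auto simp: indicator_def intro!: nn_integral_cong)
      also have "\<dots> \<le> (\<integral>\<^sup>+ r\<in>{a..b}. ennreal (\<kappa> / 4) + ennreal (1 / \<kappa>) * ennreal ((S r)\<^sup>2) \<partial>lborel)"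
      proof (intro nn_integral_mono mult_right_mono)
        fix r :: real
        have "0 \<le> (S r - \<kappa> / 2)\<^sup>2 / \<kappa>" using \<kappa> by simp
        also have "\<dots> = \<kappa> / 4 + 1 / \<kappa> * (S r)\<^sup>2 - S r" using \<kappa> by (simp add: field_simps power2_eq_square)
        finally show "ennreal (S r) \<le> ennreal (\<kappa> / 4) + ennreal (1 / \<kappa>) * ennreal ((S r)\<^sup>2)"
          using \<kappa> by (simp add: ennreal_mult[symmetric] ennreal_plus[symmetric] ennreal_leI del: ennreal_plus)
      qed simp
      also have "\<dots> = (\<integral>\<^sup>+ r. ennreal (\<kappa> / 4) * indicator {a..b} r + ennreal (1 / \<kappa>) * (ennreal ((S r)\<^sup>2) * indicator {a..b} r) \<partial>lborel)"
        by (simp add: distrib_right mult.assoc)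
      also have "\<dots> = ennreal (\<kappa> / 4) * ennreal (b - a) + ennreal (1 / \<kappa>) * (\<integral>\<^sup>+ r\<in>{a..b}. ennreal ((S r)\<^sup>2) \<partial>lborel)"
        using ab by (subst nn_integral_add) (auto simp: nn_integral_cmult nn_integral_cmult_indicator)
      also have "(\<integral>\<^sup>+ r\<in>{a..b}. ennreal ((S r)\<^sup>2) \<partial>lborel) = emeasure \<nu> {a..b}"
        unfolding \<nu>_def using ab by (subst emeasure_density) (auto simp: indicator_def intro!: nn_integral_cong)
      also have "emeasure \<nu> {a..b} = ennreal (measure \<nu> {a..b})"
      proof (rule emeasure_eq_ennreal_measure)
        have "emeasure \<nu> {a..b} \<le> emeasure \<nu> UNIV" by (intro emeasure_mono) (auto simp: \<nu>s)
        then show "emeasure \<nu> {a..b} \<noteq> top" using False \<nu>U by (auto simp: I_def top_unique)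
      qed
      finally have "(LINT r:{a..b}|lborel. S r) \<le> \<kappa> / 4 * (b - a) + 1 / \<kappa> * measure \<nu> {a..b}"
        using \<kappa> ab by (simp add: ennreal_mult[symmetric] ennreal_plus[symmetric] ennreal_le_iff del: ennreal_plus)
      then have "\<kappa> * (b - a) \<le> 2 * (\<kappa> / 4 * (b - a) + 1 / \<kappa> * measure \<nu> {a..b})"
        using dom[of a b] s(2) d ab by simp
      then have "\<kappa>\<^sup>2 / 4 * (b - a) \<le> measure \<nu> {a..b}"
        using \<kappa> by (simp add: field_simps power2_eq_square)
      then have "ennreal (\<kappa>\<^sup>2 / 4 * (b - a)) \<le> ennreal (measure \<nu> {a..b})" by (rule ennreal_leI)
      also have "\<dots> \<le> emeasure \<nu> {a..b}" by (simp add: measure_def ennreal_enn2real_if)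
      also have "\<dots> \<le> emeasure \<nu> (cball t (b - a))"
        by (intro emeasure_mono) (auto simp: \<nu>s a_def b_def dist_real_def)
      finally show "\<exists>r>0. cball t r \<subseteq> UNIV \<and> ennreal (\<kappa>\<^sup>2 / 4 * r) \<le> emeasure \<nu> (cball t r)"
        using ab by (intro exI[of _ "b - a"]) auto
    qed
    then obtain E' where "E' \<in> sets borel" "W \<kappa> \<subseteq> E'" "emeasure lborel E' \<le> ennreal (40 / \<kappa>\<^sup>2) * I"
      using \<nu>U by auto
    then show ?thesis using emeasure_mono[of "W \<kappa>" E' lborel] by force
  qed
  \<comment> \<open>Dyadic layer cake: if n is the first index with \<open>\<mu> t\<close> at most
    2^n, then all levels 2^k with k < n are exceeded, and 1 plus their sum is exactly 2^n.\<close>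
  have pt: "\<mu> t * indicator {0..1} t \<le> indicator {0..1} t + (\<Sum>k. ennreal (2 ^ k) * indicator (W (2 ^ k)) t)" for t :: real
  proof (cases "t \<in> {0..1}")
    case True
    have le: "\<mu> t \<le> 1 + (\<Sum>k<n. ennreal (2 ^ k) * indicator (W (2 ^ k)) t)" if "\<mu> t \<le> ennreal (2 ^ n)" for n
      using that
    proof (induction n)
      case 0 then show ?case by simp
    next
      case (Suc n)
      show ?case
      proof (cases "\<mu> t \<le> ennreal (2 ^ n)")
        case True
        have "\<mu> t \<le> 1 + (\<Sum>k<n. ennreal (2 ^ k) * indicator (W (2 ^ k)) t)" by (rule Suc.IH[OF True])
        also have "\<dots> \<le> 1 + (\<Sum>k<Suc n. ennreal (2 ^ k) * indicator (W (2 ^ k)) t)"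
          by (intro add_left_mono) simp
        finally show ?thesis .
      next
        case False
        then have "indicator (W (2 ^ k)) t = (1::ennreal)" if "k \<le> n" for k
        proof -
          have "ennreal (2 ^ k) \<le> ennreal (2 ^ n)" using that by (intro ennreal_leI) simp
          then have "ennreal (2 ^ k) < \<mu> t" using False by (meson le_less_trans not_le)
          then show ?thesis using \<open>t \<in> {0..1}\<close> by (simp add: W_def)
        qed
        then have "(\<Sum>k<Suc n. ennreal (2 ^ k) * indicator (W (2 ^ k)) t) = (\<Sum>k<Suc n. ennreal (2 ^ k))"
          by (intro sum.cong) auto
        also have "\<dots> = ennreal (2 ^ Suc n - 1)"
          by (subst sum_ennreal) (auto simp: sum_gp_strict simp del: sum.lessThan_Suc)
        finally have "1 + (\<Sum>k<Suc n. ennreal (2 ^ k) * indicator (W (2 ^ k)) t) = ennreal 1 + ennreal (2 ^ Suc n - 1)"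
          by simp
        also have "\<dots> = ennreal (2 ^ Suc n)"
          by (subst ennreal_plus[symmetric]) (auto simp: one_le_power simp del: power_Suc)
        finally show ?thesis using Suc.prems by simp
      qed
    qed
    show ?thesis
    proof (cases "\<mu> t = \<infinity>")
      case False
      then obtain r where r: "\<mu> t = ennreal r" "0 \<le> r" by (cases "\<mu> t") auto
      obtain n where "r < 2 ^ n" using real_arch_pow[of 2 r] by auto
      then have "\<mu> t \<le> ennreal (2 ^ n)" using r by (simp add: ennreal_leI)
      from le[OF this] have "\<mu> t \<le> 1 + (\<Sum>k<n. ennreal (2 ^ k) * indicator (W (2 ^ k)) t)" .
      also have "\<dots> \<le> 1 + (\<Sum>k. ennreal (2 ^ k) * indicator (W (2 ^ k)) t)"
        by (intro add_left_mono sum_le_suminf) auto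
      finally show ?thesis using True by simp
    next
      case inf: True
      have one: "indicator (W (2 ^ k)) t = (1::ennreal)" for k
        using inf True by (simp add: W_def less_top[symmetric])
      have "ennreal (real n) \<le> (\<Sum>k. ennreal (2 ^ k) * indicator (W (2 ^ k)) t)" for n
      proof -
        have "ennreal (real n) = (\<Sum>k<n. 1)" by (simp add: ennreal_of_nat_eq_real_of_nat)
        also have "\<dots> \<le> (\<Sum>k<n. ennreal (2 ^ k) * indicator (W (2 ^ k)) t)"
          unfolding one by (intro sum_mono) (simp add: one_le_power)
        also have "\<dots> \<le> (\<Sum>k. ennreal (2 ^ k) * indicator (W (2 ^ k)) t)"
          by (intro sum_le_suminf) auto
        finally show ?thesis .
      qed
      then have "(\<Sum>k. ennreal (2 ^ k) * indicator (W (2 ^ k)) t) = \<infinity>"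
        by (metis ennreal_of_nat_eq_real_of_nat ennreal_Ex_less_of_nat infinity_ennreal_def not_le less_top)
      then show ?thesis by simp
    qed
  qed simp
  have "(\<integral>\<^sup>+ t\<in>{0..1}. \<mu> t \<partial>lborel) \<le> (\<integral>\<^sup>+ t. indicator {0..1} t + (\<Sum>k. ennreal (2 ^ k) * indicator (W (2 ^ k)) t) \<partial>(lborel::real measure))"
    by (intro nn_integral_mono pt)
  also have "\<dots> = 1 + (\<Sum>k. ennreal (2 ^ k) * emeasure lborel (W (2 ^ k)))"
    by (subst nn_integral_add) (auto simp: nn_integral_suminf nn_integral_cmult)
  \<comment> \<open>The weak-type bound 40 / 4^k at level 2^k, multiplied by 2^k, leaves 40 / 2^k;
    the geometric series then produces the factor 80.\<close>
  also have "\<dots> \<le> 1 + (\<Sum>k. ennreal ((1 / 2) ^ k) * (40 * I))"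
  proof (intro add_left_mono suminf_le)
    fix k :: nat
    have "ennreal (2 ^ k) * emeasure lborel (W (2 ^ k)) \<le> ennreal (2 ^ k) * (ennreal (40 / (2 ^ k)\<^sup>2) * I)"
      by (intro mult_left_mono weak) auto
    also have "\<dots> = ennreal (2 ^ k * (40 / (2 ^ k)\<^sup>2)) * I"
      unfolding mult.assoc[symmetric] by (subst ennreal_mult) simp_all
    also have "(2 ^ k * (40 / (2 ^ k)\<^sup>2)) = (1 / 2) ^ k * (40::real)"
      by (simp add: power2_eq_square power_divide)
    also have "ennreal ((1 / 2) ^ k * 40) * I = ennreal ((1 / 2) ^ k) * (40 * I)"
      unfolding mult.assoc[symmetric] by (subst ennreal_mult) simp_all
    finally show "ennreal (2 ^ k) * emeasure lborel (W (2 ^ k)) \<le> ennreal ((1 / 2) ^ k) * (40 * I)" .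
  qed auto
  also have "(\<Sum>k. ennreal ((1 / 2) ^ k) * (40 * I)) = (\<Sum>k. ennreal ((1 / 2) ^ k)) * (40 * I)"
    by simp
  also have "(\<Sum>k. ennreal ((1 / 2) ^ k)) = ennreal 2"
    by (subst suminf_ennreal2) (auto simp: suminf_geometric)
  also have "ennreal 2 * (40 * I) = 80 * I"
    by (simp flip: mult.assoc)
  finally show ?thesis by (simp add: I_def)
qed simp

section \<open>The distance of a conformal metric with highways\<close>

text \<open>Fubini with translation invariance: for each fixed s the set of z with z + s v in a null
  set is null, so for almost every z the bad parameters s form a null set.\<close>

lemma AE_lborel_lines:
  fixes v :: "'a::euclidean_space"
  assumes "AE z in lborel. Q z"
  shows "AE z in lborel. AE s in (lborel::real measure). Q (z + s *\<^sub>R v)"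
proof -
  obtain N where N: "{z\<in>space lborel. \<not> Q z} \<subseteq> N" "emeasure lborel N = 0" "N \<in> sets lborel"
    using AE_E[OF assms] by blast
  have Nm[measurable]: "N \<in> sets borel" using N by simp
  have "(\<integral>\<^sup>+ z. \<integral>\<^sup>+ s. indicator N (z + s *\<^sub>R v) \<partial>(lborel::real measure) \<partial>lborel) =
        (\<integral>\<^sup>+ s. \<integral>\<^sup>+ z. indicator N (z + s *\<^sub>R v) \<partial>lborel \<partial>(lborel::real measure))"
    by (rule lborel_pair.Fubini') measurable
  also have "\<dots> = (\<integral>\<^sup>+ s. 0 \<partial>(lborel::real measure))"
  proof (intro nn_integral_cong)
    fix s :: real
    have "(\<integral>\<^sup>+ z. indicator N (z + s *\<^sub>R v) \<partial>lborel) = (\<integral>\<^sup>+ z. indicator N z \<partial>distr lborel borel ((+) (s *\<^sub>R v)))"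
      by (subst nn_integral_distr) (auto simp: add.commute)
    also have "\<dots> = 0" using N by (simp add: lborel_distr_plus)
    finally show "(\<integral>\<^sup>+ z. indicator N (z + s *\<^sub>R v) \<partial>lborel) = 0" .
  qed
  finally have "(\<integral>\<^sup>+ z. \<integral>\<^sup>+ s. indicator N (z + s *\<^sub>R v) \<partial>(lborel::real measure) \<partial>lborel) = 0" by simp
  then have "AE z in lborel. (\<integral>\<^sup>+ s. indicator N (z + s *\<^sub>R v) \<partial>(lborel::real measure)) = 0"
    by (subst (asm) nn_integral_0_iff_AE) auto
  then show ?thesis
  proof eventually_elim
    case (elim z)
    then have "AE s in (lborel::real measure). indicator N (z + s *\<^sub>R v) = (0::ennreal)"
      by (subst (asm) nn_integral_0_iff_AE) auto
    then show ?case
      by eventually_elim (use N in \<open>auto simp: indicator_def split: if_splits\<close>)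
  qed
qed

lemma AE_lborel_open_witness:
  fixes U :: "'a::euclidean_space set"
  assumes "AE z in lborel. Q z" "open U" "U \<noteq> {}"
  shows "\<exists>z\<in>U. Q z"
proof (rule ccontr)
  assume "\<not> (\<exists>z\<in>U. Q z)"
  then have "AE z in lborel. z \<notin> U" using assms(1) by (auto elim!: eventually_mono)
  then have "U \<in> null_sets lborel"
    using assms(2) by (simp add: AE_iff_null_sets)
  then have "negligible U"
    using negligible_iff_null_sets null_sets_completionI by blast
  then show False using open_not_negligible assms by blast
qed

text \<open>The segment from y to y + v may run entirely through the exceptional null set. A
  starting point z close to y is chosen whose line meets that set in a null set of parameters; along
  it w is Lipschitz, hence the integral of its derivative, which is at most B. Invariance of
  \<open>Q\<close> under translation along v keeps the shifted line in \<open>Q\<close>, and the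
  Lipschitz bound controls the change of endpoints.\<close>

lemma lipschitz_increment_le:
  fixes w :: "'a::euclidean_space \<Rightarrow> real"
  assumes w: "L-lipschitz_on UNIV w" and Q: "open Q" "y \<in> Q" "\<And>z s. z \<in> Q \<Longrightarrow> z + s *\<^sub>R v \<in> Q"
    and B: "0 \<le> B"
    and D: "AE z in lborel. z \<in> Q \<longrightarrow> (\<exists>D. (w has_derivative (\<lambda>u. D \<bullet> u)) (at z) \<and> \<bar>D \<bullet> v\<bar> \<le> B)"
  shows "\<bar>w (y + v) - w y\<bar> \<le> B"
proof (rule field_le_epsilon)
  fix e :: real assume e: "0 < e"
  have L: "0 \<le> L" using w by (rule lipschitz_on_nonneg)
  have wL: "\<bar>w a - w b\<bar> \<le> L * norm (a - b)" for a b
    using lipschitz_onD[OF w, of a b] by (simp add: dist_norm)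
  \<comment> \<open>Moving both endpoints by less than \<open>\<eta>\<close> costs at most 2 L
    \<open>\<eta>\<close>, which is at most e; L + 1 keeps the denominator positive when L is
    0.\<close>
  define \<eta> where "\<eta> = e / (2 * (L + 1))"
  have \<eta>: "0 < \<eta>" using e L by (simp add: \<eta>_def)
  have "open (Q \<inter> ball y \<eta>)" "Q \<inter> ball y \<eta> \<noteq> {}" using Q \<eta> by auto
  from AE_lborel_open_witness[OF AE_lborel_lines[OF D, of v] this]
  obtain z where z: "z \<in> Q \<inter> ball y \<eta>"
    and zs: "AE s in (lborel::real measure). z + s *\<^sub>R v \<in> Q \<longrightarrow> (\<exists>D. (w has_derivative (\<lambda>u. D \<bullet> u)) (at (z + s *\<^sub>R v)) \<and> \<bar>D \<bullet> v\<bar> \<le> B)"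
    by blast
  define \<phi> where "\<phi> s = w (z + s *\<^sub>R v)" for s
  have "\<bar>\<phi> t - \<phi> s\<bar> \<le> (LINT r:{s..t}|lborel. L * norm v)" if "s \<le> t" for s t
  proof -
    have "\<bar>\<phi> t - \<phi> s\<bar> \<le> L * norm ((t - s) *\<^sub>R v)"
      unfolding \<phi>_def using wL[of "z + t *\<^sub>R v" "z + s *\<^sub>R v"] by (simp add: algebra_simps)
    also have "\<dots> = (LINT r:{s..t}|lborel. L * norm v)"
      using that by (simp add: set_lebesgue_integral_def)
    finally show ?thesis .
  qed
  moreover have "set_integrable lborel {0..1::real} (\<lambda>r. L * norm v)"
    unfolding set_integrable_def by (intro integrable_scaleR_left integrable_real_indicator) auto
  ultimately obtain \<delta> where \<delta>: "integrable lborel \<delta>"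
    "\<And>s t. 0 \<le> s \<Longrightarrow> s \<le> t \<Longrightarrow> t \<le> 1 \<Longrightarrow> \<phi> t - \<phi> s = (LINT r:{s..t}|lborel. \<delta> r)"
    and der: "AE t in lborel. t \<in> {0..1} \<longrightarrow> (\<phi> has_real_derivative \<delta> t) (at t within {0..1})"
    using dominated_increments_absolutely_continuous[of "\<lambda>r. L * norm v" \<phi>] by blast
  have "AE t in lborel. t \<in> {0..1} \<longrightarrow> \<bar>\<delta> t\<bar> \<le> B"
    using der zs
  proof eventually_elim
    case (elim t)
    show ?case
    proof
      assume t: "t \<in> {0..1}"
      have "z + t *\<^sub>R v \<in> Q" using Q z by blast
      then obtain D where D: "(w has_derivative (\<lambda>u. D \<bullet> u)) (at (z + t *\<^sub>R v))" "\<bar>D \<bullet> v\<bar> \<le> B"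
        using elim(2) by blast
      have "((\<lambda>s. z + s *\<^sub>R v) has_derivative (\<lambda>h. h *\<^sub>R v)) (at t within {0..1})"
        by (auto intro!: derivative_eq_intros)
      from has_derivative_compose[OF this D(1)]
      have "(\<phi> has_derivative (\<lambda>h. D \<bullet> (h *\<^sub>R v))) (at t within {0..1})"
        by (simp add: \<phi>_def[abs_def])
      then have "(\<phi> has_real_derivative (D \<bullet> v)) (at t within {0..1})"
        unfolding has_field_derivative_def by (rule has_derivative_eq_rhs) (simp add: fun_eq_iff)
      moreover have "(\<phi> has_real_derivative \<delta> t) (at t within {0..1})" using elim(1) t by blast
      moreover have "at t within {0..1} \<noteq> bot" using t by (simp add: trivial_limit_within islimpt_Icc)
      ultimately have "\<delta> t = D \<bullet> v" using has_field_derivative_unique by blast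
      then show "\<bar>\<delta> t\<bar> \<le> B" using D(2) by simp
    qed
  qed
  then have "\<bar>LINT r:{0..1}|lborel. \<delta> r\<bar> \<le> (LINT r:{0..1::real}|lborel. B)"
  proof -
    assume ae: "AE t in lborel. t \<in> {0..1} \<longrightarrow> \<bar>\<delta> t\<bar> \<le> B"
    have "\<bar>LINT r:{0..1}|lborel. \<delta> r\<bar> \<le> (LINT r:{0..1}|lborel. \<bar>\<delta> r\<bar>)"
      unfolding set_lebesgue_integral_def
      using integral_abs_bound[of lborel "\<lambda>r. indicator {0..1} r *\<^sub>R \<delta> r"] by (simp add: abs_mult)
    also have "\<dots> \<le> (LINT r:{0..1::real}|lborel. B)"
      unfolding set_lebesgue_integral_def using ae \<delta>(1)
      by (intro integral_mono_AE integrable_mult_indicator integrable_abs integrable_scaleR_left integrable_real_indicator)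
         (auto elim!: eventually_mono simp: indicator_def)
    finally show ?thesis .
  qed
  then have "\<bar>\<phi> 1 - \<phi> 0\<bar> \<le> B" using \<delta>(2)[of 0 1] by (simp add: set_lebesgue_integral_def)
  then have "\<bar>w (z + v) - w z\<bar> \<le> B" by (simp add: \<phi>_def)
  moreover have "L * norm (y - z) \<le> L * \<eta>"
    using z L by (intro mult_left_mono) (auto simp: dist_norm)
  moreover have "\<bar>w (y + v) - w (z + v)\<bar> \<le> L * norm (y - z)" "\<bar>w z - w y\<bar> \<le> L * norm (y - z)"
    using wL[of "y + v" "z + v"] wL[of z y] by (auto simp: norm_minus_commute)
  moreover have "2 * (L * \<eta>) \<le> e"
  proof -
    have "2 * (L * \<eta>) = e * (L / (L + 1))" using L by (simp add: \<eta>_def field_simps)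
    also have "\<dots> \<le> e * 1" using L e by (intro mult_left_mono) auto
    finally show ?thesis by simp
  qed
  ultimately show "\<bar>w (y + v) - w y\<bar> \<le> B + e" by linarith
qed

text \<open>Orthogonal projection along the k-th axis: the norm of \<open>off_axis k (x - z)\<close>
  is the distance of x from the line through z parallel to that axis.\<close>

definition off_axis :: "'n \<Rightarrow> real^'n \<Rightarrow> real^'n" where
  "off_axis k x = x - (x \<bullet> axis k 1) *\<^sub>R axis k 1"

lemma off_axis_add_axis [simp]: "off_axis k (x + s *\<^sub>R axis k 1) = off_axis k x"
  by (simp add: off_axis_def inner_add_left algebra_simps inner_axis_axis)

text \<open>This isolates from the Sobolev construction what the metric argument requires. A tube
  may be arbitrarily thin, but it is infinitely long, so displacements of any length along the axis
  stay in it.\<close>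

locale highways =
  fixes \<psi> :: "real^'n::finite \<Rightarrow> real" and k :: 'n
  assumes \<psi>_measurable [measurable]: "\<psi> \<in> borel_measurable borel"
    and \<psi>_gt: "\<And>x. 1 / 4 < \<psi> x" and \<psi>_le: "\<And>x. \<psi> x \<le> 1"
    and tubes: "\<And>y \<epsilon>. 0 < \<epsilon> \<Longrightarrow> \<exists>z r. 0 < r \<and> dist y z < \<epsilon> \<and>
       (AE x in lborel. norm (off_axis k (x - z)) < r \<longrightarrow> \<psi> x \<le> 1 / 4 + \<epsilon>)"
begin

abbreviation e :: "real^'n" where "e \<equiv> axis k 1"

definition g :: "real^'n \<Rightarrow> real^'n^'n" where "g x = \<psi> x *\<^sub>R mat 1"

abbreviation d :: "real^'n \<Rightarrow> real^'n \<Rightarrow> real" where "d \<equiv> dist_g UNIV g"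

lemma \<psi>_pos: "0 < \<psi> x"
  using \<psi>_gt[of x] by simp

lemma g_mult [simp]: "g x *v v = \<psi> x *\<^sub>R v"
  by (simp add: g_def scaleR_matrix_vector_assoc[symmetric])

lemma matrix_inv_g: "matrix_inv (g x) = (1 / \<psi> x) *\<^sub>R mat 1"
proof -
  let ?B = "(1 / \<psi> x) *\<^sub>R mat 1 :: real^'n^'n"
  have B: "g x ** ?B = mat 1" "?B ** g x = mat 1"
    using \<psi>_pos[of x] by (simp_all add: g_def matrix_scalar_ac scalar_matrix_assoc[symmetric])
  then have inv: "g x ** matrix_inv (g x) = mat 1 \<and> matrix_inv (g x) ** g x = mat 1"
    unfolding matrix_inv_def by (intro someI_ex[of "\<lambda>A'. g x ** A' = mat 1 \<and> A' ** g x = mat 1"]) blast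
  have "matrix_inv (g x) = matrix_inv (g x) ** (g x ** ?B)" by (simp add: B)
  also have "\<dots> = ?B"
    using inv by (simp add: matrix_mul_assoc)
  finally show ?thesis .
qed

lemma grad_norm_sq_g: "grad_norm_sq g x D = (D \<bullet> D) / \<psi> x"
  by (simp add: grad_norm_sq_def matrix_inv_g scaleR_matrix_vector_assoc[symmetric])

lemma det_g: "det (g x) = \<psi> x ^ CARD('n)"
proof -
  have "det (g x) = (\<Prod>i\<in>UNIV. g x $ i $ i)"
    by (rule det_diagonal) (simp add: g_def mat_def)
  then show ?thesis by (simp add: g_def mat_def)
qed

text \<open>The competitors in \<open>dist_g\<close> for the conformal metric, with the inverse
  matrix cleared from the gradient condition and Lebesgue-null sets expressed through
  \<open>lborel\<close>.\<close>

definition admissible :: "(real^'n \<Rightarrow> real) \<Rightarrow> bool" where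
  "admissible w \<longleftrightarrow> (\<exists>L. L-lipschitz_on UNIV w) \<and>
      (AE z in lborel. \<exists>D. (w has_derivative (\<lambda>v. D \<bullet> v)) (at z) \<and> D \<bullet> D \<le> \<psi> z)"

lemma dist_g_eq: "d x y = Sup {w x - w y | w. admissible w}"
proof -
  have "grad_norm_sq g z D \<le> 1 \<longleftrightarrow> D \<bullet> D \<le> \<psi> z" for z D
    using \<psi>_pos[of z] by (simp add: grad_norm_sq_g divide_le_eq)
  then show ?thesis
    unfolding dist_g_def admissible_def by (simp add: AE_completion_iff)
qed

text \<open>The Lipschitz constant of a competitor is arbitrary, but its gradient has norm at most 1
  almost everywhere because \<open>\<psi>\<close> is at most 1; integration along lines turns this
  into Lipschitz constant 1. This makes the supremum defining the distance finite.\<close>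

lemma admissible_le:
  assumes w: "admissible w"
  shows "\<bar>w x - w y\<bar> \<le> norm (x - y)"
proof -
  obtain L where L: "L-lipschitz_on UNIV w" using w by (auto simp: admissible_def)
  have "AE z in lborel. \<exists>D. (w has_derivative (\<lambda>v. D \<bullet> v)) (at z) \<and> D \<bullet> D \<le> \<psi> z"
    using w by (simp add: admissible_def)
  then have "AE z in lborel. z \<in> UNIV \<longrightarrow> (\<exists>D. (w has_derivative (\<lambda>v. D \<bullet> v)) (at z) \<and> \<bar>D \<bullet> (x - y)\<bar> \<le> norm (x - y))"
  proof eventually_elim
    case (elim z)
    then obtain D where D: "(w has_derivative (\<lambda>v. D \<bullet> v)) (at z)" "D \<bullet> D \<le> \<psi> z" by blast
    have "(norm D)\<^sup>2 \<le> 1\<^sup>2" using D(2) \<psi>_le[of z] by (simp add: power2_norm_eq_inner)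
    then have "norm D \<le> 1" by (rule power2_le_imp_le) simp
    then have "\<bar>D \<bullet> (x - y)\<bar> \<le> norm (x - y)"
      using Cauchy_Schwarz_ineq2[of D "x - y"] mult_right_mono[of "norm D" 1 "norm (x - y)"] by simp
    then show ?case using D by blast
  qed
  from lipschitz_increment_le[OF L open_UNIV _ _ _ this, of y] show ?thesis by simp
qed

lemma admissible_zero: "admissible (\<lambda>x. 0)"
  unfolding admissible_def
proof
  show "AE z in lborel. \<exists>D. ((\<lambda>x. 0) has_derivative (\<lambda>v. D \<bullet> v)) (at z) \<and> D \<bullet> D \<le> \<psi> z"
    using \<psi>_pos by (intro AE_I2 exI[of _ 0]) (auto intro: less_imp_le)
qed (auto intro!: exI[of _ 0] lipschitz_onI)

lemma admissible_uminus: "admissible w \<Longrightarrow> admissible (\<lambda>x. - w x)"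
  unfolding admissible_def
proof (elim conjE exE, intro conjI)
  fix L assume "L-lipschitz_on UNIV w"
  then show "\<exists>L. L-lipschitz_on UNIV (\<lambda>x. - w x)" by (auto intro: lipschitz_on_minus)
  assume "AE z in lborel. \<exists>D. (w has_derivative (\<lambda>v. D \<bullet> v)) (at z) \<and> D \<bullet> D \<le> \<psi> z"
  then show "AE z in lborel. \<exists>D. ((\<lambda>x. - w x) has_derivative (\<lambda>v. D \<bullet> v)) (at z) \<and> D \<bullet> D \<le> \<psi> z"
  proof eventually_elim
    case (elim z)
    then obtain D where "(w has_derivative (\<lambda>v. D \<bullet> v)) (at z)" "D \<bullet> D \<le> \<psi> z" by blast
    then show ?case by (intro exI[of _ "- D"]) (auto intro!: derivative_eq_intros)
  qed
qed

text \<open>Half a unit covector has squared norm at most 1/4, which lies below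
  \<open>\<psi>\<close> everywhere. These functions give the lower bound on the distance.\<close>

lemma admissible_linear:
  assumes "norm u \<le> 1"
  shows "admissible (\<lambda>x. (u \<bullet> x) / 2)"
  unfolding admissible_def
proof
  have "\<bar>u \<bullet> x / 2 - u \<bullet> y / 2\<bar> \<le> norm (x - y)" for x y
  proof -
    have "\<bar>u \<bullet> (x - y)\<bar> \<le> norm (x - y)"
      using Cauchy_Schwarz_ineq2[of u "x - y"] mult_right_mono[OF assms, of "norm (x - y)"] by simp
    then show ?thesis by (simp add: inner_diff_right)
  qed
  then have "1-lipschitz_on UNIV (\<lambda>x. u \<bullet> x / 2)"
    by (intro lipschitz_onI) (auto simp: dist_norm)
  then show "\<exists>L. L-lipschitz_on UNIV (\<lambda>x. u \<bullet> x / 2)" ..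
  have "(norm u)\<^sup>2 \<le> 1" using assms by (simp add: power_le_one)
  then have "(u /\<^sub>R 2) \<bullet> (u /\<^sub>R 2) \<le> \<psi> z" for z
    using \<psi>_gt[of z] by (simp add: power2_norm_eq_inner)
  then show "AE z in lborel. \<exists>D. ((\<lambda>x. u \<bullet> x / 2) has_derivative (\<lambda>v. D \<bullet> v)) (at z) \<and> D \<bullet> D \<le> \<psi> z"
    by (intro AE_I2 exI[of _ "u /\<^sub>R 2"]) (auto intro!: derivative_eq_intros)
qed

lemma bdd_above_admissible: "bdd_above {w x - w y | w. admissible w}"
  using admissible_le[of _ x y] by (intro bdd_aboveI[of _ "norm (x - y)"]) fastforce

lemma admissible_le_d: "admissible w \<Longrightarrow> w x - w y \<le> d x y"
  unfolding dist_g_eq by (intro cSup_upper bdd_above_admissible) blast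

lemma d_leI: "(\<And>w. admissible w \<Longrightarrow> w x - w y \<le> B) \<Longrightarrow> d x y \<le> B"
  unfolding dist_g_eq using admissible_zero by (intro cSup_least) blast+

lemma d_nonneg: "0 \<le> d x y"
  using admissible_le_d[OF admissible_zero, of x y] by simp

lemma d_sym: "d x y = d y x"
proof -
  have "d x y \<le> d y x" for x y
    using admissible_le_d[OF admissible_uminus, of _ y x] by (intro d_leI) force
  then show ?thesis by (meson antisym)
qed

lemma d_triangle: "d x z \<le> d x y + d y z"
  using admissible_le_d[of _ x y] admissible_le_d[of _ y z] by (intro d_leI) fastforce

lemma d_le_norm: "d x y \<le> norm (x - y)"
  using admissible_le[of _ x y] by (intro d_leI) force

text \<open>The supremum is tested with the linear function of slope 1/2 in the direction of x -
  y.\<close>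

lemma norm_le_d: "norm (x - y) \<le> 2 * d x y"
proof (cases "x = y")
  case False
  define u where "u = (x - y) /\<^sub>R norm (x - y)"
  have "norm u \<le> 1" using False by (simp add: u_def)
  from admissible_le_d[OF admissible_linear[OF this], of x y]
  have "u \<bullet> (x - y) \<le> 2 * d x y" by (simp add: inner_diff_right)
  also have "u \<bullet> (x - y) = norm (x - y)"
    using False by (simp add: u_def power2_norm_eq_inner[symmetric] power2_eq_square)
  finally show ?thesis .
qed (use d_nonneg in simp)

text \<open>For the upper bound, a competitor is compared at x and at a tube centre z within
  \<open>\<epsilon>\<close>; this costs at most \<open>\<epsilon>\<close> at each end. Inside the
  tube its derivative along the axis is at most the square root of 1/4 + \<open>\<epsilon>\<close>,
  and \<open>\<epsilon>\<close> tends to 0. The lower bound is \<open>norm_le_d\<close>.\<close>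

lemma d_axis: "d x (x + s *\<^sub>R e) = \<bar>s\<bar> / 2"
proof (rule antisym)
  show "\<bar>s\<bar> / 2 \<le> d x (x + s *\<^sub>R e)"
    using norm_le_d[of x "x + s *\<^sub>R e"] by simp
  show "d x (x + s *\<^sub>R e) \<le> \<bar>s\<bar> / 2"
  proof (rule d_leI)
    fix w assume w: "admissible w"
    then obtain L where L: "L-lipschitz_on UNIV w" by (auto simp: admissible_def)
    have *: "\<bar>w (x + s *\<^sub>R e) - w x\<bar> \<le> \<bar>s\<bar> * sqrt (1 / 4 + \<epsilon>) + 2 * \<epsilon>" if \<epsilon>: "0 < \<epsilon>" for \<epsilon>
    proof -
      obtain z r where r: "0 < r" "dist x z < \<epsilon>"
        and ae: "AE x in lborel. norm (off_axis k (x - z)) < r \<longrightarrow> \<psi> x \<le> 1 / 4 + \<epsilon>"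
        using tubes[OF \<epsilon>, of x] by blast
      define Q where "Q = {x. norm (off_axis k (x - z)) < r}"
      have "open Q" unfolding Q_def off_axis_def by (intro open_Collect_less continuous_intros)
      moreover have "z \<in> Q" using r by (simp add: Q_def off_axis_def)
      moreover have "q + t *\<^sub>R (s *\<^sub>R e) \<in> Q" if "q \<in> Q" for q t
      proof -
        have "q + t *\<^sub>R (s *\<^sub>R e) - z = (q - z) + (t * s) *\<^sub>R e" by simp
        then show ?thesis using that unfolding Q_def by (simp only: off_axis_add_axis mem_Collect_eq)
      qed
      moreover have "AE q in lborel. q \<in> Q \<longrightarrow> (\<exists>D. (w has_derivative (\<lambda>v. D \<bullet> v)) (at q) \<and>
          \<bar>D \<bullet> (s *\<^sub>R e)\<bar> \<le> \<bar>s\<bar> * sqrt (1 / 4 + \<epsilon>))"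
        using ae w[unfolded admissible_def, THEN conjunct2]
      proof eventually_elim
        case (elim q)
        show ?case
        proof
          assume "q \<in> Q"
          then have \<psi>q: "\<psi> q \<le> 1 / 4 + \<epsilon>" using elim(1) by (simp add: Q_def)
          obtain D where D: "(w has_derivative (\<lambda>v. D \<bullet> v)) (at q)" "D \<bullet> D \<le> \<psi> q" using elim(2) by blast
          have "norm D \<le> sqrt (1 / 4 + \<epsilon>)"
            using D(2) \<psi>q by (simp add: norm_eq_sqrt_inner)
          moreover have "\<bar>D \<bullet> e\<bar> \<le> norm D" using Cauchy_Schwarz_ineq2[of D e] by simp
          ultimately have "\<bar>D \<bullet> (s *\<^sub>R e)\<bar> \<le> \<bar>s\<bar> * sqrt (1 / 4 + \<epsilon>)"
            by (auto simp: abs_mult intro!: mult_left_mono)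
          then show "\<exists>D. (w has_derivative (\<lambda>v. D \<bullet> v)) (at q) \<and> \<bar>D \<bullet> (s *\<^sub>R e)\<bar> \<le> \<bar>s\<bar> * sqrt (1 / 4 + \<epsilon>)"
            using D by blast
        qed
      qed
      ultimately have "\<bar>w (z + s *\<^sub>R e) - w z\<bar> \<le> \<bar>s\<bar> * sqrt (1 / 4 + \<epsilon>)"
        using \<epsilon> by (intro lipschitz_increment_le[OF L, of Q]) auto
      moreover have "\<bar>w (x + s *\<^sub>R e) - w (z + s *\<^sub>R e)\<bar> \<le> \<epsilon>" "\<bar>w z - w x\<bar> \<le> \<epsilon>"
        using admissible_le[OF w, of "x + s *\<^sub>R e" "z + s *\<^sub>R e"] admissible_le[OF w, of z x] r(2)
        by (auto simp: dist_norm norm_minus_commute)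
      ultimately show ?thesis by linarith
    qed
    have "((\<lambda>\<epsilon>. \<bar>s\<bar> * sqrt (1 / 4 + \<epsilon>) + 2 * \<epsilon>) \<longlongrightarrow> \<bar>s\<bar> * sqrt (1 / 4 + 0) + 2 * 0) (at_right 0)"
      by (intro tendsto_intros)
    moreover have "sqrt (1 / 4) = 1 / (2::real)" by (rule real_sqrt_unique) (auto simp: power2_eq_square)
    ultimately have "((\<lambda>\<epsilon>. \<bar>s\<bar> * sqrt (1 / 4 + \<epsilon>) + 2 * \<epsilon>) \<longlongrightarrow> \<bar>s\<bar> / 2) (at_right 0)"
      by simp
    then have "\<bar>w (x + s *\<^sub>R e) - w x\<bar> \<le> \<bar>s\<bar> / 2"
      by (rule tendsto_lowerbound) (auto simp: eventually_at_filter intro!: * always_eventually)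
    then show "w x - w (x + s *\<^sub>R e) \<le> \<bar>s\<bar> / 2" by linarith
  qed
qed

end

section \<open>Test plans and the largest difference quotient\<close>

text \<open>For non-measurable \<open>X\<close> and \<open>Y\<close> these are lower integrals.\<close>

lemma nn_integral_le_const_add:
  assumes M: "prob_space M" and le: "\<And>x. x \<in> space M \<Longrightarrow> X x \<le> 1 + Y x"
  shows "(\<integral>\<^sup>+ x. X x \<partial>M) \<le> 1 + (\<integral>\<^sup>+ x. Y x \<partial>M)"
proof -
  interpret prob_space M by fact
  show ?thesis
    unfolding nn_integral_def[of M X]
  proof (rule SUP_least)
    fix h assume h: "h \<in> {h. simple_function M h \<and> h \<le> X}"
    then have hm[measurable]: "h \<in> borel_measurable M" by (auto intro: borel_measurable_simple_function)
    \<comment> \<open>A simple minorant h of X yields the measurable minorant h - 1 of Y, so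
      additivity of the integral is applied to measurable functions only.\<close>
    have "h x - 1 \<le> Y x" if "x \<in> space M" for x
    proof -
      have "h x \<le> 1 + Y x" using h le[OF that] by (auto simp: le_fun_def intro: order_trans)
      then show ?thesis by (simp add: ennreal_minus_le_iff)
    qed
    then have *: "(\<integral>\<^sup>+ x. h x - 1 \<partial>M) \<le> (\<integral>\<^sup>+ x. Y x \<partial>M)" by (rule nn_integral_mono)
    have "integral\<^sup>S M h = (\<integral>\<^sup>+ x. h x \<partial>M)" using h by (simp add: nn_integral_eq_simple_integral)
    also have "\<dots> \<le> (\<integral>\<^sup>+ x. 1 + (h x - 1) \<partial>M)"
    proof (rule nn_integral_mono)
      fix x
      show "h x \<le> 1 + (h x - 1)"
        by (cases "1 \<le> h x") (auto simp: add_diff_inverse_ennreal intro: order_trans[of _ 1])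
    qed
    also have "\<dots> = 1 + (\<integral>\<^sup>+ x. h x - 1 \<partial>M)"
      by (subst nn_integral_add) (auto simp: emeasure_space_1)
    also have "\<dots> \<le> 1 + (\<integral>\<^sup>+ x. Y x \<partial>M)" using * by (intro add_left_mono)
    finally show "integral\<^sup>S M h \<le> 1 + (\<integral>\<^sup>+ x. Y x \<partial>M)" .
  qed
qed

text \<open>Curves take an unspecified value outside the unit interval, so time is clamped before a
  curve is treated as a function on the whole line.\<close>

definition clamp01 :: "real \<Rightarrow> real" where "clamp01 t = max 0 (min 1 t)"

lemma clamp01_mem [simp]: "clamp01 t \<in> {0..1}" and clamp01_id [simp]: "t \<in> {0..1} \<Longrightarrow> clamp01 t = t"
  by (auto simp: clamp01_def)

lemma clamp01_clamp01 [simp]: "clamp01 (clamp01 t) = clamp01 t"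
  by (simp add: clamp01_def)

lemma clamp01_measurable [measurable]: "clamp01 \<in> borel_measurable borel"
  unfolding clamp01_def[abs_def] by measurable

section \<open>Measurability of evaluations and difference quotients on the space of curves\<close>

lemma space_curve_space: "space (curve_space U) = curves U"
  by (auto simp: curve_space_def space_restrict_space space_PiM curves_def PiE_def extensional_def)

lemma measurable_eval:
  assumes "t \<in> {0..1}"
  shows "(\<lambda>\<gamma>. \<gamma> t) \<in> measurable (curve_space U) borel"
  unfolding curve_space_def using assms by (intro measurable_restrict_space1 measurable_component_singleton)

lemma floor_quotient_tendsto: "(\<lambda>n. real_of_int \<lfloor>real n * s\<rfloor> / real n) \<longlonglongrightarrow> s"
proof (rule tendsto_sandwich)
  show "\<forall>\<^sub>F n in sequentially. s - 1 / real n \<le> real_of_int \<lfloor>real n * s\<rfloor> / real n"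
    using eventually_gt_at_top[of 0]
  proof eventually_elim
    case (elim n)
    have "s - 1 / real n = (real n * s - 1) / real n" using elim by (simp add: field_simps)
    also have "\<dots> \<le> real_of_int \<lfloor>real n * s\<rfloor> / real n" by (intro divide_right_mono) linarith+
    finally show ?case .
  qed
  show "\<forall>\<^sub>F n in sequentially. real_of_int \<lfloor>real n * s\<rfloor> / real n \<le> s"
    using eventually_gt_at_top[of 0] by eventually_elim (simp add: divide_le_eq mult.commute)
  have "(\<lambda>n. s - 1 / real n) \<longlonglongrightarrow> s - 0" by (intro tendsto_intros lim_1_over_n)
  then show "(\<lambda>n. s - 1 / real n) \<longlonglongrightarrow> s" by simp
qed simp

text \<open>The sigma algebra on curves knows only evaluations at fixed times. Rounding the time
  down to multiples of 1/n leaves countably many evaluations, and continuity of the curves gives the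
  limit.\<close>

lemma measurable_eval_joint:
  fixes U :: "(real^'n) set"
  shows "(\<lambda>(\<gamma>, t). \<gamma> (clamp01 t)) \<in> measurable (curve_space U \<Otimes>\<^sub>M borel) (borel :: (real^'n) measure)"
proof -
  define j where "j n t = clamp01 (real_of_int \<lfloor>real n * clamp01 t\<rfloor> / real n)" for n :: nat and t :: real
  have j: "(\<lambda>n. j n t) \<longlonglongrightarrow> clamp01 t" for t
  proof -
    note floor_quotient_tendsto[of "clamp01 t"]
    then have "(\<lambda>n. clamp01 (real_of_int \<lfloor>real n * clamp01 t\<rfloor> / real n)) \<longlonglongrightarrow> clamp01 (clamp01 t)"
      unfolding clamp01_def[of "real_of_int _ / _"] clamp01_def[of "clamp01 t"] by (intro tendsto_intros)
    then show ?thesis by (simp add: j_def)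
  qed
  show ?thesis
  proof (rule borel_measurable_LIMSEQ_metric)
    fix n :: nat
    have "(\<lambda>x. fst x (j n (snd x))) = (\<lambda>x. (\<lambda>i x. fst x (clamp01 (real_of_int i / real n))) (\<lfloor>real n * clamp01 (snd x)\<rfloor>) x)"
      by (simp add: j_def)
    also have "\<dots> \<in> measurable (curve_space U \<Otimes>\<^sub>M borel) (borel :: (real^'n) measure)"
    proof (rule measurable_compose_countable[where f = "\<lambda>i x. fst x (clamp01 (real_of_int i / real n))"
          and g = "\<lambda>x. \<lfloor>real n * clamp01 (snd x)\<rfloor>"])
      fix i :: int
      show "(\<lambda>x. fst x (clamp01 (real_of_int i / real n))) \<in> measurable (curve_space U \<Otimes>\<^sub>M borel) (borel :: (real^'n) measure)"
        by (rule measurable_compose[OF measurable_fst measurable_eval[OF clamp01_mem]])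
      show "(\<lambda>x. \<lfloor>real n * clamp01 (snd x)\<rfloor>) \<in> measurable (curve_space U \<Otimes>\<^sub>M borel) (count_space UNIV)"
        by measurable
    qed
    finally show "(\<lambda>x. fst x (j n (snd x))) \<in> measurable (curve_space U \<Otimes>\<^sub>M borel) (borel :: (real^'n) measure)" .
  next
    fix x :: "(real \<Rightarrow> real^'n) \<times> real" assume "x \<in> space (curve_space U \<Otimes>\<^sub>M borel)"
    then have "fst x \<in> curves U" by (auto simp: space_pair_measure space_curve_space)
    then have "continuous_on {0..1} (fst x)" by (simp add: curves_def)
    then have "(\<lambda>n. fst x (j n (snd x))) \<longlonglongrightarrow> fst x (clamp01 (snd x))"
      by (rule continuous_on_tendsto_compose[OF _ j]) (auto simp: j_def simp del: atLeastAtMost_iff)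
    then show "(\<lambda>n. fst x (j n (snd x))) \<longlonglongrightarrow> (case x of (\<gamma>, t) \<Rightarrow> \<gamma> (clamp01 t))"
      by (simp add: case_prod_beta)
  qed
qed

definition unit_rats :: "real set" where "unit_rats = \<rat> \<inter> {0..1}"

lemma countable_unit_rats: "countable unit_rats"
  by (simp add: unit_rats_def countable_rat)

lemma unit_rats_dense:
  assumes "s \<in> {0..1}"
  shows "\<exists>q. (\<forall>n. q n \<in> unit_rats) \<and> q \<longlonglongrightarrow> s"
proof -
  define q where "q n = clamp01 (real_of_int \<lfloor>real n * s\<rfloor> / real n)" for n :: nat
  have "real_of_int \<lfloor>real n * s\<rfloor> / real n \<in> {0..1}" for n
  proof (cases "n = 0")
    case False
    have "real_of_int \<lfloor>real n * s\<rfloor> \<le> real n * s" by linarith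
    also have "\<dots> \<le> real n * 1" using assms by (intro mult_left_mono) auto
    finally show ?thesis using False assms by simp
  qed simp
  then have q: "q n = real_of_int \<lfloor>real n * s\<rfloor> / real n" "q n \<in> {0..1}" for n by (auto simp: q_def)
  have "q n \<in> unit_rats" for n
    using q(2)[of n] by (auto simp: unit_rats_def q(1))
  moreover have "q \<longlonglongrightarrow> s" using floor_quotient_tendsto[of s] by (simp add: q(1)[abs_def])
  ultimately show ?thesis by blast
qed

text \<open>At \<open>s = t\<close> the quotient is \<open>0 / 0 = 0\<close>.\<close>

definition max_quotient :: "(real \<Rightarrow> real^'n) \<Rightarrow> real \<Rightarrow> ennreal" where
  "max_quotient \<gamma> t = (SUP s\<in>unit_rats. ennreal (dist (\<gamma> s) (\<gamma> (clamp01 t)) / \<bar>s - clamp01 t\<bar>))"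

lemma measurable_max_quotient:
  fixes U :: "(real^'n) set"
  shows "(\<lambda>(\<gamma>, t). max_quotient \<gamma> t) \<in> borel_measurable (curve_space U \<Otimes>\<^sub>M (borel :: real measure))"
proof -
  have ev: "(\<lambda>x. fst x (clamp01 (snd x))) \<in> measurable (curve_space U \<Otimes>\<^sub>M borel) (borel :: (real^'n) measure)"
    using measurable_eval_joint by (simp add: case_prod_beta')
  have es: "(\<lambda>x. fst x s) \<in> measurable (curve_space U \<Otimes>\<^sub>M (borel :: real measure)) (borel :: (real^'n) measure)"
    if "s \<in> unit_rats" for s
    using that by (intro measurable_compose[OF measurable_fst measurable_eval]) (auto simp: unit_rats_def)
  have "(\<lambda>x. SUP s\<in>unit_rats. ennreal (dist (fst x s) (fst x (clamp01 (snd x))) / \<bar>s - clamp01 (snd x)\<bar>))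
     \<in> borel_measurable (curve_space U \<Otimes>\<^sub>M (borel :: real measure))"
    by (intro borel_measurable_SUP countable_unit_rats measurable_compose[OF _ measurable_ennreal]
        borel_measurable_divide borel_measurable_dist es ev borel_measurable_abs borel_measurable_diff
        borel_measurable_const measurable_compose[OF measurable_snd clamp01_measurable])
  then show ?thesis by (simp add: max_quotient_def case_prod_beta')
qed

lemma max_quotient_le:
  assumes "\<And>s. s \<in> {0..1} \<Longrightarrow> dist (\<gamma> s) (\<gamma> t) \<le> B * \<bar>s - t\<bar>" "t \<in> {0..1}" "0 \<le> B"
  shows "max_quotient \<gamma> t \<le> ennreal B"
  unfolding max_quotient_def
proof (rule SUP_least)
  fix s assume "s \<in> unit_rats"
  then show "ennreal (dist (\<gamma> s) (\<gamma> (clamp01 t)) / \<bar>s - clamp01 t\<bar>) \<le> ennreal B"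
    using assms(1)[of s] assms(2,3)
    by (intro ennreal_leI) (cases "s = t", auto simp: unit_rats_def divide_le_eq)
qed

text \<open>The supremum ranges over rational times only, which keeps it measurable; continuity of
  the curve carries the bound over to all times.\<close>

lemma dist_le_max_quotient:
  assumes \<gamma>: "\<gamma> \<in> curves U" and st: "s \<in> {0..1}" "t \<in> {0..1}" and fin: "max_quotient \<gamma> t < \<infinity>"
  shows "dist (\<gamma> s) (\<gamma> t) \<le> enn2real (max_quotient \<gamma> t) * \<bar>s - t\<bar>"
proof -
  obtain q where q: "\<And>n. q n \<in> unit_rats" "q \<longlonglongrightarrow> s" using unit_rats_dense[OF st(1)] by blast
  have rat: "dist (\<gamma> r) (\<gamma> t) \<le> enn2real (max_quotient \<gamma> t) * \<bar>r - t\<bar>" if "r \<in> unit_rats" for r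
  proof (cases "r = t")
    case False
    have "ennreal (dist (\<gamma> r) (\<gamma> t) / \<bar>r - t\<bar>) \<le> max_quotient \<gamma> t"
      unfolding max_quotient_def using that st by (intro SUP_upper2[OF that]) auto
    also have "\<dots> = ennreal (enn2real (max_quotient \<gamma> t))" using fin by simp
    finally have "dist (\<gamma> r) (\<gamma> t) / \<bar>r - t\<bar> \<le> enn2real (max_quotient \<gamma> t)"
      by (simp add: ennreal_le_iff)
    then show ?thesis using False by (simp add: divide_le_eq)
  qed simp
  have "continuous_on {0..1} \<gamma>" using \<gamma> by (simp add: curves_def)
  then have "(\<lambda>n. \<gamma> (q n)) \<longlonglongrightarrow> \<gamma> s"
    by (rule continuous_on_tendsto_compose[OF _ q(2) st(1)]) (use q(1) in \<open>auto simp: unit_rats_def\<close>)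
  then have "(\<lambda>n. dist (\<gamma> (q n)) (\<gamma> t)) \<longlonglongrightarrow> dist (\<gamma> s) (\<gamma> t)" by (intro tendsto_intros)
  moreover have "(\<lambda>n. enn2real (max_quotient \<gamma> t) * \<bar>q n - t\<bar>) \<longlonglongrightarrow> enn2real (max_quotient \<gamma> t) * \<bar>s - t\<bar>"
    by (intro tendsto_intros q)
  ultimately show ?thesis
    by (rule LIMSEQ_le) (use rat q in blast)
qed

lemma dense_sequence:
  obtains q :: "nat \<Rightarrow> 'a::{metric_space, second_countable_topology}"
  where "\<And>y \<epsilon>. 0 < \<epsilon> \<Longrightarrow> \<exists>j. dist y (q j) < \<epsilon>"
proof -
  obtain X :: "'a set" where X: "countable X" "\<And>U. open U \<Longrightarrow> U \<noteq> {} \<Longrightarrow> \<exists>x\<in>X. x \<in> U"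
    by (rule countable_dense_setE) blast
  have "\<exists>j. dist y (from_nat_into X j) < \<epsilon>" if "0 < \<epsilon>" for y \<epsilon>
  proof -
    obtain z where z: "z \<in> X" "z \<in> ball y \<epsilon>" using X(2)[of "ball y \<epsilon>"] \<open>0 < \<epsilon>\<close> by auto
    obtain j where "from_nat_into X j = z" using from_nat_into_surj[OF X(1) z(1)] by blast
    then show ?thesis using z(2) by auto
  qed
  then show ?thesis by (rule that)
qed

section \<open>Speed, energy and absolute continuity of curves under a test plan\<close>

context highways
begin

text \<open>\<open>metric_speed\<close> is a \<open>Lim\<close> and says something only where the
  quotient converges; \<open>S\<close> is an integrable version of it that is defined everywhere and
  still bounds the distances.\<close>

lemma abs_cont_speed:
  assumes "abs_cont_g UNIV g \<gamma>"
  shows "\<exists>S. integrable lborel S \<and> (\<forall>r. 0 \<le> S r) \<and>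
     (\<forall>s t. 0 \<le> s \<longrightarrow> s \<le> t \<longrightarrow> t \<le> 1 \<longrightarrow> d (\<gamma> s) (\<gamma> t) \<le> (LINT r:{s..t}|lborel. S r)) \<and>
     (AE t in lborel. t \<in> {0..1} \<longrightarrow> metric_speed UNIV g \<gamma> t = S t)"
proof -
  obtain m where m: "set_integrable lborel {0..1::real} m"
    "\<And>s t. 0 \<le> s \<Longrightarrow> s \<le> t \<Longrightarrow> t \<le> 1 \<Longrightarrow> d (\<gamma> s) (\<gamma> t) \<le> (LINT r:{s..t}|lborel. m r)"
    using assms by (auto simp: abs_cont_g_def)
  obtain q :: "nat \<Rightarrow> real^'n" where q: "\<And>y \<epsilon>. 0 < \<epsilon> \<Longrightarrow> \<exists>j. dist y (q j) < \<epsilon>"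
    by (rule dense_sequence) blast
  have dense: "\<exists>n. d x (q n) < \<epsilon>" if "0 < \<epsilon>" for x \<epsilon>
    using q[OF that, of x] le_less_trans[OF d_le_norm] unfolding dist_norm by blast
  obtain S where S: "integrable lborel S" "\<forall>r. 0 \<le> S r"
     "\<forall>s t. 0 \<le> s \<longrightarrow> s \<le> t \<longrightarrow> t \<le> 1 \<longrightarrow> d (\<gamma> s) (\<gamma> t) \<le> (LINT r:{s..t}|lborel. S r)"
     "AE t in lborel. t \<in> {0..1} \<longrightarrow> ((\<lambda>s. d (\<gamma> s) (\<gamma> t) / \<bar>s - t\<bar>) \<longlongrightarrow> S t) (at t within {0..1})"
    using metric_derivative_exists[of d q m \<gamma>, OF d_sym d_triangle dense m] by blast
  have "AE t in lborel. t \<in> {0..1} \<longrightarrow> metric_speed UNIV g \<gamma> t = S t"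
    using S(4)
  proof eventually_elim
    case (elim t)
    show ?case
    proof
      assume t: "t \<in> {0..1}"
      then have "at t within {0..1} \<noteq> bot" by (simp add: trivial_limit_within islimpt_Icc)
      from tendsto_Lim[OF this] elim t show "metric_speed UNIV g \<gamma> t = S t"
        by (simp add: metric_speed_def)
    qed
  qed
  then show ?thesis using S by blast
qed

lemma set_nn_integral_speed_cong:
  assumes "AE t in lborel. t \<in> {0..1} \<longrightarrow> metric_speed UNIV g \<gamma> t = S t"
  shows "(\<integral>\<^sup>+ t\<in>{0..1}. F (metric_speed UNIV g \<gamma> t) \<partial>lborel) = (\<integral>\<^sup>+ t\<in>{0..1}. F (S t) \<partial>lborel)"
  by (rule nn_integral_cong_AE) (use assms in \<open>auto elim!: eventually_mono simp: indicator_def\<close>)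

text \<open>For a curve that is not absolutely continuous the right side is infinite. For the others
  the maximal estimate applies to the speed, its factor 2 being the one in
  \<open>norm_le_d\<close>.\<close>

lemma max_quotient_energy:
  assumes \<gamma>: "\<gamma> \<in> curves UNIV"
  shows "(\<integral>\<^sup>+ t\<in>{0..1}. max_quotient \<gamma> t \<partial>lborel) \<le> 1 + 80 * energy UNIV g \<gamma>"
proof (cases "abs_cont_g UNIV g \<gamma>")
  case True
  then obtain S where S: "integrable lborel S" "\<forall>r. 0 \<le> S r"
     "\<forall>s t. 0 \<le> s \<longrightarrow> s \<le> t \<longrightarrow> t \<le> 1 \<longrightarrow> d (\<gamma> s) (\<gamma> t) \<le> (LINT r:{s..t}|lborel. S r)"
     "AE t in lborel. t \<in> {0..1} \<longrightarrow> metric_speed UNIV g \<gamma> t = S t"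
    using abs_cont_speed by blast
  have "energy UNIV g \<gamma> = (\<integral>\<^sup>+ t\<in>{0..1}. ennreal ((S t)\<^sup>2) \<partial>lborel)"
    using True by (simp add: energy_def set_nn_integral_speed_cong[OF S(4), of "\<lambda>r. ennreal (r\<^sup>2)"])
  moreover have "(\<integral>\<^sup>+ t\<in>{0..1}. max_quotient \<gamma> t \<partial>lborel) \<le> 1 + 80 * (\<integral>\<^sup>+ t\<in>{0..1}. ennreal ((S t)\<^sup>2) \<partial>lborel)"
  proof (rule maximal_quotient_energy[OF S(1)])
    show "0 \<le> S r" for r using S by blast
    show "dist (\<gamma> s) (\<gamma> t) \<le> 2 * (LINT r:{s..t}|lborel. S r)" if "0 \<le> s" "s \<le> t" "t \<le> 1" for s t
      using norm_le_d[of "\<gamma> s" "\<gamma> t"] S(3) that by (fastforce simp: dist_norm)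
    show "max_quotient \<gamma> \<in> borel_measurable borel"
      using measurable_Pair2[OF measurable_max_quotient[where U = UNIV], of \<gamma>] \<gamma> by (simp add: space_curve_space)
    show "max_quotient \<gamma> t \<le> ennreal B"
      if "t \<in> {0..1}" "0 \<le> B" "\<And>s. s \<in> {0..1} \<Longrightarrow> dist (\<gamma> s) (\<gamma> t) \<le> B * \<bar>s - t\<bar>" for t B
      using that max_quotient_le by blast
  qed
  ultimately show ?thesis by simp
next
  case False
  then have "energy UNIV g \<gamma> = \<infinity>" by (simp add: energy_def)
  then show ?thesis by (simp add: ennreal_mult_eq_top_iff)
qed

text \<open>For every \<open>r\<close> between \<open>s\<close> and \<open>t\<close>, passing through \<open>\<gamma> r\<close> bounds the distance of \<open>\<gamma> s\<close> and \<open>\<gamma> t\<close> by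
  \<open>(t - s)\<close> times the largest difference quotient at \<open>r\<close>; average over \<open>r\<close>.\<close>

lemma max_quotient_abs_cont:
  assumes \<gamma>: "\<gamma> \<in> curves UNIV" and fin: "(\<integral>\<^sup>+ t\<in>{0..1}. max_quotient \<gamma> t \<partial>lborel) < \<infinity>"
  shows "abs_cont_g UNIV g \<gamma>"
proof -
  have [measurable]: "max_quotient \<gamma> \<in> borel_measurable borel"
    using measurable_Pair2[OF measurable_max_quotient[where U = UNIV], of \<gamma>] \<gamma> by (simp add: space_curve_space)
  define m where "m r = enn2real (max_quotient \<gamma> r)" for r
  have [measurable]: "m \<in> borel_measurable borel" by (simp add: m_def[abs_def])
  have ae: "AE r in lborel. max_quotient \<gamma> r * indicator {0..1} r \<noteq> \<infinity>"
    using fin by (intro nn_integral_PInf_AE) auto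
  have mint: "set_integrable lborel {0..1} m"
    unfolding set_integrable_def
  proof (rule integrableI_bounded)
    have "(\<integral>\<^sup>+ x. ennreal (norm (indicator {0..1} x *\<^sub>R m x)) \<partial>lborel) = (\<integral>\<^sup>+ t\<in>{0..1}. max_quotient \<gamma> t \<partial>lborel)"
      by (rule nn_integral_cong_AE)
        (use ae in \<open>eventually_elim, auto simp: indicator_def m_def less_top\<close>)
    then show "(\<integral>\<^sup>+ x. ennreal (norm (indicator {0..1} x *\<^sub>R m x)) \<partial>lborel) < \<infinity>" using fin by simp
  qed simp
  have "d (\<gamma> s) (\<gamma> t) \<le> (LINT r:{s..t}|lborel. m r)" if st: "0 \<le> s" "s \<le> t" "t \<le> 1" for s t
  proof (cases "s = t")
    case True
    then show ?thesis using d_le_norm[of "\<gamma> t" "\<gamma> t"]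
      by (simp add: set_lebesgue_integral_def m_def integral_nonneg order_trans)
  next
    case False
    let ?c = "dist (\<gamma> s) (\<gamma> t) / (t - s)"
    have ae': "AE r in lborel. r \<in> {s..t} \<longrightarrow> ?c \<le> m r"
      using ae
    proof eventually_elim
      case (elim r)
      show ?case
      proof
        assume r: "r \<in> {s..t}"
        then have r01: "r \<in> {0..1}" and s01: "s \<in> {0..1}" and t01: "t \<in> {0..1}" using st by auto
        have fin: "max_quotient \<gamma> r < \<infinity>" using elim r01 by (simp add: less_top)
        have "dist (\<gamma> s) (\<gamma> t) \<le> dist (\<gamma> s) (\<gamma> r) + dist (\<gamma> t) (\<gamma> r)" by (rule dist_triangle2)
        also have "\<dots> \<le> m r * \<bar>s - r\<bar> + m r * \<bar>t - r\<bar>"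
          unfolding m_def by (intro add_mono dist_le_max_quotient[OF \<gamma> _ r01 fin] s01 t01)
        also have "\<dots> = m r * (t - s)" using r by (simp add: algebra_simps)
        finally show "?c \<le> m r" using False st by (simp add: divide_le_eq)
      qed
    qed
    have "d (\<gamma> s) (\<gamma> t) \<le> dist (\<gamma> s) (\<gamma> t)" using d_le_norm by (simp add: dist_norm)
    also have "\<dots> = (LINT r:{s..t}|lborel. ?c)"
      using False st by (simp add: set_lebesgue_integral_def)
    also have "\<dots> \<le> (LINT r:{s..t}|lborel. m r)"
      unfolding set_lebesgue_integral_def
    proof (rule integral_mono_AE)
      show "integrable lborel (\<lambda>r. indicator {s..t} r *\<^sub>R ?c)"
        using st by (intro integrable_scaleR_left integrable_real_indicator) auto
      show "integrable lborel (\<lambda>r. indicator {s..t} r *\<^sub>R m r)"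
        using set_integrable_subset[OF mint, of "{s..t}"] st by (simp add: set_integrable_def)
      show "AE r in lborel. indicator {s..t} r *\<^sub>R ?c \<le> indicator {s..t} r *\<^sub>R m r"
        using ae' by eventually_elim (simp add: indicator_def)
    qed
    finally show ?thesis .
  qed
  then show ?thesis using mint unfolding abs_cont_g_def by blast
qed

text \<open>The energy is infinite on curves that are not absolutely continuous, but a finite lower
  integral does not exclude a non-measurable set of such curves with positive outer measure. The
  integrated largest quotient \<open>H\<close> is measurable, so its finite integral does make it
  finite almost everywhere.\<close>

lemma test_plan_AE_abs_cont:
  assumes \<pi>: "test_plan UNIV g \<pi>"
  shows "AE \<gamma> in \<pi>. abs_cont_g UNIV g \<gamma>"
proof -
  have ps: "prob_space \<pi>" and sets: "sets \<pi> = sets (curve_space UNIV)"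
    and fin: "(\<integral>\<^sup>+ \<gamma>. energy UNIV g \<gamma> \<partial>\<pi>) < \<infinity>"
    using \<pi> by (auto simp: test_plan_def)
  have sp: "space \<pi> = curves UNIV" using sets_eq_imp_space_eq[OF sets] by (simp add: space_curve_space)
  define H where "H \<gamma> = (\<integral>\<^sup>+ t\<in>{0..1}. max_quotient \<gamma> t \<partial>lborel)" for \<gamma> :: "real \<Rightarrow> real^'n"
  have "(\<lambda>x. max_quotient (fst x) (snd x) * indicator {0..1} (snd x))
      \<in> borel_measurable (curve_space (UNIV :: (real^'n) set) \<Otimes>\<^sub>M lborel)"
    using measurable_max_quotient[where U = "UNIV::(real^'n) set"]
    by (intro borel_measurable_times_ennreal) (simp_all add: case_prod_beta')
  then have "H \<in> borel_measurable (curve_space UNIV)"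
    unfolding H_def[abs_def] by (intro lborel.borel_measurable_nn_integral) (simp add: case_prod_beta')
  then have Hm[measurable]: "H \<in> borel_measurable \<pi>" by (simp cong: measurable_cong_sets add: sets)
  \<comment> \<open>The factor 1/80 cancels the constant of
    \<open>max_quotient_energy\<close>.\<close>
  define Y where "Y \<gamma> = ennreal (1 / 80) * H \<gamma>" for \<gamma>
  have "(\<integral>\<^sup>+ \<gamma>. Y \<gamma> \<partial>\<pi>) \<le> 1 + (\<integral>\<^sup>+ \<gamma>. energy UNIV g \<gamma> \<partial>\<pi>)"
  proof (rule nn_integral_le_const_add[OF ps])
    fix \<gamma> assume "\<gamma> \<in> space \<pi>"
    then have "Y \<gamma> \<le> ennreal (1 / 80) * (1 + 80 * energy UNIV g \<gamma>)"
      unfolding Y_def H_def by (intro mult_left_mono max_quotient_energy) (auto simp: sp)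
    also have "\<dots> = ennreal (1 / 80) + ennreal (1 / 80) * ennreal 80 * energy UNIV g \<gamma>"
      by (simp add: distrib_left mult.assoc)
    also have "ennreal (1 / 80) * ennreal 80 = 1" by (subst ennreal_mult[symmetric]) auto
    also have "ennreal (1 / 80) + 1 * energy UNIV g \<gamma> \<le> 1 + energy UNIV g \<gamma>"
      by (simp add: add_right_mono)
    finally show "Y \<gamma> \<le> 1 + energy UNIV g \<gamma>" .
  qed
  also have "\<dots> < \<infinity>" using fin by simp
  finally have "AE \<gamma> in \<pi>. Y \<gamma> \<noteq> \<infinity>" by (intro nn_integral_PInf_AE) (auto simp: Y_def[abs_def])
  then show ?thesis
    using AE_space
  proof eventually_elim
    case (elim \<gamma>)
    then have "H \<gamma> < \<infinity>" by (auto simp: Y_def ennreal_mult_eq_top_iff less_top)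
    then show ?case using elim(2) max_quotient_abs_cont by (simp add: sp H_def)
  qed
qed

text \<open>On an absolutely continuous curve the increment of f is at most the Euclidean distance
  of the endpoints, hence at most twice the integral of the speed. The finiteness clause of the
  definition follows from 2 S \<le> 1 + S^2 and the finite energy of the plan.\<close>

lemma weak_upper_gradient_two:
  assumes f: "\<And>x y. \<bar>f x - f y\<bar> \<le> norm (x - y)"
  shows "weak_upper_gradient UNIV g f (\<lambda>_. 2)"
  unfolding weak_upper_gradient_def
proof (intro conjI allI impI)
  fix \<pi> assume \<pi>: "test_plan UNIV g \<pi>"
  have ps: "prob_space \<pi>" and fin: "(\<integral>\<^sup>+ \<gamma>. energy UNIV g \<gamma> \<partial>\<pi>) < \<infinity>"
    using \<pi> by (auto simp: test_plan_def)
  let ?X = "\<lambda>\<gamma>. \<integral>\<^sup>+ t\<in>{0..1}. ennreal (2 * metric_speed UNIV g \<gamma> t) \<partial>lborel"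
  have X_le: "?X \<gamma> \<le> 1 + energy UNIV g \<gamma>" for \<gamma>
  proof (cases "abs_cont_g UNIV g \<gamma>")
    case True
    then obtain S where S: "integrable lborel S" "\<forall>r. 0 \<le> S r"
     "AE t in lborel. t \<in> {0..1} \<longrightarrow> metric_speed UNIV g \<gamma> t = S t"
      using abs_cont_speed by blast
    have [measurable]: "S \<in> borel_measurable borel" using S by (simp add: borel_measurable_integrable)
    have "?X \<gamma> = (\<integral>\<^sup>+ t\<in>{0..1}. ennreal (2 * S t) \<partial>lborel)"
      by (rule set_nn_integral_speed_cong[OF S(3), of "\<lambda>r. ennreal (2 * r)"])
    also have "\<dots> \<le> (\<integral>\<^sup>+ t. indicator {0..1} t + ennreal ((S t)\<^sup>2) * indicator {0..1} t \<partial>lborel)"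
    proof (rule nn_integral_mono)
      fix t :: real
      have "0 \<le> (S t - 1)\<^sup>2" by simp
      then have "2 * S t \<le> 1 + (S t)\<^sup>2" by (simp add: power2_eq_square algebra_simps)
      then have "ennreal (2 * S t) \<le> ennreal (1 + (S t)\<^sup>2)" by (rule ennreal_leI)
      also have "\<dots> = 1 + ennreal ((S t)\<^sup>2)" by (subst ennreal_plus) auto
      finally have "ennreal (2 * S t) \<le> 1 + ennreal ((S t)\<^sup>2)" .
      then show "ennreal (2 * S t) * indicator {0..1} t \<le> indicator {0..1} t + ennreal ((S t)\<^sup>2) * indicator {0..1} t"
        by (simp add: indicator_def)
    qed
    also have "\<dots> = 1 + (\<integral>\<^sup>+ t\<in>{0..1}. ennreal ((S t)\<^sup>2) \<partial>lborel)"
      by (subst nn_integral_add) auto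
    also have "(\<integral>\<^sup>+ t\<in>{0..1}. ennreal ((S t)\<^sup>2) \<partial>lborel) = energy UNIV g \<gamma>"
      using True by (simp add: energy_def set_nn_integral_speed_cong[OF S(3), of "\<lambda>r. ennreal (r\<^sup>2)"])
    finally show ?thesis .
  qed (simp add: energy_def)
  have "(\<integral>\<^sup>+ \<gamma>. ?X \<gamma> \<partial>\<pi>) \<le> 1 + (\<integral>\<^sup>+ \<gamma>. energy UNIV g \<gamma> \<partial>\<pi>)"
    by (intro nn_integral_le_const_add[OF ps] X_le)
  also have "\<dots> < \<infinity>" using fin by simp
  finally show "(\<integral>\<^sup>+ \<gamma>. ?X \<gamma> \<partial>\<pi>) < \<infinity>" .
  show "(\<integral>\<^sup>+ \<gamma>. ennreal \<bar>f (\<gamma> 1) - f (\<gamma> 0)\<bar> \<partial>\<pi>) \<le> (\<integral>\<^sup>+ \<gamma>. ?X \<gamma> \<partial>\<pi>)"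
  proof (rule nn_integral_mono_AE)
    show "AE \<gamma> in \<pi>. ennreal \<bar>f (\<gamma> 1) - f (\<gamma> 0)\<bar> \<le> ?X \<gamma>"
      using test_plan_AE_abs_cont[OF \<pi>]
    proof eventually_elim
      case (elim \<gamma>)
      then obtain S where S: "integrable lborel S" "\<forall>r. 0 \<le> S r"
         "\<forall>s t. 0 \<le> s \<longrightarrow> s \<le> t \<longrightarrow> t \<le> 1 \<longrightarrow> d (\<gamma> s) (\<gamma> t) \<le> (LINT r:{s..t}|lborel. S r)"
         "AE t in lborel. t \<in> {0..1} \<longrightarrow> metric_speed UNIV g \<gamma> t = S t"
        using abs_cont_speed by blast
      have "\<bar>f (\<gamma> 1) - f (\<gamma> 0)\<bar> \<le> norm (\<gamma> 0 - \<gamma> 1)" using f[of "\<gamma> 1" "\<gamma> 0"] by (simp add: norm_minus_commute)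
      also have "\<dots> \<le> 2 * (LINT r:{0..1}|lborel. S r)"
        using norm_le_d[of "\<gamma> 0" "\<gamma> 1"] S(3)[rule_format, of 0 1] by simp
      also have "\<dots> = (LINT r|lborel. indicator {0..1} r * (2 * S r))"
        by (simp add: set_lebesgue_integral_def mult.left_commute)
      finally have "ennreal \<bar>f (\<gamma> 1) - f (\<gamma> 0)\<bar> \<le> ennreal (LINT r|lborel. indicator {0..1} r * (2 * S r))"
        by (rule ennreal_leI)
      also have "\<dots> = (\<integral>\<^sup>+ r. ennreal (indicator {0..1} r * (2 * S r)) \<partial>lborel)"
        using S(1,2) integrable_mult_indicator[of "{0..1::real}" lborel "\<lambda>r. 2 * S r"]
        by (subst nn_integral_eq_integral) auto
      also have "\<dots> = (\<integral>\<^sup>+ t\<in>{0..1}. ennreal (2 * S t) \<partial>lborel)"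
        by (intro nn_integral_cong) (simp add: indicator_def)
      also have "\<dots> = ?X \<gamma>"
        by (rule set_nn_integral_speed_cong[OF S(4), of "\<lambda>r. ennreal (2 * r)", symmetric])
      finally show ?case .
    qed
  qed
qed auto

end

section \<open>Minimality of the constant weak upper gradient\<close>

lemma emeasure_lborel_vimage_plus:
  fixes A :: "'a::euclidean_space set"
  assumes "A \<in> sets borel"
  shows "emeasure lborel {x. x + v \<in> A} = emeasure lborel A"
proof -
  have "emeasure lborel A = emeasure (distr lborel borel ((+) v)) A" by (simp add: lborel_distr_plus)
  also have "\<dots> = emeasure lborel ((+) v -` A \<inter> space lborel)" using assms by (subst emeasure_distr) auto
  also have "(+) v -` A \<inter> space lborel = {x. x + v \<in> A}" by (auto simp: add.commute)
  finally show ?thesis by simp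
qed

lemma nn_integral_lborel_shift:
  fixes f :: "'a::euclidean_space \<Rightarrow> ennreal"
  assumes [measurable]: "f \<in> borel_measurable borel"
  shows "(\<integral>\<^sup>+ x. f (x + v) \<partial>lborel) = (\<integral>\<^sup>+ x. f x \<partial>lborel)"
proof -
  have "(\<integral>\<^sup>+ x. f x \<partial>lborel) = (\<integral>\<^sup>+ x. f x \<partial>distr lborel borel ((+) v))" by (simp add: lborel_distr_plus)
  also have "\<dots> = (\<integral>\<^sup>+ x. f (x + v) \<partial>lborel)" by (subst nn_integral_distr) (auto simp: add.commute)
  finally show ?thesis by simp
qed

lemma emeasure_lborel_cball_neq_0:
  fixes x :: "'a::euclidean_space"
  assumes "0 < r"
  shows "emeasure lborel (cball x r) \<noteq> 0"
proof
  assume "emeasure lborel (cball x r) = 0"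
  then have "cball x r \<in> null_sets lborel" by (simp add: null_sets_def)
  then have "negligible (cball x r)" using negligible_iff_null_sets null_sets_completionI by blast
  then have "negligible (ball x r)" using negligible_subset ball_subset_cball by blast
  then show False using assms open_not_negligible[of "ball x r"] by simp
qed

text \<open>On a compact subset of a set where \<open>G\<close> is at most c - c / (j + 1), the
  assumed average forces measure 0; inner regularity then makes the whole set null, and the sets
  \<open>A j\<close> exhaust the points with \<open>G x\<close> below c.\<close>

lemma AE_ge_of_compact_average:
  fixes G :: "'a::euclidean_space \<Rightarrow> ennreal"
  assumes G[measurable]: "G \<in> borel_measurable borel" and c: "0 < c"
    and K: "\<And>K. compact K \<Longrightarrow> ennreal c * emeasure lborel K \<le> (\<integral>\<^sup>+ x\<in>K. G x \<partial>lborel)"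
  shows "AE x in lborel. ennreal c \<le> G x"
proof -
  define A where "A j = {x \<in> cball 0 (real j). G x \<le> ennreal (c - c / (real j + 1))}" for j
  have Am[measurable]: "A j \<in> sets borel" for j by (simp add: A_def)
  have null: "A j \<in> null_sets lborel" for j
  proof -
    \<comment> \<open>Restriction to the bounded set \<open>A j\<close> makes the measure finite, as
      inner regularity by compact sets demands.\<close>
    define \<nu> where "\<nu> = density lborel (indicator (A j) :: 'a \<Rightarrow> ennreal)"
    have \<nu>: "emeasure \<nu> B = emeasure lborel (A j \<inter> B)" if "B \<in> sets borel" for B
      unfolding \<nu>_def using that by (subst emeasure_density) (auto simp: indicator_inter_arith[symmetric] nn_integral_indicator simp flip: indicator_inter_arith)
    have fin: "emeasure lborel (A j) < \<infinity>"
    proof -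
      have "emeasure lborel (A j) \<le> emeasure lborel (cball (0::'a) (real j))"
        by (intro emeasure_mono) (auto simp: A_def)
      also have "\<dots> < \<infinity>" using emeasure_bounded_finite[OF bounded_cball, of 0 "real j"] by simp
      finally show ?thesis .
    qed
    have zero: "emeasure lborel C = 0" if C: "C \<subseteq> A j" "compact C" for C
    proof -
      have Cm[measurable]: "C \<in> sets borel" using C by (simp add: borel_compact)
      have "emeasure lborel C \<le> emeasure lborel (A j)" using C by (intro emeasure_mono) auto
      then have Cfin: "emeasure lborel C = ennreal (measure lborel C)"
        using fin by (simp add: emeasure_eq_ennreal_measure less_top[symmetric] top_unique) (metis emeasure_eq_ennreal_measure infinity_ennreal_def leD top.not_eq_extremum)
      have "ennreal c * emeasure lborel C \<le> (\<integral>\<^sup>+ x\<in>C. G x \<partial>lborel)" using K C by blast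
      also have "\<dots> \<le> (\<integral>\<^sup>+ x. ennreal (c - c / (real j + 1)) * indicator C x \<partial>lborel)"
        using C by (intro nn_integral_mono) (auto simp: A_def indicator_def)
      also have "\<dots> = ennreal (c - c / (real j + 1)) * emeasure lborel C"
        by (subst nn_integral_cmult_indicator) auto
      finally have "c * measure lborel C \<le> (c - c / (real j + 1)) * measure lborel C"
      proof -
        assume *: "ennreal c * emeasure lborel C \<le> ennreal (c - c / (real j + 1)) * emeasure lborel C"
        have "0 \<le> c - c / (real j + 1)" using c by (simp add: divide_le_eq algebra_simps)
        then show ?thesis using * c unfolding Cfin by (simp add: ennreal_mult[symmetric] ennreal_le_iff)
      qed
      then have "measure lborel C * (c / (real j + 1)) \<le> 0" by (simp add: algebra_simps)
      moreover have "0 < c / (real j + 1)" using c by simp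
      ultimately have "measure lborel C \<le> 0" by (metis mult_pos_pos not_le)
      then show ?thesis using Cfin by (simp add: antisym)
    qed
    have "emeasure \<nu> (A j) = (SUP C\<in>{C. C \<subseteq> A j \<and> compact C}. emeasure \<nu> C)"
      by (rule inner_regular) (use \<nu>[of UNIV] fin in \<open>auto simp: \<nu>_def\<close>)
    also have "\<dots> = (SUP C\<in>{C. C \<subseteq> A j \<and> compact C}. 0)"
      by (intro SUP_cong refl) (auto simp: \<nu> borel_compact Int_absorb1 zero)
    also have "\<dots> = 0" by (simp add: bot_ennreal[symmetric] del: bot_ennreal)
    finally show ?thesis using \<nu>[of "A j"] by (simp add: null_sets_def)
  qed
  have "AE x in lborel. \<forall>j. x \<notin> A j"
    unfolding AE_all_countable using AE_not_in[OF null] by blast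
  then show ?thesis
  proof eventually_elim
    case (elim x)
    show ?case
    proof (rule ccontr)
      assume "\<not> ennreal c \<le> G x"
      then obtain r where r: "G x = ennreal r" "0 \<le> r" "r < c"
        using c by (cases "G x") (auto simp: not_le ennreal_less_iff)
      obtain j1 where j1: "norm x < real j1" using reals_Archimedean2 by blast
      obtain j2 where j2: "c / (c - r) < real j2" using reals_Archimedean2 by blast
      define j where "j = max j1 j2"
      have "c / (c - r) < real j + 1" using j2 by (simp add: j_def)
      then have "c / (real j + 1) < c - r" using r c by (simp add: field_simps)
      then have "x \<in> A j" using j1 r by (simp add: A_def j_def ennreal_leI)
      then show False using elim by blast
    qed
  qed
qed

text \<open>Continuity from above for the measure with density \<open>G\<close>: the closed
  neighbourhoods of K shrink to K, and local integrability makes their masses finite.\<close>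

lemma nn_integral_decreasing_neighbourhoods:
  fixes G :: "'a::euclidean_space \<Rightarrow> ennreal"
  assumes G[measurable]: "G \<in> borel_measurable borel" and K: "compact K" "K \<noteq> {}"
    and fin: "\<And>R. (\<integral>\<^sup>+ x\<in>cball 0 R. G x \<partial>lborel) < \<infinity>"
    and le: "\<And>\<delta>. 0 < \<delta> \<Longrightarrow> B \<le> (\<integral>\<^sup>+ x\<in>{y. infdist y K \<le> \<delta>}. G x \<partial>lborel)"
  shows "B \<le> (\<integral>\<^sup>+ x\<in>K. G x \<partial>lborel)"
proof -
  define M where "M = density lborel G"
  have M: "emeasure M A = (\<integral>\<^sup>+ x\<in>A. G x \<partial>lborel)" if "A \<in> sets borel" for A
    unfolding M_def using that by (subst emeasure_density) auto
  define V where "V n = {y. infdist y K \<le> 1 / real (Suc n)}" for n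
  have "closed (V n)" for n
    unfolding V_def by (intro closed_Collect_le continuous_intros)
  then have Vm: "V n \<in> sets borel" for n by (rule borel_closed)
  obtain R where R: "\<And>x. x \<in> K \<Longrightarrow> norm x \<le> R" using compact_imp_bounded[OF K(1)] by (auto simp: bounded_iff)
  have "V n \<subseteq> cball 0 (R + 1)" for n
  proof
    fix y assume y: "y \<in> V n"
    obtain x where x: "x \<in> K" "infdist y K = dist y x"
      using infdist_attains_inf[OF compact_imp_closed[OF K(1)] K(2)] by blast
    have "infdist y K \<le> 1 / real (Suc n)" using y unfolding V_def by blast
    also have "\<dots> \<le> 1" by simp
    finally have "dist y x \<le> 1" using x by simp
    then have "norm y \<le> R + 1" using R[OF x(1)] norm_triangle_ineq[of "y - x" x] by (simp add: dist_norm)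
    then show "y \<in> cball 0 (R + 1)" by simp
  qed
  then have Vfin: "emeasure M (V n) \<noteq> \<infinity>" for n
    using emeasure_mono[of "V n" "cball 0 (R + 1)" M] fin[of "R + 1"] M[of "cball 0 (R + 1)"]
    by (simp add: M_def)
  have "decseq V"
  proof (rule decseq_SucI)
    fix n
    have "1 / real (Suc (Suc n)) \<le> 1 / real (Suc n)" by (simp add: divide_simps)
    then show "V (Suc n) \<subseteq> V n" unfolding V_def by (auto intro: order_trans)
  qed
  moreover have "range V \<subseteq> sets M" using Vm by (auto simp: M_def)
  ultimately have lim: "(\<lambda>n. emeasure M (V n)) \<longlonglongrightarrow> emeasure M (\<Inter>n. V n)"
    using Vfin by (intro Lim_emeasure_decseq)
  have "(\<Inter>n. V n) = K"
  proof (intro equalityI subsetI)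
    fix y assume y: "y \<in> (\<Inter>n. V n)"
    have "infdist y K \<le> 0"
    proof (rule field_le_epsilon)
      fix \<epsilon> :: real assume "0 < \<epsilon>"
      then obtain n where "1 / real (Suc n) < \<epsilon>" using reals_Archimedean by (auto simp: inverse_eq_divide)
      moreover have "infdist y K \<le> 1 / real (Suc n)" using y by (simp add: V_def)
      ultimately show "infdist y K \<le> 0 + \<epsilon>" by linarith
    qed
    then have "infdist y K = 0" using infdist_nonneg[of y K] by linarith
    then show "y \<in> K" using in_closed_iff_infdist_zero[OF compact_imp_closed[OF K(1)] K(2)] by blast
  qed (auto simp: V_def)
  moreover have "B \<le> emeasure M (\<Inter>n. V n)"
  proof (rule LIMSEQ_le_const[OF lim])
    show "\<exists>N. \<forall>n\<ge>N. B \<le> emeasure M (V n)"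
      using le[of "1 / real (Suc _)"] M[OF Vm] by (simp add: V_def)
  qed
  ultimately show ?thesis using M borel_compact[OF K(1)] by simp
qed

section \<open>Test plans translating a compact set in direction \<open>e\<close>\<close>

context highways
begin

definition line :: "real \<Rightarrow> real^'n \<Rightarrow> real \<Rightarrow> real^'n" where
  "line s x = (\<lambda>t\<in>{0..1}. x + (t * s) *\<^sub>R e)"

lemma line_apply [simp]: "t \<in> {0..1} \<Longrightarrow> line s x t = x + (t * s) *\<^sub>R e"
  by (simp add: line_def)

lemma line_in_curves: "line s x \<in> curves UNIV"
proof -
  have "continuous_on {0..1} (line s x)"
    by (rule continuous_on_cong[THEN iffD2, of _ _ _ "\<lambda>t. x + (t * s) *\<^sub>R e"]) (auto intro!: continuous_intros)
  then show ?thesis by (simp add: curves_def line_def)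
qed

lemma measurable_line: "line s \<in> measurable borel (curve_space UNIV)"
  unfolding curve_space_def
proof (rule measurable_restrict_space2)
  show "line s \<in> space borel \<rightarrow> curves UNIV" using line_in_curves by blast
  show "line s \<in> measurable borel (Pi\<^sub>M {0..1} (\<lambda>_. borel))"
    unfolding line_def[abs_def] by (rule measurable_restrict) measurable
qed

text \<open>The range of \<open>line s\<close>, written with countably many conditions so that it is
  a measurable set of curves; continuity recovers all times from the rational ones.\<close>

definition lines :: "real \<Rightarrow> (real \<Rightarrow> real^'n) set" where
  "lines s = {\<gamma> \<in> curves UNIV. \<forall>t\<in>unit_rats. \<gamma> t - \<gamma> 0 = (t * s) *\<^sub>R e}"

lemma lines_eq: "\<gamma> \<in> lines s \<longleftrightarrow> \<gamma> = line s (\<gamma> 0)"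
proof
  assume \<gamma>: "\<gamma> \<in> lines s"
  then have c: "continuous_on {0..1} \<gamma>" and ext: "\<gamma> \<in> extensional {0..1}"
    and rat: "\<And>t. t \<in> unit_rats \<Longrightarrow> \<gamma> t = \<gamma> 0 + (t * s) *\<^sub>R e"
    by (auto simp: lines_def curves_def algebra_simps)
  show "\<gamma> = line s (\<gamma> 0)"
  proof (rule extensionalityI[OF ext])
    show "line s (\<gamma> 0) \<in> extensional {0..1}" by (simp add: line_def)
    fix t :: real assume t: "t \<in> {0..1}"
    obtain q where q: "\<And>n. q n \<in> unit_rats" "q \<longlonglongrightarrow> t" using unit_rats_dense[OF t] by blast
    have "(\<lambda>n. \<gamma> (q n)) \<longlonglongrightarrow> \<gamma> t"
      by (rule continuous_on_tendsto_compose[OF c q(2) t]) (use q(1) in \<open>auto simp: unit_rats_def\<close>)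
    moreover have "(\<lambda>n. \<gamma> 0 + (q n * s) *\<^sub>R e) \<longlonglongrightarrow> \<gamma> 0 + (t * s) *\<^sub>R e"
      by (intro tendsto_intros q)
    ultimately have "\<gamma> t = \<gamma> 0 + (t * s) *\<^sub>R e"
      using rat[OF q(1)] by (simp add: LIMSEQ_unique)
    then show "\<gamma> t = line s (\<gamma> 0) t" using t by simp
  qed
next
  assume eq: "\<gamma> = line s (\<gamma> 0)"
  have "\<gamma> t - \<gamma> 0 = (t * s) *\<^sub>R e" if "t \<in> unit_rats" for t
  proof -
    have "t \<in> {0..1}" using that by (simp add: unit_rats_def)
    then have "\<gamma> t = \<gamma> 0 + (t * s) *\<^sub>R e" by (subst eq) simp
    then show ?thesis by simp
  qed
  moreover have "\<gamma> \<in> curves UNIV" by (subst eq) (rule line_in_curves)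
  ultimately show "\<gamma> \<in> lines s" by (simp add: lines_def)
qed

lemma line_in_lines: "line s x \<in> lines s"
  by (simp add: lines_eq)

lemma lines_measurable: "lines s \<in> sets (curve_space UNIV)"
proof -
  have "(\<Inter>t\<in>unit_rats. {\<gamma> \<in> space (curve_space UNIV). \<gamma> t - \<gamma> 0 = (t * s) *\<^sub>R e}) \<in> sets (curve_space UNIV)"
  proof (rule sets.countable_INT'[OF countable_unit_rats])
    show "unit_rats \<noteq> {}" by (auto simp: unit_rats_def intro: exI[of _ 0])
    show "(\<lambda>t. {\<gamma> \<in> space (curve_space UNIV). \<gamma> t - \<gamma> 0 = (t * s) *\<^sub>R e}) ` unit_rats \<subseteq> sets (curve_space UNIV)"
    proof safe
      fix t assume "t \<in> unit_rats"
      then have "(\<lambda>\<gamma>. \<gamma> t) \<in> measurable (curve_space UNIV) (borel :: (real^'n) measure)"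
        by (intro measurable_eval) (simp add: unit_rats_def)
      then have "(\<lambda>\<gamma>. \<gamma> t - \<gamma> 0) \<in> measurable (curve_space UNIV) (borel :: (real^'n) measure)"
        by (intro borel_measurable_diff) (auto intro: measurable_eval)
      from measurable_sets[OF this, of "{(t * s) *\<^sub>R e}"]
      show "{\<gamma> \<in> space (curve_space UNIV). \<gamma> t - \<gamma> 0 = (t * s) *\<^sub>R e} \<in> sets (curve_space UNIV)"
        by (simp add: vimage_def Int_def conj_commute)
    qed
  qed
  moreover have "lines s = (\<Inter>t\<in>unit_rats. {\<gamma> \<in> space (curve_space UNIV). \<gamma> t - \<gamma> 0 = (t * s) *\<^sub>R e})"
    by (auto simp: lines_def space_curve_space unit_rats_def)
  ultimately show ?thesis by simp
qed

lemma metric_speed_line: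
  assumes t: "t \<in> {0..1}"
  shows "metric_speed UNIV g (line s x) t = \<bar>s\<bar> / 2"
proof -
  have "d (line s x r) (line s x t) / \<bar>r - t\<bar> = \<bar>s\<bar> / 2" if "r \<in> {0..1}" "r \<noteq> t" for r
  proof -
    have "line s x r = line s x t + ((r - t) * s) *\<^sub>R e"
      using that t by (simp add: algebra_simps)
    then have "d (line s x r) (line s x t) = \<bar>(r - t) * s\<bar> / 2"
      using d_axis[of "line s x t" "(r - t) * s"] d_sym by metis
    then show ?thesis using that by (simp add: abs_mult)
  qed
  then have "((\<lambda>r. d (line s x r) (line s x t) / \<bar>r - t\<bar>) \<longlongrightarrow> \<bar>s\<bar> / 2) (at t within {0..1})"
    by (intro tendsto_eventually) (auto simp: eventually_at_filter)
  moreover have "at t within {0..1} \<noteq> bot" using t by (simp add: trivial_limit_within islimpt_Icc)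
  ultimately show ?thesis unfolding metric_speed_def by (intro tendsto_Lim)
qed

lemma abs_cont_line: "abs_cont_g UNIV g (line s x)"
  unfolding abs_cont_g_def
proof (intro exI[of _ "\<lambda>_. \<bar>s\<bar> / 2"] conjI allI impI)
  show "set_integrable lborel {0..1::real} (\<lambda>_. \<bar>s\<bar> / 2)"
    unfolding set_integrable_def by (intro integrable_scaleR_left integrable_real_indicator) auto
  fix a b :: real assume ab: "0 \<le> a" "a \<le> b" "b \<le> 1"
  have "line s x b = line s x a + ((b - a) * s) *\<^sub>R e" using ab by (simp add: algebra_simps)
  then have "d (line s x a) (line s x b) = \<bar>(b - a) * s\<bar> / 2" by (simp only: d_axis)
  also have "\<dots> = (LINT r:{a..b}|lborel. \<bar>s\<bar> / 2)"
    using ab by (simp add: set_lebesgue_integral_def abs_mult)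
  finally show "d (line s x a) (line s x b) \<le> (LINT r:{a..b}|lborel. \<bar>s\<bar> / 2)" by simp
qed

lemma energy_line: "energy UNIV g (line s x) = ennreal ((\<bar>s\<bar> / 2)\<^sup>2)"
proof -
  have "energy UNIV g (line s x) = (\<integral>\<^sup>+ t\<in>{0..1}. ennreal ((metric_speed UNIV g (line s x) t)\<^sup>2) \<partial>lborel)"
    by (simp add: energy_def abs_cont_line)
  also have "\<dots> = (\<integral>\<^sup>+ t\<in>{0..1::real}. ennreal ((\<bar>s\<bar> / 2)\<^sup>2) \<partial>lborel)"
    by (intro nn_integral_cong) (auto simp: indicator_def metric_speed_line)
  also have "\<dots> = ennreal ((\<bar>s\<bar> / 2)\<^sup>2)"
    by (subst nn_integral_cmult_indicator) auto
  finally show ?thesis .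
qed

lemma density_vol_g: "vol_g UNIV g = density lebesgue (\<lambda>x. ennreal (sqrt (\<psi> x ^ CARD('n))))"
  by (simp add: vol_g_def det_g lebesgue_on_UNIV_eq)

text \<open>The volume density is at least (1/4)^(d/2). This bounds the compression of the segment
  plans and shows that the total volume is positive.\<close>

lemma emeasure_le_vol_g:
  assumes "A \<in> sets borel"
  shows "ennreal (sqrt ((1 / 4) ^ CARD('n))) * emeasure lborel A \<le> emeasure (vol_g UNIV g) A"
proof -
  have "ennreal (sqrt ((1 / 4) ^ CARD('n))) * emeasure lborel A =
      (\<integral>\<^sup>+ x. ennreal (sqrt ((1 / 4) ^ CARD('n))) * indicator A x \<partial>lborel)"
    using assms by (subst nn_integral_cmult_indicator) auto
  also have "\<dots> \<le> (\<integral>\<^sup>+ x. ennreal (sqrt (\<psi> x ^ CARD('n))) * indicator A x \<partial>lborel)"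
    using \<psi>_gt by (intro nn_integral_mono mult_right_mono ennreal_leI real_sqrt_le_mono power_mono)
      (auto intro: less_imp_le)
  also have "\<dots> = (\<integral>\<^sup>+ x. ennreal (sqrt (\<psi> x ^ CARD('n))) * indicator A x \<partial>lebesgue)"
    by (simp add: nn_integral_completion)
  also have "\<dots> = emeasure (vol_g UNIV g) A"
    unfolding density_vol_g using assms
    by (subst emeasure_density) (auto intro!: measurable_completion)
  finally show ?thesis .
qed

lemma AE_vol_g: "(AE x in lborel. Q x) \<Longrightarrow> AE x in vol_g UNIV g. Q x"
  unfolding density_vol_g
  by (subst AE_density) (auto intro!: measurable_completion AE_completion elim: eventually_mono)

definition line_plan :: "(real^'n) set \<Rightarrow> real \<Rightarrow> (real \<Rightarrow> real^'n) measure" where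
  "line_plan K s = distr (uniform_measure lborel K) (curve_space UNIV) (line s)"

lemma sets_line_plan: "sets (line_plan K s) = sets (curve_space UNIV)"
  and space_line_plan: "space (line_plan K s) = curves UNIV"
  by (simp_all add: line_plan_def space_curve_space)

lemma measurable_line': "line s \<in> measurable (uniform_measure lborel K) (curve_space UNIV)"
  using measurable_line[of s] by (simp cong: measurable_cong_sets)

context
  fixes K :: "(real^'n) set"
  assumes K: "compact K" "emeasure lborel K \<noteq> 0"
begin

lemma K_borel [measurable]: "K \<in> sets borel"
  using K by (simp add: borel_compact)

lemma K_emeasure: "emeasure lborel K = ennreal (measure lborel K)" and K_measure_pos: "0 < measure lborel K"
proof -
  have "emeasure lborel K \<noteq> \<infinity>"
    using emeasure_bounded_finite[OF compact_imp_bounded[OF K(1)]] by simp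
  then show *: "emeasure lborel K = ennreal (measure lborel K)" by (simp add: emeasure_eq_ennreal_measure)
  show "0 < measure lborel K" using K(2) unfolding * by (simp add: zero_less_measure_iff *)
qed

lemma prob_space_line_plan: "prob_space (line_plan K s)"
  unfolding line_plan_def
  by (intro prob_space.prob_space_distr measurable_line' prob_space_uniform_measure) (auto simp: K K_emeasure[symmetric], simp add: K_emeasure)

text \<open>Almost-everywhere statements pass through a push-forward for measurable sets, and the
  property claimed need not describe one. The set of segments whose starting point avoids a Borel
  null set is measurable and implies the property.\<close>

lemma AE_line_plan:
  assumes "AE x in lborel. Q x"
  shows "AE \<gamma> in line_plan K s. \<exists>x. Q x \<and> \<gamma> = line s x"
proof -
  obtain N where N: "{z\<in>space lborel. \<not> Q z} \<subseteq> N" "emeasure lborel N = 0" "N \<in> sets lborel"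
    using AE_E[OF assms] by blast
  have e0: "(\<lambda>\<gamma>. \<gamma> 0) \<in> measurable (curve_space UNIV) (borel :: (real^'n) measure)" by (rule measurable_eval) simp
  have m: "{\<gamma> \<in> space (curve_space UNIV). \<gamma> \<in> lines s \<and> \<gamma> 0 \<notin> N} \<in> sets (curve_space UNIV)"
  proof -
    have "{\<gamma> \<in> space (curve_space UNIV). \<gamma> \<in> lines s \<and> \<gamma> 0 \<notin> N} =
        lines s \<inter> ((\<lambda>\<gamma>. \<gamma> 0) -` (- N) \<inter> space (curve_space UNIV))"
      by (auto simp: lines_def space_curve_space)
    also have "\<dots> \<in> sets (curve_space UNIV)"
      using N(3) by (intro sets.Int lines_measurable measurable_sets[OF e0]) auto
    finally show ?thesis .
  qed
  have nN: "AE x in lborel. x \<notin> N" using N by (intro AE_not_in) (simp add: null_sets_def)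
  have "AE x in uniform_measure lborel K. x \<notin> N"
    by (rule AE_uniform_measureI) (use nN in \<open>auto elim: eventually_mono\<close>)
  then have "AE x in uniform_measure lborel K. line s x \<in> lines s \<and> line s x 0 \<notin> N"
    by eventually_elim (simp add: line_in_lines)
  then have "AE \<gamma> in line_plan K s. \<gamma> \<in> lines s \<and> \<gamma> 0 \<notin> N"
    unfolding line_plan_def by (subst AE_distr_iff[OF measurable_line' m])
  then show ?thesis
  proof eventually_elim
    case (elim \<gamma>)
    then have "\<gamma> = line s (\<gamma> 0)" by (simp add: lines_eq)
    moreover have "Q (\<gamma> 0)" using elim N by auto
    ultimately show ?case by blast
  qed
qed

lemma emeasure_lines: "emeasure (line_plan K s) (lines s) = 1"
proof -
  have "AE \<gamma> in line_plan K s. \<gamma> \<in> lines s"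
    using AE_line_plan[of "\<lambda>_. True" s] by (auto elim!: eventually_mono simp: line_in_lines)
  then show ?thesis
    using prob_space.emeasure_eq_1_AE[OF prob_space_line_plan] lines_measurable by (simp add: sets_line_plan)
qed

text \<open>At each time the positions are uniform on a translate of K, with Lebesgue density at
  most 1 / |K|; dividing by the lower bound c on the volume density gives the compression constant.
  All segments have the same energy.\<close>

lemma test_plan_line_plan: "test_plan UNIV g (line_plan K s)"
  unfolding test_plan_def
proof (intro conjI)
  show "prob_space (line_plan K s)" by (rule prob_space_line_plan)
  show "sets (line_plan K s) = sets (curve_space UNIV)" by (rule sets_line_plan)
  have "AE \<gamma> in line_plan K s. energy UNIV g \<gamma> = ennreal ((\<bar>s\<bar> / 2)\<^sup>2)"
    using AE_line_plan[of "\<lambda>_. True" s] by (auto elim!: eventually_mono simp: energy_line)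
  then have "(\<integral>\<^sup>+ \<gamma>. energy UNIV g \<gamma> \<partial>line_plan K s) = (\<integral>\<^sup>+ \<gamma>. ennreal ((\<bar>s\<bar> / 2)\<^sup>2) \<partial>line_plan K s)"
    by (rule nn_integral_cong_AE)
  also have "\<dots> = ennreal ((\<bar>s\<bar> / 2)\<^sup>2)"
    by (simp add: prob_space.emeasure_space_1[OF prob_space_line_plan])
  finally show "(\<integral>\<^sup>+ \<gamma>. energy UNIV g \<gamma> \<partial>line_plan K s) < \<infinity>" by simp
  define c where "c = sqrt ((1 / 4) ^ CARD('n))"
  have c: "0 < c" by (simp add: c_def)
  show "\<exists>C. \<forall>t\<in>{0..1}. \<forall>A\<in>sets borel. emeasure (line_plan K s) {\<gamma> \<in> space (line_plan K s). \<gamma> t \<in> A}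
      \<le> ennreal C * emeasure (vol_g UNIV g) (A \<inter> UNIV)"
  proof (intro exI ballI)
    fix t :: real and A :: "(real^'n) set" assume t: "t \<in> {0..1}" and A[measurable]: "A \<in> sets borel"
    have m: "(\<lambda>\<gamma>. \<gamma> t) -` A \<inter> space (curve_space UNIV) \<in> sets (curve_space UNIV)"
      by (rule measurable_sets[OF measurable_eval[OF t] A])
    have "{\<gamma> \<in> space (line_plan K s). \<gamma> t \<in> A} = (\<lambda>\<gamma>. \<gamma> t) -` A \<inter> space (curve_space UNIV)"
      by (auto simp: space_line_plan space_curve_space)
    then have "emeasure (line_plan K s) {\<gamma> \<in> space (line_plan K s). \<gamma> t \<in> A} =
      emeasure (uniform_measure lborel K) (line s -` ((\<lambda>\<gamma>. \<gamma> t) -` A \<inter> space (curve_space UNIV)) \<inter> space (uniform_measure lborel K))"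
      using emeasure_distr[OF measurable_line' m] by (simp add: line_plan_def)
    also have "line s -` ((\<lambda>\<gamma>. \<gamma> t) -` A \<inter> space (curve_space UNIV)) \<inter> space (uniform_measure lborel K)
        = {x. x + (t * s) *\<^sub>R e \<in> A}"
      using line_in_curves t by (auto simp: space_curve_space)
    also have "emeasure (uniform_measure lborel K) {x. x + (t * s) *\<^sub>R e \<in> A} =
        emeasure lborel (K \<inter> {x. x + (t * s) *\<^sub>R e \<in> A}) / emeasure lborel K"
      by (rule emeasure_uniform_measure) auto
    also have "\<dots> = ennreal (1 / measure lborel K) * emeasure lborel (K \<inter> {x. x + (t * s) *\<^sub>R e \<in> A})"
      unfolding K_emeasure divide_ennreal_def using K_measure_pos
      by (simp add: inverse_ennreal inverse_eq_divide mult.commute)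
    also have "\<dots> \<le> ennreal (1 / measure lborel K) * emeasure lborel A"
      using emeasure_mono[of "K \<inter> {x. x + (t * s) *\<^sub>R e \<in> A}" "{x. x + (t * s) *\<^sub>R e \<in> A}" lborel]
        emeasure_lborel_vimage_plus[OF A, of "(t * s) *\<^sub>R e"]
      by (intro mult_left_mono) auto
    also have "\<dots> = ennreal (1 / (measure lborel K * c)) * (ennreal c * emeasure lborel A)"
      using c K_measure_pos by (simp add: mult.assoc[symmetric] ennreal_mult[symmetric])
    also have "\<dots> \<le> ennreal (1 / (measure lborel K * c)) * emeasure (vol_g UNIV g) (A \<inter> UNIV)"
      using emeasure_le_vol_g[OF A] by (intro mult_left_mono) (auto simp: c_def)
    finally show "emeasure (line_plan K s) {\<gamma> \<in> space (line_plan K s). \<gamma> t \<in> A}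
        \<le> ennreal (1 / (measure lborel K * c)) * emeasure (vol_g UNIV g) (A \<inter> UNIV)" .
  qed
qed

text \<open>Each segment gains s in the k-th coordinate at metric speed s / 2, so the inequality for
  this plan reads s \<le> s / (2 |K|) times the integral on the right. Multiplication by 2 |K| / s
  removes the length s, which can then be sent to 0. Finiteness is the second clause of the
  definition of a weak upper gradient.\<close>

lemma weak_upper_gradient_line_plan:
  assumes wug: "weak_upper_gradient UNIV g (\<lambda>x. x $ k) G" and s: "0 < s"
    and G0[measurable]: "G0 \<in> borel_measurable borel" and eq: "AE x in lborel. ennreal (G x) = G0 x"
  shows "2 * emeasure lborel K \<le> (\<integral>\<^sup>+ t\<in>{0..1}. (\<integral>\<^sup>+ y. G0 y * indicator K (y - (t * s) *\<^sub>R e) \<partial>lborel) \<partial>lborel)"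
    and "(\<integral>\<^sup>+ t\<in>{0..1}. (\<integral>\<^sup>+ y. G0 y * indicator K (y - (t * s) *\<^sub>R e) \<partial>lborel) \<partial>lborel) < \<infinity>"
proof -
  let ?\<pi> = "line_plan K s"
  let ?J = "\<integral>\<^sup>+ t\<in>{0..1}. (\<integral>\<^sup>+ y. G0 y * indicator K (y - (t * s) *\<^sub>R e) \<partial>lborel) \<partial>lborel"
  define X where "X \<gamma> = (\<integral>\<^sup>+ t\<in>{0..1}. ennreal (G (\<gamma> t) * metric_speed UNIV g \<gamma> t) \<partial>lborel)" for \<gamma>
  define X0 where "X0 \<gamma> = ennreal (s / 2) * (\<integral>\<^sup>+ t\<in>{0..1}. G0 (\<gamma> (clamp01 t)) \<partial>lborel)" for \<gamma> :: "real \<Rightarrow> real^'n"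
  have G_nonneg: "0 \<le> G x" for x using wug by (simp add: weak_upper_gradient_def)
  have le: "(\<integral>\<^sup>+ \<gamma>. ennreal \<bar>\<gamma> 1 $ k - \<gamma> 0 $ k\<bar> \<partial>?\<pi>) \<le> (\<integral>\<^sup>+ \<gamma>. X \<gamma> \<partial>?\<pi>)" and fin: "(\<integral>\<^sup>+ \<gamma>. X \<gamma> \<partial>?\<pi>) < \<infinity>"
    using wug test_plan_line_plan[of s] unfolding weak_upper_gradient_def X_def by blast+
  have "AE \<gamma> in ?\<pi>. ennreal \<bar>\<gamma> 1 $ k - \<gamma> 0 $ k\<bar> = ennreal s"
    using AE_line_plan[of "\<lambda>_. True" s] s by (auto elim!: eventually_mono simp: axis_def)
  then have "(\<integral>\<^sup>+ \<gamma>. ennreal \<bar>\<gamma> 1 $ k - \<gamma> 0 $ k\<bar> \<partial>?\<pi>) = (\<integral>\<^sup>+ \<gamma>. ennreal s \<partial>?\<pi>)"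
    by (rule nn_integral_cong_AE)
  then have lhs: "(\<integral>\<^sup>+ \<gamma>. ennreal \<bar>\<gamma> 1 $ k - \<gamma> 0 $ k\<bar> \<partial>?\<pi>) = ennreal s"
    by (simp add: prob_space.emeasure_space_1[OF prob_space_line_plan])
  \<comment> \<open>\<open>G\<close> is only Lebesgue measurable. It may be replaced by the Borel
    function \<open>G0\<close> in the integrals along curves because almost every line meets the set
    where they differ in a null set.\<close>
  have line_ae: "AE x in lborel. AE r in (lborel::real measure). ennreal (G (x + (r * s) *\<^sub>R e)) = G0 (x + (r * s) *\<^sub>R e)"
    using AE_lborel_lines[OF eq, of "s *\<^sub>R e"] by simp
  have "AE \<gamma> in ?\<pi>. X \<gamma> = X0 \<gamma>"
    using AE_line_plan[OF line_ae, of s]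
  proof eventually_elim
    case (elim \<gamma>)
    then obtain x where x: "AE r in (lborel::real measure). ennreal (G (x + (r * s) *\<^sub>R e)) = G0 (x + (r * s) *\<^sub>R e)"
      and \<gamma>: "\<gamma> = line s x" by blast
    have "X \<gamma> = (\<integral>\<^sup>+ t. ennreal (s / 2) * (G0 (\<gamma> (clamp01 t)) * indicator {0..1} t) \<partial>lborel)"
      unfolding X_def
    proof (rule nn_integral_cong_AE)
      show "AE t in lborel. ennreal (G (\<gamma> t) * metric_speed UNIV g \<gamma> t) * indicator {0..1} t =
          ennreal (s / 2) * (G0 (\<gamma> (clamp01 t)) * indicator {0..1} t)"
        using x
      proof eventually_elim
        case (elim t)
        show ?case
        proof (cases "t \<in> {0..1}")
          case True
          have "ennreal (G (\<gamma> t) * metric_speed UNIV g \<gamma> t) = ennreal (s / 2) * ennreal (G (x + (t * s) *\<^sub>R e))"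
            using True s G_nonneg by (simp add: \<gamma> metric_speed_line ennreal_mult'[symmetric] mult.commute)
          also have "\<dots> = ennreal (s / 2) * G0 (\<gamma> (clamp01 t))"
            unfolding elim using True by (simp add: \<gamma>)
          finally show ?thesis using True by simp
        qed simp
      qed
    qed
    also have "\<dots> = X0 \<gamma>"
      unfolding X0_def
    proof (rule nn_integral_cmult)
      have "(\<lambda>t. x + (clamp01 t * s) *\<^sub>R e) \<in> borel_measurable borel" by measurable
      then have "(\<lambda>t. \<gamma> (clamp01 t)) \<in> borel_measurable borel" by (simp add: \<gamma> del: atLeastAtMost_iff)
      from measurable_compose[OF this G0] show "(\<lambda>t. G0 (\<gamma> (clamp01 t)) * indicator {0..1} t) \<in> borel_measurable lborel"
        by simp
    qed
    finally show ?case .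
  qed
  then have XX0: "(\<integral>\<^sup>+ \<gamma>. X \<gamma> \<partial>?\<pi>) = (\<integral>\<^sup>+ \<gamma>. X0 \<gamma> \<partial>?\<pi>)" by (rule nn_integral_cong_AE)
  have "(\<lambda>(\<gamma>, t). G0 (\<gamma> (clamp01 t)) * indicator {0..1} t) \<in> borel_measurable (curve_space (UNIV :: (real^'n) set) \<Otimes>\<^sub>M lborel)"
    using measurable_compose[OF measurable_eval_joint[where U = "UNIV :: (real^'n) set"] G0]
    by (simp add: case_prod_beta')
  then have X0m: "X0 \<in> borel_measurable (curve_space UNIV)"
    unfolding X0_def[abs_def] by (intro borel_measurable_times_ennreal borel_measurable_const lborel.borel_measurable_nn_integral)
  have "(\<integral>\<^sup>+ \<gamma>. X0 \<gamma> \<partial>?\<pi>) = (\<integral>\<^sup>+ x. X0 (line s x) \<partial>uniform_measure lborel K)"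
    unfolding line_plan_def by (rule nn_integral_distr[OF measurable_line']) (simp add: X0m)
  also have "\<dots> = (\<integral>\<^sup>+ x. X0 (line s x) * indicator K x \<partial>lborel) / emeasure lborel K"
    by (rule nn_integral_uniform_measure) (use measurable_compose[OF measurable_line X0m] in auto)
  also have "(\<integral>\<^sup>+ x. X0 (line s x) * indicator K x \<partial>lborel) =
      (\<integral>\<^sup>+ x. ennreal (s / 2) * (\<integral>\<^sup>+ t. G0 (x + (t * s) *\<^sub>R e) * indicator {0..1} t * indicator K x \<partial>lborel) \<partial>lborel)"
  proof (intro nn_integral_cong)
    fix x
    have "(\<integral>\<^sup>+ t\<in>{0..1}. G0 (line s x (clamp01 t)) \<partial>lborel) = (\<integral>\<^sup>+ t\<in>{0..1}. G0 (x + (t * s) *\<^sub>R e) \<partial>lborel)"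
      by (intro nn_integral_cong) (auto simp: indicator_def)
    moreover have "(\<integral>\<^sup>+ t. G0 (x + (t * s) *\<^sub>R e) * indicator {0..1} t * indicator K x \<partial>lborel) =
        (\<integral>\<^sup>+ t\<in>{0..1}. G0 (x + (t * s) *\<^sub>R e) \<partial>lborel) * indicator K x"
      by (rule nn_integral_multc) measurable
    ultimately show "X0 (line s x) * indicator K x =
        ennreal (s / 2) * (\<integral>\<^sup>+ t. G0 (x + (t * s) *\<^sub>R e) * indicator {0..1} t * indicator K x \<partial>lborel)"
      by (simp only: X0_def mult.assoc)
  qed
  also have "\<dots> = ennreal (s / 2) * (\<integral>\<^sup>+ x. (\<integral>\<^sup>+ t. G0 (x + (t * s) *\<^sub>R e) * indicator {0..1} t * indicator K x \<partial>lborel) \<partial>lborel)"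
    by (rule nn_integral_cmult) measurable
  also have "(\<integral>\<^sup>+ x. (\<integral>\<^sup>+ t. G0 (x + (t * s) *\<^sub>R e) * indicator {0..1} t * indicator K x \<partial>lborel) \<partial>lborel) =
      (\<integral>\<^sup>+ t. (\<integral>\<^sup>+ x. G0 (x + (t * s) *\<^sub>R e) * indicator {0..1} t * indicator K x \<partial>lborel) \<partial>lborel)"
    by (rule lborel_pair.Fubini') measurable
  also have "\<dots> = ?J"
  proof (intro nn_integral_cong)
    fix t :: real
    have "(\<integral>\<^sup>+ x. G0 (x + (t * s) *\<^sub>R e) * indicator {0..1} t * indicator K x \<partial>lborel) =
        (\<integral>\<^sup>+ x. G0 (x + (t * s) *\<^sub>R e) * indicator K ((x + (t * s) *\<^sub>R e) - (t * s) *\<^sub>R e) * indicator {0..1} t \<partial>lborel)"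
      by (intro nn_integral_cong) (simp add: mult_ac)
    also have "\<dots> = (\<integral>\<^sup>+ y. G0 y * indicator K (y - (t * s) *\<^sub>R e) * indicator {0..1} t \<partial>lborel)"
      by (rule nn_integral_lborel_shift[where f = "\<lambda>y. G0 y * indicator K (y - (t * s) *\<^sub>R e) * indicator {0..1} t"]) measurable
    also have "\<dots> = (\<integral>\<^sup>+ y. G0 y * indicator K (y - (t * s) *\<^sub>R e) \<partial>lborel) * indicator {0..1} t"
      by (rule nn_integral_multc) measurable
    finally show "(\<integral>\<^sup>+ x. G0 (x + (t * s) *\<^sub>R e) * indicator {0..1} t * indicator K x \<partial>lborel) =
        (\<integral>\<^sup>+ y. G0 y * indicator K (y - (t * s) *\<^sub>R e) \<partial>lborel) * indicator {0..1} t" .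
  qed
  finally have X0J: "(\<integral>\<^sup>+ \<gamma>. X0 \<gamma> \<partial>?\<pi>) = ennreal (s / 2) * ?J / ennreal (measure lborel K)"
    by (simp add: K_emeasure)
  also have "\<dots> = ennreal (s / (2 * measure lborel K)) * ?J"
    unfolding divide_ennreal_def using K_measure_pos s
    by (simp add: inverse_ennreal mult.assoc mult.commute[of _ "ennreal (inverse _)"])
       (simp add: mult.assoc[symmetric] ennreal_mult[symmetric] field_simps)
  finally have eqJ: "(\<integral>\<^sup>+ \<gamma>. X \<gamma> \<partial>?\<pi>) = ennreal (s / (2 * measure lborel K)) * ?J" using XX0 by simp
  have cpos: "0 < s / (2 * measure lborel K)" using s K_measure_pos by simp
  show "?J < \<infinity>"
    using fin eqJ cpos by (auto simp: ennreal_mult_less_top ennreal_mult_eq_top_iff less_top)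
  have "ennreal (2 * measure lborel K / s) * ennreal s \<le> ennreal (2 * measure lborel K / s) * (ennreal (s / (2 * measure lborel K)) * ?J)"
    using le lhs eqJ by (intro mult_left_mono) auto
  moreover have "ennreal (2 * measure lborel K / s) * ennreal s = 2 * emeasure lborel K"
    using s K_measure_pos by (simp add: K_emeasure ennreal_mult[symmetric] ennreal_mult')
  moreover have "ennreal (2 * measure lborel K / s) * (ennreal (s / (2 * measure lborel K)) * ?J) = ?J"
    using s K_measure_pos by (simp add: mult.assoc[symmetric] ennreal_mult[symmetric])
  ultimately show "2 * emeasure lborel K \<le> ?J" by simp
qed

end

text \<open>A plan of segments of length \<delta> sees \<open>G\<close> only in the
  \<delta>-neighbourhood of K, so letting \<delta> tend to 0 bounds the integral of \<open>G\<close>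
  over K below by 2 |K|. As K is an arbitrary compact set, this is a pointwise bound almost
  everywhere. Plans of length 1 supply the local integrability that the limit uses.\<close>

lemma weak_upper_gradient_ge_two:
  assumes wug: "weak_upper_gradient UNIV g (\<lambda>x. x $ k) G"
  shows "AE x in lborel. 2 \<le> G x"
proof -
  have "G \<in> borel_measurable lebesgue"
    using wug by (simp add: weak_upper_gradient_def lebesgue_on_UNIV_eq)
  then have "(\<lambda>x. ennreal (G x)) \<in> borel_measurable lebesgue" by measurable
  from completion_ex_borel_measurable[OF this]
  obtain G0 where G0: "G0 \<in> borel_measurable lborel" and eq: "AE x in lborel. ennreal (G x) = G0 x" by blast
  have G0m[measurable]: "G0 \<in> borel_measurable borel" using G0 by simp
  have fin: "(\<integral>\<^sup>+ x\<in>cball 0 R. G0 x \<partial>lborel) < \<infinity>" for R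
  proof -
    \<comment> \<open>The extra 1 makes every translate of this ball by t e with t in [0,1] contain
      the ball of radius R; the maximum keeps the radius positive for negative R.\<close>
    define B where "B = cball (0::real^'n) (max R 0 + 1)"
    have B: "compact B" "emeasure lborel B \<noteq> 0"
      unfolding B_def by (simp, rule emeasure_lborel_cball_neq_0) simp
    have "(\<integral>\<^sup>+ x\<in>cball 0 R. G0 x \<partial>lborel) = (\<integral>\<^sup>+ t\<in>{0..1::real}. (\<integral>\<^sup>+ x\<in>cball 0 R. G0 x \<partial>lborel) \<partial>lborel)"
      by (subst nn_integral_cmult_indicator) auto
    also have "\<dots> \<le> (\<integral>\<^sup>+ t\<in>{0..1}. (\<integral>\<^sup>+ y. G0 y * indicator B (y - (t * 1) *\<^sub>R e) \<partial>lborel) \<partial>lborel)"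
    proof (rule nn_integral_mono)
      fix t :: real
      show "(\<integral>\<^sup>+ x\<in>cball 0 R. G0 x \<partial>lborel) * indicator {0..1} t \<le>
          (\<integral>\<^sup>+ y. G0 y * indicator B (y - (t * 1) *\<^sub>R e) \<partial>lborel) * indicator {0..1} t"
      proof (cases "t \<in> {0..1}")
        case True
        have "indicator (cball 0 R) y \<le> (indicator B (y - (t * 1) *\<^sub>R e) :: ennreal)" for y :: "real^'n"
        proof (cases "y \<in> cball 0 R")
          case y: True
          have "norm (y - t *\<^sub>R e) \<le> norm y + norm (t *\<^sub>R e)" by (rule norm_triangle_ineq4)
          also have "\<dots> \<le> max R 0 + 1" using y True by (intro add_mono) auto
          finally show ?thesis by (simp add: B_def indicator_def)
        qed simp
        then show ?thesis by (intro mult_right_mono nn_integral_mono mult_left_mono) auto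
      qed simp
    qed
    also have "\<dots> < \<infinity>"
      by (rule weak_upper_gradient_line_plan(2)[OF B wug _ G0m eq]) simp
    finally show ?thesis .
  qed
  have "AE x in lborel. ennreal 2 \<le> G0 x"
  proof (rule AE_ge_of_compact_average[OF G0m])
    fix K :: "(real^'n) set" assume K: "compact K"
    show "ennreal 2 * emeasure lborel K \<le> (\<integral>\<^sup>+ x\<in>K. G0 x \<partial>lborel)"
    proof (cases "emeasure lborel K = 0")
      case False
      then have ne: "K \<noteq> {}" by auto
      show ?thesis
      proof (rule nn_integral_decreasing_neighbourhoods[OF G0m K ne fin])
        fix \<delta> :: real assume \<delta>: "0 < \<delta>"
        have "ennreal 2 * emeasure lborel K \<le> (\<integral>\<^sup>+ t\<in>{0..1}. (\<integral>\<^sup>+ y. G0 y * indicator K (y - (t * \<delta>) *\<^sub>R e) \<partial>lborel) \<partial>lborel)"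
          using weak_upper_gradient_line_plan(1)[OF K False wug \<delta> G0m eq] by simp
        also have "\<dots> \<le> (\<integral>\<^sup>+ t\<in>{0..1::real}. (\<integral>\<^sup>+ x\<in>{y. infdist y K \<le> \<delta>}. G0 x \<partial>lborel) \<partial>lborel)"
        proof (rule nn_integral_mono)
          fix t :: real
          show "(\<integral>\<^sup>+ y. G0 y * indicator K (y - (t * \<delta>) *\<^sub>R e) \<partial>lborel) * indicator {0..1} t
              \<le> (\<integral>\<^sup>+ x\<in>{y. infdist y K \<le> \<delta>}. G0 x \<partial>lborel) * indicator {0..1} t"
          proof (cases "t \<in> {0..1}")
            case True
            have "indicator K (y - (t * \<delta>) *\<^sub>R e) \<le> (indicator {y. infdist y K \<le> \<delta>} y :: ennreal)" for y
            proof (cases "y - (t * \<delta>) *\<^sub>R e \<in> K")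
              case y: True
              have "infdist y K \<le> dist y (y - (t * \<delta>) *\<^sub>R e)" by (rule infdist_le[OF y])
              also have "\<dots> \<le> \<delta>" using True \<delta> by (simp add: dist_norm abs_mult mult_le_cancel_right1)
              finally show ?thesis by (simp add: indicator_def)
            qed simp
            then show ?thesis by (intro mult_right_mono nn_integral_mono mult_left_mono) auto
          qed simp
        qed
        also have "\<dots> = (\<integral>\<^sup>+ x\<in>{y. infdist y K \<le> \<delta>}. G0 x \<partial>lborel)"
          by (subst nn_integral_cmult_indicator) auto
        finally show "ennreal 2 * emeasure lborel K \<le> (\<integral>\<^sup>+ x\<in>{y. infdist y K \<le> \<delta>}. G0 x \<partial>lborel)" .
      qed
    qed simp
  qed simp
  then show ?thesis
    using eq
  proof eventually_elim
    case (elim x)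
    then have "ennreal 2 \<le> ennreal (G x)" by simp
    then show ?case using wug by (subst (asm) ennreal_le_iff) (auto simp: weak_upper_gradient_def)
  qed
qed

section \<open>The coordinate function and the slow segments\<close>

lemma minimal_wug_two: "minimal_wug UNIV g (\<lambda>x. x $ k) (\<lambda>_. 2)"
proof -
  have lip: "\<bar>x $ k - y $ k\<bar> \<le> norm (x - y)" for x y :: "real^'n"
    using component_le_norm_cart[of "x - y" k] by simp
  show ?thesis
    unfolding minimal_wug_def
    by (intro conjI allI impI weak_upper_gradient_two lip AE_vol_g weak_upper_gradient_ge_two)
qed

text \<open>In direction \<open>e\<close> the difference quotient equals 2 at every scale, by
  \<open>d_axis\<close>.\<close>

lemma slope_ge_two: "2 \<le> slope UNIV g (\<lambda>x. x $ k) x"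
  unfolding slope_def Limsup_def
proof (rule INF_greatest)
  fix P assume "P \<in> {P. eventually P (at x within UNIV)}"
  then obtain \<delta> where \<delta>: "0 < \<delta>" "\<And>y. y \<noteq> x \<Longrightarrow> dist y x < \<delta> \<Longrightarrow> P y"
    by (auto simp: eventually_at)
  define y where "y = x + (\<delta> / 2) *\<^sub>R e"
  have "P y" using \<delta> by (intro \<delta>(2)) (auto simp: y_def dist_norm axis_eq_0_iff)
  moreover have "\<bar>y $ k - x $ k\<bar> / d x y = 2"
    using \<delta>(1) unfolding y_def d_axis by (simp add: axis_def)
  ultimately show "2 \<le> (SUP y\<in>Collect P. ereal (\<bar>y $ k - x $ k\<bar> / d x y))"
    by (intro SUP_upper2[of y]) auto
qed

lemma sqrt_grad_norm_sq_axis: "sqrt (grad_norm_sq g x e) < 2"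
proof -
  have "grad_norm_sq g x e < 2\<^sup>2"
    using \<psi>_gt[of x] \<psi>_pos[of x] by (simp add: grad_norm_sq_g inner_axis_axis divide_less_eq)
  then show ?thesis using real_sqrt_less_mono by fastforce
qed

lemma g_speed_line:
  assumes t: "t \<in> {0..1}" and s: "s \<noteq> 0"
  shows "line s x differentiable (at t within {0..1})" "\<bar>s\<bar> / 2 < g_speed g (line s x) t"
proof -
  have "((\<lambda>t. x + (t * s) *\<^sub>R e) has_vector_derivative s *\<^sub>R e) (at t within {0..1})"
    by (auto intro!: derivative_eq_intros simp: has_vector_derivative_def)
  then have D: "(line s x has_vector_derivative s *\<^sub>R e) (at t within {0..1})"
    by (rule has_vector_derivative_transform[OF t, rotated]) simp
  then show "line s x differentiable (at t within {0..1})" by (rule differentiableI_vector)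
  have "vector_derivative (line s x) (at t within {0..1}) = s *\<^sub>R e"
    using vector_derivative_within_closed_interval[OF _ t D] by simp
  then have "g_speed g (line s x) t = sqrt (\<psi> (line s x t) * s\<^sup>2)"
    by (simp add: g_speed_def Let_def inner_axis_axis power2_eq_square mult_ac)
  moreover have "(\<bar>s\<bar> / 2)\<^sup>2 < \<psi> (line s x t) * s\<^sup>2"
    using \<psi>_gt[of "line s x t"] s by (simp add: power_divide)
  ultimately show "\<bar>s\<bar> / 2 < g_speed g (line s x) t" by (simp only: real_less_rsqrt)
qed

lemma slow_test_plan:
  "\<exists>\<pi>. test_plan UNIV g \<pi> \<and>
        (\<exists>S\<in>sets \<pi>. emeasure \<pi> S > 0 \<and>
           (\<forall>\<gamma>\<in>S. AE t in lborel. t \<in> {0..1} \<longrightarrow>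
               \<gamma> differentiable (at t within {0..1}) \<and>
               metric_speed UNIV g \<gamma> t < g_speed g \<gamma> t))"
proof -
  define K where "K = cball (0::real^'n) 1"
  have K: "compact K" "emeasure lborel K \<noteq> 0"
    unfolding K_def by (simp, rule emeasure_lborel_cball_neq_0) simp
  show ?thesis
  proof (intro exI[of _ "line_plan K 1"] conjI bexI[of _ "lines 1"] ballI)
    show "test_plan UNIV g (line_plan K 1)" by (rule test_plan_line_plan[OF K])
    show "emeasure (line_plan K 1) (lines 1) > 0" by (simp add: emeasure_lines[OF K])
    show "lines 1 \<in> sets (line_plan K 1)" by (simp add: sets_line_plan lines_measurable)
    fix \<gamma> assume "\<gamma> \<in> lines 1"
    then obtain x where "\<gamma> = line 1 x" by (auto simp: lines_eq)
    then show "AE t in lborel. t \<in> {0..1} \<longrightarrow> \<gamma> differentiable (at t within {0..1}) \<and>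
        metric_speed UNIV g \<gamma> t < g_speed g \<gamma> t"
      using g_speed_line[of _ 1 x] by (intro AE_I2) (simp add: metric_speed_line)
  qed
qed

text \<open>The k-th coordinate with constant gradient \<open>e\<close>; the set of positive volume
  is the whole space. A minimal G is itself a weak upper gradient, hence at least 2 almost
  everywhere by \<open>weak_upper_gradient_ge_two\<close>.\<close>

lemma steep_function:
  "\<exists>f D. (\<forall>x\<in>UNIV. (f has_derivative (\<lambda>v. D x \<bullet> v)) (at x)) \<and> continuous_on UNIV D \<and>
        (\<exists>G. minimal_wug UNIV g f G) \<and>
        (\<forall>G. minimal_wug UNIV g f G \<longrightarrow>
           (\<exists>A\<in>sets (vol_g UNIV g). emeasure (vol_g UNIV g) A > 0 \<and>
              (AE x in vol_g UNIV g. x \<in> A \<longrightarrow>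
                  slope UNIV g f x > ereal (sqrt (grad_norm_sq g x (D x))) \<and>
                  G x > sqrt (grad_norm_sq g x (D x)))))"
proof (rule exI[of _ "\<lambda>x. x $ k"], rule exI[of _ "\<lambda>_. e"], intro conjI ballI allI impI)
  show "((\<lambda>x. x $ k) has_derivative (\<lambda>v. e \<bullet> v)) (at x)" for x
    by (simp add: inner_axis' bounded_linear_imp_has_derivative bounded_linear_vec_nth)
  show "\<exists>G. minimal_wug UNIV g (\<lambda>x. x $ k) G" using minimal_wug_two by blast
  fix G assume "minimal_wug UNIV g (\<lambda>x. x $ k) G"
  then have "AE x in vol_g UNIV g. 2 \<le> G x"
    using AE_vol_g[OF weak_upper_gradient_ge_two] by (simp add: minimal_wug_def)
  then have ae: "AE x in vol_g UNIV g. x \<in> UNIV \<longrightarrow> slope UNIV g (\<lambda>x. x $ k) x > ereal (sqrt (grad_norm_sq g x e)) \<and>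
      G x > sqrt (grad_norm_sq g x e)"
  proof eventually_elim
    case (elim x)
    have "ereal (sqrt (grad_norm_sq g x e)) < 2" using sqrt_grad_norm_sq_axis[of x] by simp
    then have "ereal (sqrt (grad_norm_sq g x e)) < slope UNIV g (\<lambda>x. x $ k) x"
      using slope_ge_two by (rule less_le_trans)
    then show ?case using elim sqrt_grad_norm_sq_axis[of x] by simp
  qed
  have "0 < ennreal (sqrt ((1 / 4) ^ CARD('n))) * emeasure lborel (UNIV :: (real^'n) set)"
    by (simp add: emeasure_lborel_UNIV ennreal_zero_less_mult_iff)
  also have "\<dots> \<le> emeasure (vol_g UNIV g) UNIV" by (rule emeasure_le_vol_g) simp
  finally have pos: "0 < emeasure (vol_g UNIV g) UNIV" .
  have "UNIV \<in> sets (vol_g UNIV g)" by (simp add: density_vol_g)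
  then show "\<exists>A\<in>sets (vol_g UNIV g). emeasure (vol_g UNIV g) A > 0 \<and>
              (AE x in vol_g UNIV g. x \<in> A \<longrightarrow>
                  slope UNIV g (\<lambda>x. x $ k) x > ereal (sqrt (grad_norm_sq g x e)) \<and>
                  G x > sqrt (grad_norm_sq g x e))"
    using pos ae by blast
qed simp

lemma riem_metric_g: "riem_metric UNIV g"
  unfolding riem_metric_def
proof (intro conjI allI ballI impI)
  fix i j show "(\<lambda>x. g x $ i $ j) \<in> borel_measurable (restrict_space lebesgue UNIV)"
    unfolding lebesgue_on_UNIV_eq g_def by (rule measurable_completion) simp
  fix x :: "real^'n"
  show "transpose (g x) = g x" by (simp add: g_def transpose_def mat_def vec_eq_iff)
  fix v :: "real^'n" assume "v \<noteq> 0"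
  then show "0 < v \<bullet> (g x *v v)" using \<psi>_pos[of x] by simp
qed

lemma metric_Linf_g: "metric_Linf UNIV g"
  unfolding metric_Linf_def
proof (intro exI[of _ 4] AE_I2 impI allI)
  fix x :: "real^'n" and i j
  have "1 / \<psi> x \<le> 4" using \<psi>_gt[of x] \<psi>_pos[of x] by (simp add: divide_le_eq)
  then show "\<bar>g x $ i $ j\<bar> \<le> 4 \<and> \<bar>matrix_inv (g x) $ i $ j\<bar> \<le> 4"
    using \<psi>_le[of x] \<psi>_pos[of x] by (simp add: matrix_inv_g, simp add: g_def mat_def)
qed

end

section \<open>Sobolev regularity near lines\<close>

lemma nn_integral_abs_powr_neg_finite:
  fixes \<theta> :: real
  assumes \<theta>: "\<theta> < 1"
  shows "(\<integral>\<^sup>+ \<tau>\<in>{-1..1}. ennreal (\<bar>\<tau>\<bar> powr - \<theta>) \<partial>lborel) < \<infinity>"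
proof -
  let ?h = "\<lambda>\<tau>::real. ennreal (\<bar>\<tau>\<bar> powr - \<theta>) * indicator {0..1} \<tau>"
  have "(\<integral>\<^sup>+ \<tau>. ennreal (\<tau> powr - \<theta>) * indicator {0..1} \<tau> \<partial>lborel) = ennreal (1 powr (- \<theta> + 1) / (- \<theta> + 1))"
    by (rule nn_integral_has_integral_lebesgue'[OF _ has_integral_powr_from_0]) (use \<theta> in auto)
  moreover have "(\<integral>\<^sup>+ \<tau>. ?h \<tau> \<partial>lborel) = (\<integral>\<^sup>+ \<tau>. ennreal (\<tau> powr - \<theta>) * indicator {0..1} \<tau> \<partial>lborel)"
    by (intro nn_integral_cong) (auto simp: indicator_def)
  ultimately have h: "(\<integral>\<^sup>+ \<tau>. ?h \<tau> \<partial>lborel) < \<infinity>" by simp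
  have "(\<integral>\<^sup>+ \<tau>. ?h (- \<tau>) \<partial>lborel) = (\<integral>\<^sup>+ \<tau>. ?h \<tau> \<partial>distr lborel borel uminus)"
    by (subst nn_integral_distr) auto
  also have "\<dots> = (\<integral>\<^sup>+ \<tau>. ?h \<tau> \<partial>lborel)" by (simp add: lborel_distr_uminus)
  finally have h': "(\<integral>\<^sup>+ \<tau>. ?h (- \<tau>) \<partial>lborel) < \<infinity>" using h by simp
  have "(\<integral>\<^sup>+ \<tau>\<in>{-1..1}. ennreal (\<bar>\<tau>\<bar> powr - \<theta>) \<partial>lborel) \<le> (\<integral>\<^sup>+ \<tau>. ?h \<tau> + ?h (- \<tau>) \<partial>lborel)"
    by (intro nn_integral_mono) (auto simp: indicator_def)
  also have "\<dots> = (\<integral>\<^sup>+ \<tau>. ?h \<tau> \<partial>lborel) + (\<integral>\<^sup>+ \<tau>. ?h (- \<tau>) \<partial>lborel)"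
    by (rule nn_integral_add) auto
  also have "\<dots> < \<infinity>" using h h' by simp
  finally show ?thesis .
qed

text \<open>Within distance 1 of c the integrand is a translate of the model singularity; farther
  away it is at most 1. The bound does not depend on c, which later makes the estimate uniform over
  all lines.\<close>

lemma nn_integral_abs_diff_powr_neg_le:
  fixes \<theta> R c :: real
  assumes \<theta>: "0 \<le> \<theta>" and R: "0 \<le> R"
  shows "(\<integral>\<^sup>+ \<tau>\<in>{-R..R}. ennreal (\<bar>\<tau> - c\<bar> powr - \<theta>) \<partial>lborel)
    \<le> ennreal (2 * R) + (\<integral>\<^sup>+ \<tau>\<in>{-1..1}. ennreal (\<bar>\<tau>\<bar> powr - \<theta>) \<partial>lborel)"
proof -
  let ?k = "\<lambda>\<tau>::real. ennreal (\<bar>\<tau>\<bar> powr - \<theta>) * indicator {-1..1} \<tau>"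
  have "(\<integral>\<^sup>+ \<tau>\<in>{-R..R}. ennreal (\<bar>\<tau> - c\<bar> powr - \<theta>) \<partial>lborel) \<le> (\<integral>\<^sup>+ \<tau>. indicator {-R..R} \<tau> + ?k (\<tau> + - c) \<partial>lborel)"
  proof (rule nn_integral_mono)
    fix \<tau> :: real
    have "\<bar>\<tau> - c\<bar> powr - \<theta> \<le> 1" if "1 < \<bar>\<tau> - c\<bar>"
      using powr_mono2'[of "- \<theta>" 1 "\<bar>\<tau> - c\<bar>"] that \<theta> by simp
    then show "ennreal (\<bar>\<tau> - c\<bar> powr - \<theta>) * indicator {-R..R} \<tau> \<le> indicator {-R..R} \<tau> + ?k (\<tau> + - c)"
      by (cases "1 < \<bar>\<tau> - c\<bar>") (auto simp: indicator_def)
  qed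
  also have "\<dots> = ennreal (2 * R) + (\<integral>\<^sup>+ \<tau>. ?k (\<tau> + - c) \<partial>lborel)"
    using R by (subst nn_integral_add) auto
  also have "(\<integral>\<^sup>+ \<tau>. ?k (\<tau> + - c) \<partial>lborel) = (\<integral>\<^sup>+ \<tau>. ?k \<tau> \<partial>lborel)"
    by (rule nn_integral_lborel_shift) measurable
  finally show ?thesis .
qed

lemma off_axis_inner_axis: "b \<in> Basis \<Longrightarrow> b \<noteq> axis k 1 \<Longrightarrow> off_axis k y \<bullet> b = y \<bullet> b"
  by (simp add: off_axis_def inner_diff_left inner_not_same_Basis)

lemma abs_inner_le_norm_off_axis:
  assumes "b \<in> Basis" "b \<noteq> axis k 1"
  shows "\<bar>y \<bullet> b\<bar> \<le> norm (off_axis k y)"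
  using Basis_le_norm[of b "off_axis k y"] assms by (simp add: off_axis_inner_axis)

text \<open>Comparing with a product of one-dimensional singularities: this is where the codimension
  of the line enters.\<close>

lemma nn_integral_norm_off_axis_powr_bound:
  fixes k :: "'n::finite"
  assumes p: "0 \<le> p" "p < real CARD('n) - 1"
  shows "\<exists>C<\<infinity>. \<forall>q::real^'n. (\<integral>\<^sup>+ x\<in>cball 0 R. ennreal (norm (off_axis k (x - q)) powr - p) \<partial>lborel) \<le> C"
proof -
  define e :: "real^'n" where "e = axis k 1"
  define B :: "(real^'n) set" where "B = Basis - {e}"
  have eB: "e \<in> Basis" by (simp add: e_def)
  have cB: "real (card B) = real CARD('n) - 1"
    using eB by (simp add: B_def card_Diff_singleton of_nat_diff)
  then have cBpos: "0 < real (card B)" using p by linarith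
  \<comment> \<open>The exponent p is shared equally among the d - 1 coordinates transverse to the
    line; p < d - 1 makes each share less than 1, hence integrable in one dimension.\<close>
  define \<theta> where "\<theta> = p / real (card B)"
  have \<theta>: "0 \<le> \<theta>" "\<theta> < 1" using p cB cBpos by (auto simp: \<theta>_def divide_less_eq)
  define R' where "R' = max R 0"
  define J where "J = ennreal (2 * R') + (\<integral>\<^sup>+ \<tau>\<in>{-1..1}. ennreal (\<bar>\<tau>\<bar> powr - \<theta>) \<partial>lborel)"
  have Jfin: "J < \<infinity>" using nn_integral_abs_powr_neg_finite[OF \<theta>(2)] by (simp add: J_def)
  define C where "C = (\<Prod>b\<in>(Basis::(real^'n) set). J)"
  have "C < \<infinity>" using Jfin by (simp add: C_def less_top[symmetric] power_eq_top_ennreal)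
  moreover have "(\<integral>\<^sup>+ x\<in>cball 0 R. ennreal (norm (off_axis k (x - q)) powr - p) \<partial>lborel) \<le> C" for q :: "real^'n"
  proof -
    define f :: "real^'n \<Rightarrow> real \<Rightarrow> ennreal" where
      "f b \<tau> = (if b = e then 1 else ennreal (\<bar>\<tau> - q \<bullet> b\<bar> powr - \<theta>)) * indicator {-R'..R'} \<tau>" for b \<tau>
    have fm: "f b \<in> borel_measurable borel" for b unfolding f_def by (cases "b = e") simp_all
    \<comment> \<open>Since \<open>0 powr a = 0\<close>, the comparison of negative powers would
      fail at points sharing a coordinate with q; these form a null set.\<close>
    have "AE x in lborel. \<forall>b\<in>(Basis::(real^'n) set). x \<bullet> b \<noteq> q \<bullet> b"
      by (intro AE_finite_allI AE_lborel_inner_neq) auto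
    then have "AE x in lborel. ennreal (norm (off_axis k (x - q)) powr - p) * indicator (cball 0 R) x \<le> (\<Prod>b\<in>Basis. f b (x \<bullet> b))"
    proof eventually_elim
      case (elim x)
      show ?case
      proof (cases "x \<in> cball 0 R")
        case True
        then have ind: "indicator {-R'..R'} (x \<bullet> b) = (1::ennreal)" if "b \<in> Basis" for b
          using Basis_le_norm[OF that, of x] by (auto simp: R'_def indicator_def)
        let ?\<sigma> = "norm (off_axis k (x - q))"
        have le: "?\<sigma> powr - \<theta> \<le> \<bar>(x - q) \<bullet> b\<bar> powr - \<theta>" if b: "b \<in> B" for b
          using b elim abs_inner_le_norm_off_axis[of b k "x - q"] \<theta>
          by (intro powr_mono2') (auto simp: B_def e_def inner_diff_left)
        have "?\<sigma> powr - p = (\<Prod>b\<in>B. ?\<sigma> powr - \<theta>)"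
        proof (cases "?\<sigma> = 0")
          case False
          then have "(\<Prod>b\<in>B. ?\<sigma> powr - \<theta>) = ?\<sigma> powr (real (card B) * - \<theta>)"
            by (simp add: powr_power mult.commute)
          then show ?thesis using cBpos by (simp add: \<theta>_def)
        next
          case True
          then show ?thesis using cBpos by (simp add: power_0_left)
        qed
        also have "ennreal \<dots> \<le> ennreal (\<Prod>b\<in>B. \<bar>(x - q) \<bullet> b\<bar> powr - \<theta>)"
          by (intro ennreal_leI prod_mono conjI le) auto
        also have "\<dots> = (\<Prod>b\<in>B. ennreal (\<bar>(x - q) \<bullet> b\<bar> powr - \<theta>))"
          by (rule prod_ennreal[symmetric]) simp
        also have "\<dots> = (\<Prod>b\<in>B. f b (x \<bullet> b))"
          by (intro prod.cong refl) (auto simp: f_def B_def ind inner_diff_left)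
        also have "\<dots> = (\<Prod>b\<in>Basis. f b (x \<bullet> b))"
        proof -
          have "f e (x \<bullet> e) = 1" by (simp add: f_def ind[OF eB])
          then show ?thesis
            using prod.remove[OF finite_Basis eB, of "\<lambda>b. f b (x \<bullet> b)"] by (simp add: B_def)
        qed
        finally show ?thesis using True by simp
      qed simp
    qed
    then have "(\<integral>\<^sup>+ x\<in>cball 0 R. ennreal (norm (off_axis k (x - q)) powr - p) \<partial>lborel) \<le> (\<integral>\<^sup>+ x. (\<Prod>b\<in>Basis. f b (x \<bullet> b)) \<partial>lborel)"
      by (rule nn_integral_mono_AE)
    also have "\<dots> = (\<Prod>b\<in>Basis. (\<integral>\<^sup>+ \<tau>. f b \<tau> \<partial>lborel))"
      by (rule nn_integral_lborel_prod) (simp_all add: fm)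
    also have "\<dots> \<le> C"
      unfolding C_def
    proof (rule prod_mono_ennreal)
      fix b :: "real^'n"
      show "(\<integral>\<^sup>+ \<tau>. f b \<tau> \<partial>lborel) \<le> J"
      proof (cases "b = e")
        case True
        then show ?thesis by (simp add: f_def J_def R'_def)
      next
        case False
        then show ?thesis
          using nn_integral_abs_diff_powr_neg_le[OF \<theta>(1), of R' "q \<bullet> b"] by (simp add: f_def J_def R'_def)
      qed
    qed
    finally show ?thesis .
  qed
  ultimately show ?thesis by blast
qed

section \<open>Integration by parts and criteria for local Sobolev regularity\<close>

lemma integrable_compact_support:
  fixes G :: "'a::euclidean_space \<Rightarrow> real"
  assumes "compact K" "continuous_on UNIV G" "\<And>x. x \<notin> K \<Longrightarrow> G x = 0"
  shows "integrable lborel G"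
proof -
  have "integrable lborel (\<lambda>x. indicator K x *\<^sub>R G x)"
    by (intro borel_integrable_compact assms continuous_on_subset[OF assms(2)]) auto
  also have "(\<lambda>x. indicator K x *\<^sub>R G x) = G" using assms(3) by (auto simp: fun_eq_iff indicator_def)
  finally show ?thesis .
qed

text \<open>The difference quotients of F have integral 0 by translation invariance, and they
  converge dominatedly to the directional derivative G.\<close>

lemma integral_directional_derivative_0:
  fixes F G :: "'a::euclidean_space \<Rightarrow> real"
  assumes F: "\<And>x. (F has_derivative F' x) (at x)" and G: "\<And>x. F' x v = G x"
    and cont: "continuous_on UNIV G" and K: "compact K" and out: "\<And>x. x \<notin> K \<Longrightarrow> F x = 0 \<and> G x = 0"
  shows "(LINT x|lborel. G x) = 0"
proof -
  obtain B where B: "\<And>x. \<bar>G x\<bar> \<le> B"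
  proof -
    have "bounded (G ` K)"
      by (intro compact_imp_bounded compact_continuous_image K continuous_on_subset[OF cont]) auto
    then obtain B where "\<And>x. x \<in> K \<Longrightarrow> \<bar>G x\<bar> \<le> B" by (auto simp: bounded_iff)
    then have "\<bar>G x\<bar> \<le> max B 0" for x using out[of x] by (cases "x \<in> K") (auto intro: order_trans[OF _ max.cobounded1])
    then show ?thesis by (rule that)
  qed
  have B0: "0 \<le> B" using B[of 0] by linarith
  have Fc: "continuous_on UNIV F"
    using F by (intro continuous_at_imp_continuous_on ballI has_derivative_continuous) auto
  have Fm[measurable]: "F \<in> borel_measurable borel" and Gm[measurable]: "G \<in> borel_measurable borel"
    using Fc cont by (auto intro: borel_measurable_continuous_onI)
  have Fint: "integrable lborel F"
    using integrable_compact_support[OF K Fc] out by blast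
  define Q where "Q n x = real (Suc n) * (F (x + (1 / real (Suc n)) *\<^sub>R v) - F x)" for n x
  have deriv: "((\<lambda>s. F (x + s *\<^sub>R v)) has_real_derivative G (x + s *\<^sub>R v)) (at s)" for x s
  proof -
    have "((\<lambda>s. x + s *\<^sub>R v) has_derivative (\<lambda>h. h *\<^sub>R v)) (at s)" by (auto intro!: derivative_eq_intros)
    from has_derivative_compose[OF this F]
    have "((\<lambda>s. F (x + s *\<^sub>R v)) has_derivative (\<lambda>h. F' (x + s *\<^sub>R v) (h *\<^sub>R v))) (at s)" .
    moreover have "F' (x + s *\<^sub>R v) (h *\<^sub>R v) = G (x + s *\<^sub>R v) * h" for h
      using has_derivative_linear[OF F[of "x + s *\<^sub>R v"]] G by (simp add: linear_cmul)
    ultimately show ?thesis unfolding has_field_derivative_def by simp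
  qed
  have Qlim: "(\<lambda>n. Q n x) \<longlonglongrightarrow> G x" for x
  proof -
    have "((\<lambda>h. (F (x + h *\<^sub>R v) - F x) / h) \<longlongrightarrow> G x) (at 0)"
      using deriv[of x 0] by (simp add: DERIV_def)
    moreover have "filterlim (\<lambda>n. 1 / real (Suc n)) (at 0) sequentially"
      unfolding filterlim_at using LIMSEQ_inverse_real_of_nat by (auto simp: inverse_eq_divide)
    ultimately have "(\<lambda>n. (F (x + (1 / real (Suc n)) *\<^sub>R v) - F x) / (1 / real (Suc n))) \<longlonglongrightarrow> G x"
      by (rule filterlim_compose)
    then show ?thesis by (simp add: Q_def mult.commute)
  qed
  \<comment> \<open>K swept backwards along v up to parameter 1: it contains every point where a
    difference quotient with step 1 / (n + 1) is nonzero.\<close>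
  define K' where "K' = (\<lambda>(x, s). x - s *\<^sub>R v) ` (K \<times> {0..1})"
  have K': "compact K'"
    unfolding K'_def by (intro compact_continuous_image compact_Times K)
      (auto intro!: continuous_intros simp: case_prod_beta')
  have Qbd: "\<bar>Q n x\<bar> \<le> indicator K' x * B" for n x
  proof -
    obtain z where z: "0 < z" "z < 1 / real (Suc n)"
      "F (x + (1 / real (Suc n)) *\<^sub>R v) - F (x + 0 *\<^sub>R v) = (1 / real (Suc n) - 0) * G (x + z *\<^sub>R v)"
      using MVT2[of 0 "1 / real (Suc n)" "\<lambda>s. F (x + s *\<^sub>R v)" "\<lambda>s. G (x + s *\<^sub>R v)"] deriv by auto
    then have Q: "Q n x = G (x + z *\<^sub>R v)" by (simp add: Q_def)
    show ?thesis
    proof (cases "x + z *\<^sub>R v \<in> K")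
      case True
      have "1 / real (Suc n) \<le> 1" by simp
      with z(1,2) have "0 \<le> z" "z \<le> 1" by linarith+
      then have "z \<in> {0..1}" by simp
      then have "x \<in> K'" unfolding K'_def using True by (intro image_eqI[of _ _ "(x + z *\<^sub>R v, z)"]) auto
      then show ?thesis using B Q by simp
    next
      case False
      then show ?thesis using out Q B0 by simp
    qed
  qed
  have "(\<lambda>n. LINT x|lborel. Q n x) \<longlonglongrightarrow> (LINT x|lborel. G x)"
  proof (rule integral_dominated_convergence[where w = "\<lambda>x. indicator K' x * B"])
    show "integrable lborel (\<lambda>x. indicator K' x * B)"
      using K' by (intro integrable_mult_left integrable_real_indicator) (use emeasure_bounded_finite[OF compact_imp_bounded[OF K']] in \<open>auto simp: borel_compact\<close>)
    show "Q n \<in> borel_measurable lborel" for n unfolding Q_def[abs_def] by measurable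
  qed (use Qlim Qbd in auto)
  moreover have "(LINT x|lborel. Q n x) = 0" for n
  proof -
    have shift: "integrable lborel (\<lambda>x. F (x + w)) \<and> (LINT x|lborel. F (x + w)) = (LINT x|lborel. F x)" for w
    proof -
      have "integrable (distr lborel borel ((+) w)) F" "(LINT x|lborel. F x) = (LINT x|distr lborel borel ((+) w). F x)"
        using Fint by (simp_all add: lborel_distr_plus)
      then show ?thesis by (simp add: integrable_distr_eq integral_distr add.commute)
    qed
    show ?thesis
      using shift[of "(1 / real (Suc n)) *\<^sub>R v"] Fint by (simp add: Q_def)
  qed
  ultimately show ?thesis by (simp add: LIMSEQ_const_iff)
qed

lemma Lp_loc_UNIV_I:
  fixes f :: "real^'n::finite \<Rightarrow> real"
  assumes f: "f \<in> borel_measurable borel" and W: "AE x in lborel. ennreal (\<bar>f x\<bar> powr p) \<le> W x"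
    and fin: "\<And>R. (\<integral>\<^sup>+ x\<in>cball 0 R. W x \<partial>lborel) < \<infinity>"
  shows "Lp_loc UNIV p f"
  unfolding Lp_loc_def
proof (intro conjI allI impI)
  note [measurable] = f
  show "f \<in> borel_measurable (lebesgue_on UNIV)"
    unfolding lebesgue_on_UNIV_eq by (rule measurable_completion) simp
  fix K :: "(real^'n) set" assume K: "compact K \<and> K \<subseteq> UNIV"
  then have "bounded K" by (simp add: compact_imp_bounded)
  then obtain R where "\<forall>x\<in>K. norm x \<le> R" by (auto simp: bounded_iff)
  then have R: "K \<subseteq> cball 0 R" by auto
  have Km[measurable]: "K \<in> sets borel" using K by (simp add: borel_compact)
  have "integrable lborel (\<lambda>x. indicator K x *\<^sub>R \<bar>f x\<bar> powr p)"
  proof (rule integrableI_bounded)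
    have "(\<integral>\<^sup>+ x. ennreal (norm (indicator K x *\<^sub>R \<bar>f x\<bar> powr p)) \<partial>lborel) \<le> (\<integral>\<^sup>+ x\<in>cball 0 R. W x \<partial>lborel)"
      by (rule nn_integral_mono_AE)
        (use W in \<open>eventually_elim, use R in \<open>auto simp: indicator_def\<close>\<close>)
    also have "\<dots> < \<infinity>" by (rule fin)
    finally show "(\<integral>\<^sup>+ x. ennreal (norm (indicator K x *\<^sub>R \<bar>f x\<bar> powr p)) \<partial>lborel) < \<infinity>" .
  qed simp
  then show "set_integrable lebesgue K (\<lambda>x. \<bar>f x\<bar> powr p)"
    unfolding set_integrable_def by (subst integrable_completion) auto
qed

lemma test_fun_derivative:
  fixes \<phi> :: "real^'n::finite \<Rightarrow> real"
  assumes "test_fun UNIV \<phi>"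
  obtains D K where "\<And>x. (\<phi> has_derivative (\<lambda>v. D x \<bullet> v)) (at x)"
    "\<And>i. continuous_on UNIV (\<lambda>x. D x $ i)" "compact K" "\<And>x. x \<notin> K \<Longrightarrow> \<phi> x = 0 \<and> D x = 0"
proof -
  have "Ck_fun 1 \<phi>" using assms by (simp add: test_fun_def smooth_fun_def)
  then obtain D where D: "\<And>x. (\<phi> has_derivative (\<lambda>v. D x \<bullet> v)) (at x)" "\<And>i. continuous_on UNIV (\<lambda>x. D x $ i)"
    unfolding One_nat_def Ck_fun.simps by blast
  define K where "K = closure {x. \<phi> x \<noteq> 0}"
  have "compact K" using assms by (simp add: test_fun_def K_def)
  moreover have "\<phi> x = 0 \<and> D x = 0" if x: "x \<notin> K" for x
  proof
    have sub: "{x. \<phi> x \<noteq> 0} \<subseteq> K" unfolding K_def by (rule closure_subset)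
    then show "\<phi> x = 0" using x by auto
    have "open (- K)" by (simp add: K_def open_Compl)
    then have "((\<lambda>_. 0) has_derivative (\<lambda>v. D x \<bullet> v)) (at x)"
      using has_derivative_transform_within_open[OF D(1)[of x], of "- K" "\<lambda>_. 0"] x sub by auto
    moreover have "((\<lambda>_. 0::real) has_derivative (\<lambda>v. 0)) (at x)" by simp
    ultimately have "(\<lambda>v. D x \<bullet> v) = (\<lambda>v. 0)" by (rule has_derivative_unique)
    then have "D x \<bullet> D x = 0" by meson
    then show "D x = 0" by simp
  qed
  ultimately show ?thesis using that D by blast
qed

text \<open>A test function enters only through a continuous gradient and a compact support, so the
  identity can be checked for this larger class and with Borel integrals.\<close>

lemma weak_partial_UNIV_I:
  fixes f h :: "real^'n::finite \<Rightarrow> real"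
  assumes fm: "f \<in> borel_measurable borel" and hm: "h \<in> borel_measurable borel"
    and eq: "\<And>\<phi> D K. \<lbrakk>\<And>x. (\<phi> has_derivative (\<lambda>v. D x \<bullet> v)) (at x); \<And>i. continuous_on UNIV (\<lambda>x. D x $ i);
        compact K; \<And>x. x \<notin> K \<Longrightarrow> \<phi> x = 0 \<and> D x = 0\<rbrakk>
      \<Longrightarrow> (LINT x|lborel. f x * (D x $ i)) = - (LINT x|lborel. h x * \<phi> x)"
  shows "weak_partial UNIV f i h"
  unfolding weak_partial_def
proof (intro allI impI)
  fix \<phi> :: "real^'n \<Rightarrow> real" assume "test_fun UNIV \<phi>"
  then obtain D K where D: "\<And>x. (\<phi> has_derivative (\<lambda>v. D x \<bullet> v)) (at x)"
    "\<And>i. continuous_on UNIV (\<lambda>x. D x $ i)" "compact K" "\<And>x. x \<notin> K \<Longrightarrow> \<phi> x = 0 \<and> D x = 0"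
    by (rule test_fun_derivative) blast
  have "continuous_on UNIV \<phi>"
    using D(1) by (intro continuous_at_imp_continuous_on ballI has_derivative_continuous) auto
  then have [measurable]: "\<phi> \<in> borel_measurable borel" by (rule borel_measurable_continuous_onI)
  have [measurable]: "(\<lambda>x. D x $ i) \<in> borel_measurable borel"
    by (rule borel_measurable_continuous_onI[OF D(2)])
  note [measurable] = fm hm
  have fd: "frechet_derivative \<phi> (at x) (axis i 1) = D x $ i" for x
    using frechet_derivative_at[OF D(1)[of x], symmetric] by (simp add: inner_axis)
  show "(LINT x:UNIV|lebesgue. f x * frechet_derivative \<phi> (at x) (axis i 1)) = - (LINT x:UNIV|lebesgue. h x * \<phi> x)"
    using eq[OF D] unfolding fd set_lebesgue_integral_def
    by (simp add: integral_completion)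
qed

lemma W1p_loc_0: "W1p_loc UNIV p (\<lambda>x::real^'n::finite. 0)"
proof -
  have "Lp_loc UNIV p (\<lambda>x::real^'n. 0)"
    by (rule Lp_loc_UNIV_I[where W = "\<lambda>_. 0"]) auto
  moreover have "weak_partial UNIV (\<lambda>x::real^'n. 0) i (\<lambda>x. 0)" for i
    by (rule weak_partial_UNIV_I) auto
  ultimately show ?thesis unfolding W1p_loc_def by blast
qed

section \<open>The conformal factor built from a dense family of parallel lines\<close>

locale singular_lines =
  fixes q :: "nat \<Rightarrow> real^'n::finite" and k :: 'n and p :: real
  assumes p1: "1 \<le> p" and p2: "p < real CARD('n) - 1"
    and dense: "\<And>y \<epsilon>. 0 < \<epsilon> \<Longrightarrow> \<exists>j. dist y (q j) < \<epsilon>"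
begin

definition \<sigma> :: "nat \<Rightarrow> real^'n \<Rightarrow> real" where "\<sigma> j x = norm (off_axis k (x - q j))"

text \<open>The weights make \<open>T\<close> locally integrable, and its finiteness at a point
  controls the series for \<open>u\<close> and for its gradient there.\<close>

definition T :: "real^'n \<Rightarrow> ennreal" where "T x = (\<Sum>j. ennreal ((1 / 2) ^ j * \<sigma> j x powr - p))"

definition good :: "real^'n \<Rightarrow> bool" where "good x \<longleftrightarrow> (\<forall>j. 0 < \<sigma> j x) \<and> T x < \<infinity>"

text \<open>At a point where the series diverges \<open>enn2real\<close> gives 0, and on the j-th
  line the j-th term is ln 1 = 0 because 1 / 0 = 0. Both kinds of points fall outside
  \<open>good\<close> and form a null set; the default value 0 still gives \<open>\<psi>\<close> the
  right bounds there.\<close>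

definition u :: "real^'n \<Rightarrow> real" where
  "u x = enn2real (\<Sum>j. ennreal ((1 / 4) ^ j * ln (1 + 1 / (\<sigma> j x)\<^sup>2)))"

definition \<psi> :: "real^'n \<Rightarrow> real" where "\<psi> x = 1 / 4 + 3 / 4 * exp (- u x)"

text \<open>The formal i-th partial derivative of \<open>\<psi>\<close>: the gradient of ln (1 +
  1/s^2), s being the distance to a line, is -2 / (s^2 (s^2 + 1)) times the off-axis vector, and 3/2
  is 3/4 times 2.\<close>

definition h :: "'n \<Rightarrow> real^'n \<Rightarrow> real" where
  "h i x = 3 / 2 * exp (- u x) * (\<Sum>j. (1 / 4) ^ j / ((\<sigma> j x)\<^sup>2 * ((\<sigma> j x)\<^sup>2 + 1)) * off_axis k (x - q j) $ i)"

text \<open>Up to constants this dominates the series for \<open>u\<close> term by term and all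
  regularised gradients.\<close>

definition majorant :: "real^'n \<Rightarrow> real" where "majorant x = (\<Sum>j. (1 / 4) ^ j / \<sigma> j x)"

text \<open>Truncation leaves finitely many terms, and the positive shift of the squared distance
  removes their singularities, so that \<open>\<psi>_reg\<close> is differentiable everywhere with
  continuous gradient. Both modifications disappear as N grows.\<close>

definition u_reg :: "nat \<Rightarrow> real^'n \<Rightarrow> real" where
  "u_reg N x = (\<Sum>j<N. (1 / 4) ^ j * ln (1 + 1 / ((\<sigma> j x)\<^sup>2 + 1 / real (Suc N))))"

definition \<psi>_reg :: "nat \<Rightarrow> real^'n \<Rightarrow> real" where "\<psi>_reg N x = 1 / 4 + 3 / 4 * exp (- u_reg N x)"

definition grad_reg :: "nat \<Rightarrow> real^'n \<Rightarrow> real^'n" where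
  "grad_reg N x = (3 / 2 * exp (- u_reg N x)) *\<^sub>R
     (\<Sum>j<N. ((1 / 4) ^ j / (((\<sigma> j x)\<^sup>2 + 1 / real (Suc N)) * ((\<sigma> j x)\<^sup>2 + 1 / real (Suc N) + 1))) *\<^sub>R off_axis k (x - q j))"

lemma continuous_off_axis [continuous_intros]:
  "continuous_on S f \<Longrightarrow> continuous_on S (\<lambda>x. off_axis k (f x))"
  unfolding off_axis_def by (intro continuous_intros)

lemma continuous_\<sigma> [continuous_intros]: "continuous_on S (\<sigma> j)"
  unfolding \<sigma>_def[abs_def] by (intro continuous_intros)

lemma measurable_\<sigma> [measurable]: "\<sigma> j \<in> borel_measurable borel"
  by (rule borel_measurable_continuous_onI) (rule continuous_\<sigma>)

lemma measurable_off_axis [measurable]: "(\<lambda>x. off_axis k (x - q j) $ i) \<in> borel_measurable borel"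
  by (rule borel_measurable_continuous_onI) (intro continuous_intros)

lemma measurable_T [measurable]: "T \<in> borel_measurable borel"
  unfolding T_def[abs_def] by measurable

lemma measurable_u [measurable]: "u \<in> borel_measurable borel"
  unfolding u_def[abs_def] by measurable

lemma measurable_\<psi> [measurable]: "\<psi> \<in> borel_measurable borel"
  unfolding \<psi>_def[abs_def] by measurable

lemma measurable_h [measurable]: "h i \<in> borel_measurable borel"
  unfolding h_def[abs_def] by measurable

lemma measurable_majorant [measurable]: "majorant \<in> borel_measurable borel"
  unfolding majorant_def[abs_def] by measurable

lemma cball_borel [measurable]: "cball (x::real^'n) r \<in> sets borel"
  by simp

text \<open>The integral of a single singular power over a ball is bounded independently of the
  position of the line, so only the sum of the weights remains.\<close>

lemma T_locally_integrable: "(\<integral>\<^sup>+ x\<in>cball 0 R. T x \<partial>lborel) < \<infinity>"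
proof -
  obtain C where C: "C < \<infinity>"
    "\<And>y::real^'n. (\<integral>\<^sup>+ x\<in>cball 0 R. ennreal (norm (off_axis k (x - y)) powr - p) \<partial>lborel) \<le> C"
    using nn_integral_norm_off_axis_powr_bound[of p, where k = k and R = R] p1 p2 by auto
  have "(\<integral>\<^sup>+ x\<in>cball 0 R. T x \<partial>lborel) =
      (\<integral>\<^sup>+ x. (\<Sum>j. ennreal ((1 / 2) ^ j) * (ennreal (\<sigma> j x powr - p) * indicator (cball 0 R) x)) \<partial>lborel)"
    unfolding T_def by (intro nn_integral_cong) (simp add: ennreal_mult mult.assoc flip: ennreal_suminf_multc)
  also have "\<dots> = (\<Sum>j. ennreal ((1 / 2) ^ j) * (\<integral>\<^sup>+ x\<in>cball 0 R. ennreal (\<sigma> j x powr - p) \<partial>lborel))"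
    by (subst nn_integral_suminf) (auto simp: nn_integral_cmult)
  also have "\<dots> \<le> (\<Sum>j. ennreal ((1 / 2) ^ j) * C)"
    unfolding \<sigma>_def by (intro suminf_le mult_left_mono C(2)) auto
  also have "\<dots> = (\<Sum>j. ennreal ((1 / 2) ^ j)) * C"
    by simp
  also have "(\<Sum>j. ennreal ((1 / 2) ^ j)) = ennreal 2"
    by (subst suminf_ennreal2) (auto simp: suminf_geometric)
  also have "ennreal 2 * C < \<infinity>" using C(1) by (simp add: ennreal_mult_less_top)
  finally show ?thesis .
qed

lemma AE_good: "AE x in lborel. good x"
proof -
  have "card {k} < card (UNIV :: 'n set)" using p1 p2 by simp
  then obtain i where i: "i \<noteq> k" by (metis UNIV_eq_I insertCI less_irrefl singletonI)
  then have ik: "(axis i 1 :: real^'n) \<noteq> axis k 1" by (simp add: axis_eq_axis)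
  have pos: "AE x in lborel. \<forall>j. 0 < \<sigma> j x"
    unfolding AE_all_countable
  proof
    fix j
    have "AE x::real^'n in lborel. x \<bullet> axis i 1 \<noteq> q j \<bullet> axis i 1"
      by (rule AE_lborel_inner_neq) simp
    then show "AE x in lborel. 0 < \<sigma> j x"
    proof eventually_elim
      case (elim x)
      then have "0 < \<bar>(x - q j) \<bullet> axis i 1\<bar>" by (simp add: inner_diff_left)
      also have "\<dots> \<le> \<sigma> j x" unfolding \<sigma>_def using ik by (intro abs_inner_le_norm_off_axis) auto
      finally show ?case .
    qed
  qed
  have "AE x in lborel. \<forall>n. T x * indicator (cball 0 (real n)) x \<noteq> \<infinity>"
    unfolding AE_all_countable
  proof
    fix n show "AE x in lborel. T x * indicator (cball 0 (real n)) x \<noteq> \<infinity>"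
      using T_locally_integrable[of "real n"] by (intro nn_integral_PInf_AE) auto
  qed
  with pos show ?thesis
  proof eventually_elim
    case (elim x)
    obtain n where "norm x \<le> real n" using real_arch_simple by blast
    then have "T x \<noteq> \<infinity>" using elim(2)[rule_format, of n] by simp
    then show ?case using elim(1) by (simp add: good_def less_top)
  qed
qed

text \<open>Since p is at least 1, the p-th power of 2^-j / \<open>\<sigma> j x\<close> is at most
  the j-th term of \<open>T x\<close>, hence at most \<open>T x\<close>. Therefore 4^-j /
  \<open>\<sigma> j x\<close> is at most 2^-j times the p-th root of \<open>T x\<close>, and the
  remaining geometric series has sum 2.\<close>

lemma majorant_bound:
  assumes "good x"
  shows "summable (\<lambda>j. (1 / 4) ^ j / \<sigma> j x)" "0 \<le> majorant x"
    "ennreal (majorant x powr p) \<le> ennreal (2 powr p) * T x"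
proof -
  have \<sigma>: "0 < \<sigma> j x" for j using assms by (simp add: good_def)
  have Tfin: "T x < \<infinity>" using assms by (simp add: good_def)
  define \<tau> where "\<tau> = enn2real (T x)"
  have \<tau>: "T x = ennreal \<tau>" "0 \<le> \<tau>" using Tfin by (auto simp: \<tau>_def)
  have le: "(1 / 2) ^ j / \<sigma> j x \<le> \<tau> powr (1 / p)" for j
  proof -
    have "ennreal ((1 / 2) ^ j * \<sigma> j x powr - p) = (\<Sum>i\<in>{j}. ennreal ((1 / 2) ^ i * \<sigma> i x powr - p))" by simp
    also have "\<dots> \<le> T x"
      unfolding T_def by (intro sum_le_suminf summableI) simp_all
    finally have "ennreal ((1 / 2) ^ j * \<sigma> j x powr - p) \<le> ennreal \<tau>" unfolding \<tau>(1) .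
    then have *: "(1 / 2) ^ j * \<sigma> j x powr - p \<le> \<tau>" using ennreal_le_iff[OF \<tau>(2)] by blast
    have "((1 / 2) ^ j / \<sigma> j x) powr p = ((1 / 2) ^ j) powr p * \<sigma> j x powr - p"
      unfolding powr_divide powr_minus_divide by simp
    also have "\<dots> \<le> (1 / 2) ^ j * \<sigma> j x powr - p"
      using powr_mono'[of 1 p "(1 / 2) ^ j :: real"] p1 by (intro mult_right_mono) (auto simp: power_le_one)
    also have "\<dots> \<le> \<tau>" by (rule *)
    finally have "(((1 / 2) ^ j / \<sigma> j x) powr p) powr (1 / p) \<le> \<tau> powr (1 / p)"
      using p1 by (intro powr_mono2) auto
    then show ?thesis using p1 \<sigma>[of j] by (simp add: powr_powr)
  qed
  have le4: "(1 / 4) ^ j / \<sigma> j x \<le> (1 / 2) ^ j * \<tau> powr (1 / p)" for j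
  proof -
    have "(1 / 4 :: real) ^ j = (1 / 2) ^ j * (1 / 2) ^ j" by (simp flip: power_mult_distrib)
    then show ?thesis using mult_left_mono[OF le[of j], of "(1 / 2) ^ j"] by simp
  qed
  have sg: "summable (\<lambda>j. (1 / 2 :: real) ^ j * \<tau> powr (1 / p))"
    by (intro summable_mult2 summable_geometric) simp
  show sm: "summable (\<lambda>j. (1 / 4) ^ j / \<sigma> j x)"
    by (rule summable_comparison_test[OF _ sg]) (use le4 \<sigma> in \<open>auto intro!: exI[of _ 0] simp: less_imp_le\<close>)
  show A0: "0 \<le> majorant x" unfolding majorant_def using \<sigma> by (intro suminf_nonneg sm) (simp add: less_imp_le)
  have "majorant x \<le> (\<Sum>j. (1 / 2) ^ j * \<tau> powr (1 / p))"
    unfolding majorant_def by (intro suminf_le le4 sm sg)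
  also have "\<dots> = 2 * \<tau> powr (1 / p)"
    by (subst suminf_mult2[symmetric]) (auto simp: suminf_geometric summable_geometric)
  finally have "majorant x powr p \<le> (2 * \<tau> powr (1 / p)) powr p"
    using A0 p1 by (intro powr_mono2) auto
  also have "\<dots> = 2 powr p * \<tau>"
    using p1 \<tau> by (simp add: powr_mult powr_powr)
  finally show "ennreal (majorant x powr p) \<le> ennreal (2 powr p) * T x"
    unfolding \<tau>(1) by (simp add: ennreal_leI ennreal_mult'[symmetric])
qed

text \<open>From 1 + 1/s^2 \<le> (1 + 1/s)^2 the logarithm is at most 2 ln (1 + 1/s), hence at most
  2 / s. The bound does not depend on \<epsilon> and so serves the regularised terms as
  well.\<close>

lemma ln_term_bound:
  fixes s \<epsilon> :: real
  assumes "0 < s" "0 \<le> \<epsilon>"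
  shows "0 \<le> ln (1 + 1 / (s\<^sup>2 + \<epsilon>))" "ln (1 + 1 / (s\<^sup>2 + \<epsilon>)) \<le> 2 / s"
proof -
  have pos: "0 < s\<^sup>2 + \<epsilon>" using assms by (simp add: add_pos_nonneg)
  then show "0 \<le> ln (1 + 1 / (s\<^sup>2 + \<epsilon>))" by simp
  have "1 / (s\<^sup>2 + \<epsilon>) \<le> 1 / s\<^sup>2" using assms by (intro divide_left_mono) (auto simp: add_pos_nonneg)
  moreover have "1 + 1 / s\<^sup>2 \<le> (1 + 1 / s)\<^sup>2" using assms by (simp add: power2_sum power_divide)
  ultimately have le: "1 + 1 / (s\<^sup>2 + \<epsilon>) \<le> (1 + 1 / s)\<^sup>2" by linarith
  have "ln (1 + 1 / (s\<^sup>2 + \<epsilon>)) \<le> ln ((1 + 1 / s)\<^sup>2)"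
  proof (subst ln_le_cancel_iff)
    show "0 < 1 + 1 / (s\<^sup>2 + \<epsilon>)" using pos by (intro add_pos_pos) auto
    show "0 < (1 + 1 / s)\<^sup>2" using assms by (intro zero_less_power add_pos_pos) auto
  qed (rule le)
  also have "\<dots> = 2 * ln (1 + 1 / s)"
    using assms by (simp add: ln_realpow add_pos_pos)
  also have "\<dots> \<le> 2 * (1 / s)" using assms by (intro mult_left_mono ln_add_one_self_le_self) auto
  finally show "ln (1 + 1 / (s\<^sup>2 + \<epsilon>)) \<le> 2 / s" by simp
qed

lemma suminf_lessThan: "(\<Sum>j. if j < N then f j else 0) = (\<Sum>j<N. f j :: real)"
  using suminf_finite[of "{..<N}" "\<lambda>j. if j < N then f j else 0"] by simp

text \<open>Tannery's theorem for the terms extended by zero beyond the truncation index, which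
  moves with N.\<close>

lemma suminf_truncated_tendsto:
  fixes f :: "nat \<Rightarrow> nat \<Rightarrow> real"
  assumes lim: "\<And>j. (\<lambda>N. f N j) \<longlonglongrightarrow> b j" and bd: "\<And>j N. \<bar>f N j\<bar> \<le> M j" and M: "summable M"
  shows "(\<lambda>N. \<Sum>j<N. f N j) \<longlonglongrightarrow> suminf b"
proof -
  let ?a = "\<lambda>j N. if j < N then f N j else 0"
  have "0 \<le> M j" for j using bd[of 0 j] by linarith
  then have bd': "norm (?a j N) \<le> M j" for j N using bd by simp
  have "(\<lambda>N. suminf (\<lambda>j. ?a j N)) \<longlonglongrightarrow> suminf b"
  proof (rule tannerys_theorem[THEN conjunct2, THEN conjunct2])
    fix j
    have "\<forall>\<^sub>F N in sequentially. f N j = ?a j N"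
      using eventually_gt_at_top[of j] by eventually_elim simp
    with lim show "(\<lambda>N. ?a j N) \<longlonglongrightarrow> b j" by (rule Lim_transform_eventually)
  qed (use bd' M in \<open>auto intro!: always_eventually\<close>)
  then show ?thesis by (simp add: suminf_lessThan)
qed

lemma summable_ln_terms: "good x \<Longrightarrow> summable (\<lambda>j. (1 / 4) ^ j * ln (1 + 1 / (\<sigma> j x)\<^sup>2))"
proof (rule summable_comparison_test)
  assume x: "good x"
  then have \<sigma>: "0 < \<sigma> j x" for j by (simp add: good_def)
  have "(1 / 4) ^ j * ln (1 + 1 / (\<sigma> j x)\<^sup>2) \<le> 2 * ((1 / 4) ^ j / \<sigma> j x)" for j
    using mult_left_mono[OF ln_term_bound(2)[OF \<sigma>[of j], of 0], of "(1 / 4) ^ j"] by (simp add: mult.commute)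
  then show "\<exists>N. \<forall>n\<ge>N. norm ((1 / 4) ^ n * ln (1 + 1 / (\<sigma> n x)\<^sup>2)) \<le> 2 * ((1 / 4) ^ n / \<sigma> n x)"
    using ln_term_bound(1)[OF \<sigma>, of 0] by (auto simp: abs_mult)
  show "summable (\<lambda>j. 2 * ((1 / 4) ^ j / \<sigma> j x))" by (intro summable_mult majorant_bound(1) x)
qed

lemma u_good: "good x \<Longrightarrow> u x = (\<Sum>j. (1 / 4) ^ j * ln (1 + 1 / (\<sigma> j x)\<^sup>2))"
  unfolding u_def using ln_term_bound(1)[of "\<sigma> _ x" 0]
  by (subst suminf_ennreal2[OF _ summable_ln_terms])
     (auto simp: good_def intro!: enn2real_ennreal suminf_nonneg summable_ln_terms mult_nonneg_nonneg)

lemma inverse_Suc_tendsto_0: "(\<lambda>N. 1 / real (Suc N)) \<longlonglongrightarrow> 0"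
  using LIMSEQ_inverse_real_of_nat by (simp add: inverse_eq_divide)

lemma u_reg_tendsto: "good x \<Longrightarrow> (\<lambda>N. u_reg N x) \<longlonglongrightarrow> u x"
  unfolding u_good u_reg_def
proof (rule suminf_truncated_tendsto)
  assume x: "good x"
  then have \<sigma>: "0 < \<sigma> j x" for j by (simp add: good_def)
  show "summable (\<lambda>j. 2 * ((1 / 4) ^ j / \<sigma> j x))" by (intro summable_mult majorant_bound(1) x)
  fix j
  have "0 \<le> 1 / ((\<sigma> j x)\<^sup>2 + 0)" by simp
  then have "1 + 1 / ((\<sigma> j x)\<^sup>2 + 0) \<noteq> 0" by linarith
  then have "(\<lambda>N. (1 / 4) ^ j * ln (1 + 1 / ((\<sigma> j x)\<^sup>2 + 1 / real (Suc N)))) \<longlonglongrightarrow> (1 / 4) ^ j * ln (1 + 1 / ((\<sigma> j x)\<^sup>2 + 0))"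
    using \<sigma>[of j] by (intro tendsto_intros inverse_Suc_tendsto_0) auto
  then show "(\<lambda>N. (1 / 4) ^ j * ln (1 + 1 / ((\<sigma> j x)\<^sup>2 + 1 / real (Suc N)))) \<longlonglongrightarrow> (1 / 4) ^ j * ln (1 + 1 / (\<sigma> j x)\<^sup>2)"
    by simp
  fix N
  show "\<bar>(1 / 4) ^ j * ln (1 + 1 / ((\<sigma> j x)\<^sup>2 + 1 / real (Suc N)))\<bar> \<le> 2 * ((1 / 4) ^ j / \<sigma> j x)"
    using mult_left_mono[OF ln_term_bound(2)[OF \<sigma>[of j], of "1 / real (Suc N)"], of "(1 / 4) ^ j"]
      ln_term_bound(1)[OF \<sigma>[of j], of "1 / real (Suc N)"] by (simp add: abs_mult mult.commute)
qed

lemma u_nonneg: "0 \<le> u x"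
  by (simp add: u_def)

lemma \<psi>_bounds: "1 / 4 < \<psi> x" "\<psi> x \<le> 1"
proof -
  have "exp (- u x) \<le> 1" "0 < exp (- u x)" using u_nonneg[of x] by simp_all
  then show "1 / 4 < \<psi> x" "\<psi> x \<le> 1" unfolding \<psi>_def by linarith+
qed

lemma u_reg_nonneg: "0 \<le> u_reg N x"
  unfolding u_reg_def by (intro sum_nonneg mult_nonneg_nonneg ln_ge_zero) auto

lemma \<psi>_reg_bounds: "\<bar>\<psi>_reg N x\<bar> \<le> 1"
proof -
  have "exp (- u_reg N x) \<le> 1" using u_reg_nonneg by simp
  then show ?thesis unfolding \<psi>_reg_def using exp_gt_zero[of "- u_reg N x"] by linarith
qed

text \<open>A component of the off-axis vector is at most \<open>\<sigma> j x\<close>, and the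
  denominator is at least its square; one power cancels. The bound is uniform in the regularisation
  \<epsilon>.\<close>

lemma gradient_term_bound:
  fixes \<epsilon> :: real
  assumes "0 < \<sigma> j x" "0 \<le> \<epsilon>"
  shows "\<bar>(1 / 4) ^ j / (((\<sigma> j x)\<^sup>2 + \<epsilon>) * ((\<sigma> j x)\<^sup>2 + \<epsilon> + 1)) * off_axis k (x - q j) $ i\<bar> \<le> (1 / 4) ^ j / \<sigma> j x"
proof -
  let ?s = "\<sigma> j x"
  have s2: "0 < ?s\<^sup>2" using assms by simp
  let ?c = "(1 / 4) ^ j / ((?s\<^sup>2 + \<epsilon>) * (?s\<^sup>2 + \<epsilon> + 1))"
  have c: "0 \<le> ?c" using assms by simp
  have "\<bar>off_axis k (x - q j) $ i\<bar> \<le> ?s" unfolding \<sigma>_def by (rule component_le_norm_cart)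
  then have "?c * \<bar>off_axis k (x - q j) $ i\<bar> \<le> ?c * ?s" using c by (rule mult_left_mono)
  then have "\<bar>?c * off_axis k (x - q j) $ i\<bar> \<le> ?c * ?s" by (simp only: abs_mult abs_of_nonneg[OF c])
  also have "\<dots> \<le> (1 / 4) ^ j / ?s\<^sup>2 * ?s"
  proof (intro mult_right_mono divide_left_mono)
    have "?s\<^sup>2 * 1 \<le> (?s\<^sup>2 + \<epsilon>) * (?s\<^sup>2 + \<epsilon> + 1)" using assms by (intro mult_mono) auto
    then show "?s\<^sup>2 \<le> (?s\<^sup>2 + \<epsilon>) * (?s\<^sup>2 + \<epsilon> + 1)" by simp
    show "0 < ((?s\<^sup>2 + \<epsilon>) * (?s\<^sup>2 + \<epsilon> + 1)) * ?s\<^sup>2" using assms s2 by (intro mult_pos_pos) linarith+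
  qed (use assms in auto)
  also have "\<dots> = (1 / 4) ^ j / ?s" using assms by (simp add: power2_eq_square)
  finally show ?thesis .
qed

lemma grad_reg_component: "grad_reg N x $ i = 3 / 2 * exp (- u_reg N x) *
    (\<Sum>j<N. (1 / 4) ^ j / (((\<sigma> j x)\<^sup>2 + 1 / real (Suc N)) * ((\<sigma> j x)\<^sup>2 + 1 / real (Suc N) + 1)) * off_axis k (x - q j) $ i)"
  by (simp add: grad_reg_def sum_component)

lemma grad_reg_tendsto: "good x \<Longrightarrow> (\<lambda>N. grad_reg N x $ i) \<longlonglongrightarrow> h i x"
  unfolding grad_reg_component h_def
proof (intro tendsto_mult tendsto_const tendsto_exp tendsto_minus u_reg_tendsto)
  assume x: "good x"
  then have \<sigma>: "0 < \<sigma> j x" for j by (simp add: good_def)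
  show "(\<lambda>N. \<Sum>j<N. (1 / 4) ^ j / (((\<sigma> j x)\<^sup>2 + 1 / real (Suc N)) * ((\<sigma> j x)\<^sup>2 + 1 / real (Suc N) + 1)) * off_axis k (x - q j) $ i)
     \<longlonglongrightarrow> (\<Sum>j. (1 / 4) ^ j / ((\<sigma> j x)\<^sup>2 * ((\<sigma> j x)\<^sup>2 + 1)) * off_axis k (x - q j) $ i)"
  proof (rule suminf_truncated_tendsto)
    show "summable (\<lambda>j. (1 / 4) ^ j / \<sigma> j x)" by (rule majorant_bound(1)[OF x])
    show "\<bar>(1 / 4) ^ j / (((\<sigma> j x)\<^sup>2 + 1 / real (Suc N)) * ((\<sigma> j x)\<^sup>2 + 1 / real (Suc N) + 1)) * off_axis k (x - q j) $ i\<bar>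
        \<le> (1 / 4) ^ j / \<sigma> j x" for j N
      by (rule gradient_term_bound[OF \<sigma>]) simp
    fix j
    have "(\<lambda>N. (1 / 4) ^ j / (((\<sigma> j x)\<^sup>2 + 1 / real (Suc N)) * ((\<sigma> j x)\<^sup>2 + 1 / real (Suc N) + 1)) * off_axis k (x - q j) $ i)
       \<longlonglongrightarrow> (1 / 4) ^ j / (((\<sigma> j x)\<^sup>2 + 0) * ((\<sigma> j x)\<^sup>2 + 0 + 1)) * off_axis k (x - q j) $ i"
      using \<sigma>[of j] by (intro tendsto_intros inverse_Suc_tendsto_0) (auto simp: add_nonneg_eq_0_iff)
    then show "(\<lambda>N. (1 / 4) ^ j / (((\<sigma> j x)\<^sup>2 + 1 / real (Suc N)) * ((\<sigma> j x)\<^sup>2 + 1 / real (Suc N) + 1)) * off_axis k (x - q j) $ i)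
       \<longlonglongrightarrow> (1 / 4) ^ j / ((\<sigma> j x)\<^sup>2 * ((\<sigma> j x)\<^sup>2 + 1)) * off_axis k (x - q j) $ i" by simp
  qed
qed

lemma grad_reg_bound:
  assumes x: "good x"
  shows "\<bar>grad_reg N x $ i\<bar> \<le> 3 / 2 * majorant x"
proof -
  have \<sigma>: "0 < \<sigma> j x" for j using x by (simp add: good_def)
  let ?S = "\<Sum>j<N. (1 / 4) ^ j / (((\<sigma> j x)\<^sup>2 + 1 / real (Suc N)) * ((\<sigma> j x)\<^sup>2 + 1 / real (Suc N) + 1)) * off_axis k (x - q j) $ i"
  have "\<bar>?S\<bar> \<le> (\<Sum>j<N. (1 / 4) ^ j / \<sigma> j x)"
    by (rule order_trans[OF sum_abs]) (intro sum_mono gradient_term_bound \<sigma>, simp)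
  also have "\<dots> \<le> majorant x"
    unfolding majorant_def using \<sigma> by (intro sum_le_suminf majorant_bound(1) x) (auto simp: less_imp_le)
  finally have S: "\<bar>?S\<bar> \<le> majorant x" .
  have "\<bar>grad_reg N x $ i\<bar> = 3 / 2 * exp (- u_reg N x) * \<bar>?S\<bar>"
    unfolding grad_reg_component by (simp add: abs_mult)
  also have "\<dots> \<le> 3 / 2 * 1 * majorant x"
    using S u_reg_nonneg by (intro mult_mono) auto
  finally show ?thesis by simp
qed

lemma h_bound:
  assumes x: "good x"
  shows "\<bar>h i x\<bar> \<le> 3 / 2 * majorant x"
  using grad_reg_bound[OF x, of _ i]
  by (intro LIMSEQ_le_const2[OF tendsto_rabs[OF grad_reg_tendsto[OF x]]]) auto

lemma off_axis_inner_self: "off_axis k y \<bullet> off_axis k v = off_axis k y \<bullet> v"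
  by (simp add: off_axis_def inner_diff_left inner_diff_right inner_axis_axis)

lemma off_axis_inner_commute: "off_axis k v \<bullet> y = off_axis k y \<bullet> v"
  by (simp add: off_axis_def inner_diff_left inner_commute[of v y] inner_commute[of "axis k 1"] mult.commute)

lemma \<sigma>_sq_has_derivative: "((\<lambda>x. (\<sigma> j x)\<^sup>2) has_derivative (\<lambda>v. 2 * (off_axis k (x - q j) \<bullet> v))) (at x)"
proof -
  have eq: "(\<lambda>x. (\<sigma> j x)\<^sup>2) = (\<lambda>x. off_axis k (x - q j) \<bullet> off_axis k (x - q j))"
    by (simp add: \<sigma>_def power2_norm_eq_inner)
  have "((\<lambda>x. off_axis k (x - q j)) has_derivative (\<lambda>v. off_axis k v)) (at x)"
    unfolding off_axis_def by (auto intro!: derivative_eq_intros)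
  from has_derivative_inner[OF this this]
  show ?thesis unfolding eq
    by (rule has_derivative_eq_rhs) (simp add: fun_eq_iff off_axis_inner_self off_axis_inner_commute[of _ "x - q j"] inner_commute[of "off_axis k (x - q j)" "off_axis k _"])
qed

lemma \<psi>_reg_has_derivative: "(\<psi>_reg N has_derivative (\<lambda>v. grad_reg N x \<bullet> v)) (at x)"
proof -
  define \<epsilon> where "\<epsilon> = 1 / real (Suc N)"
  have \<epsilon>: "0 < \<epsilon>" by (simp add: \<epsilon>_def)
  have lnd: "((\<lambda>x. ln (1 + 1 / ((\<sigma> j x)\<^sup>2 + \<epsilon>))) has_derivative
      (\<lambda>v. - 2 / (((\<sigma> j x)\<^sup>2 + \<epsilon>) * ((\<sigma> j x)\<^sup>2 + \<epsilon> + 1)) * (off_axis k (x - q j) \<bullet> v))) (at x)" for j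
  proof -
    define s where "s = (\<sigma> j x)\<^sup>2 + \<epsilon>"
    have s: "0 < s" using \<epsilon> by (simp add: s_def add_nonneg_pos)
    have "((\<lambda>s. ln (1 + 1 / s)) has_real_derivative - (1 / (s * (s + 1)))) (at s)"
      using s by (auto intro!: derivative_eq_intros simp: add_pos_pos) (simp add: field_simps power2_eq_square)
    then have "((\<lambda>s. ln (1 + 1 / s)) has_derivative (\<lambda>t. - (1 / (s * (s + 1))) * t)) (at s)"
      by (simp only: has_field_derivative_def)
    moreover have "((\<lambda>x. (\<sigma> j x)\<^sup>2 + \<epsilon>) has_derivative (\<lambda>v. 2 * (off_axis k (x - q j) \<bullet> v))) (at x)"
      using has_derivative_add[OF \<sigma>_sq_has_derivative has_derivative_const] by simp
    ultimately have "((\<lambda>x. ln (1 + 1 / ((\<sigma> j x)\<^sup>2 + \<epsilon>))) has_derivative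
       (\<lambda>v. - (1 / (s * (s + 1))) * (2 * (off_axis k (x - q j) \<bullet> v)))) (at x)"
      using has_derivative_compose[of "\<lambda>x. (\<sigma> j x)\<^sup>2 + \<epsilon>" _ x UNIV "\<lambda>s. ln (1 + 1 / s)"] by (simp add: s_def)
    then show ?thesis by (rule has_derivative_eq_rhs) (simp add: s_def fun_eq_iff)
  qed
  have "(u_reg N has_derivative (\<lambda>v. \<Sum>j<N. (1 / 4) ^ j * (- 2 / (((\<sigma> j x)\<^sup>2 + \<epsilon>) * ((\<sigma> j x)\<^sup>2 + \<epsilon> + 1)) * (off_axis k (x - q j) \<bullet> v)))) (at x)"
    unfolding u_reg_def[abs_def] \<epsilon>_def[symmetric] by (intro has_derivative_sum has_derivative_mult_right lnd)
  then have "(\<psi>_reg N has_derivative (\<lambda>v. 3 / 4 * (exp (- u_reg N x) *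
      - (\<Sum>j<N. (1 / 4) ^ j * (- 2 / (((\<sigma> j x)\<^sup>2 + \<epsilon>) * ((\<sigma> j x)\<^sup>2 + \<epsilon> + 1)) * (off_axis k (x - q j) \<bullet> v)))))) (at x)"
    unfolding \<psi>_reg_def[abs_def] by (auto intro!: derivative_eq_intros)
  then show ?thesis
    unfolding grad_reg_def \<epsilon>_def[symmetric]
    by (rule has_derivative_eq_rhs)
       (simp add: fun_eq_iff inner_sum_left sum_distrib_left sum_negf[symmetric] mult_ac)
qed

lemma continuous_u_reg: "continuous_on UNIV (u_reg N)"
  unfolding u_reg_def[abs_def]
  by (intro continuous_intros ballI) (auto simp: add_nonneg_eq_0_iff add_pos_nonneg intro!: less_imp_neq[symmetric])

lemma continuous_grad_reg: "continuous_on UNIV (\<lambda>x. grad_reg N x $ i)"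
  unfolding grad_reg_component
  by (intro continuous_intros continuous_u_reg ballI) (auto simp: add_nonneg_eq_0_iff)

lemma continuous_\<psi>_reg: "continuous_on UNIV (\<psi>_reg N)"
  unfolding \<psi>_reg_def[abs_def] by (intro continuous_intros continuous_u_reg)

lemma integral_by_parts_reg:
  assumes \<phi>: "\<And>x. (\<phi> has_derivative (\<lambda>v. D x \<bullet> v)) (at x)" "continuous_on UNIV (\<lambda>x. D x $ i)"
    and K: "compact K" "\<And>x. x \<notin> K \<Longrightarrow> \<phi> x = 0 \<and> D x = 0"
  shows "(LINT x|lborel. \<psi>_reg N x * (D x $ i)) = - (LINT x|lborel. grad_reg N x $ i * \<phi> x)"
proof -
  have \<phi>c: "continuous_on UNIV \<phi>"
    using \<phi>(1) by (intro continuous_at_imp_continuous_on ballI has_derivative_continuous) auto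
  have "(LINT x|lborel. \<psi>_reg N x * (D x $ i) + grad_reg N x $ i * \<phi> x) = 0"
  proof (rule integral_directional_derivative_0[where K = K and F = "\<lambda>x. \<psi>_reg N x * \<phi> x"
        and F' = "\<lambda>x v. \<psi>_reg N x * (D x \<bullet> v) + (grad_reg N x \<bullet> v) * \<phi> x" and v = "axis i 1"])
    show "((\<lambda>x. \<psi>_reg N x * \<phi> x) has_derivative (\<lambda>v. \<psi>_reg N x * (D x \<bullet> v) + (grad_reg N x \<bullet> v) * \<phi> x)) (at x)" for x
      by (rule has_derivative_mult[OF \<psi>_reg_has_derivative \<phi>(1)])
    show "continuous_on UNIV (\<lambda>x. \<psi>_reg N x * (D x $ i) + grad_reg N x $ i * \<phi> x)"
      by (intro continuous_intros continuous_\<psi>_reg continuous_grad_reg \<phi> \<phi>c)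
  qed (use K in \<open>auto simp: inner_axis\<close>)
  moreover have "integrable lborel (\<lambda>x. \<psi>_reg N x * (D x $ i))"
    by (intro integrable_compact_support[OF K(1)] continuous_intros continuous_\<psi>_reg \<phi>) (use K in auto)
  moreover have "integrable lborel (\<lambda>x. grad_reg N x $ i * \<phi> x)"
    by (intro integrable_compact_support[OF K(1)] continuous_intros continuous_grad_reg \<phi>c) (use K in auto)
  ultimately show ?thesis by simp
qed

lemma majorant_locally_integrable:
  assumes K: "compact K"
  shows "integrable lborel (\<lambda>x. indicator K x * majorant x)"
proof (rule integrableI_bounded)
  have [measurable]: "K \<in> sets borel" using K by (simp add: borel_compact)
  then show "(\<lambda>x. indicator K x * majorant x) \<in> borel_measurable lborel" by simp
  obtain R where "\<forall>x\<in>K. norm x \<le> R" using compact_imp_bounded[OF K] by (auto simp: bounded_iff)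
  then have R: "K \<subseteq> cball 0 R" by auto
  have "(\<integral>\<^sup>+ x. ennreal (norm (indicator K x * majorant x)) \<partial>lborel)
      \<le> (\<integral>\<^sup>+ x. indicator (cball 0 R) x + ennreal (2 powr p) * (T x * indicator (cball 0 R) x) \<partial>lborel)"
  proof (rule nn_integral_mono_AE)
    show "AE x in lborel. ennreal (norm (indicator K x * majorant x)) \<le>
        indicator (cball 0 R) x + ennreal (2 powr p) * (T x * indicator (cball 0 R) x)"
      using AE_good
    proof eventually_elim
      case (elim x)
      note mb = majorant_bound[OF elim]
      show ?case
      proof (cases "x \<in> K")
        case True
        \<comment> \<open>As p is at least 1, the first power is controlled by the p-th, for which
          \<open>T\<close> is a locally integrable bound.\<close>
        have "majorant x \<le> 1 + majorant x powr p"
        proof (cases "majorant x \<le> 1")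
          case False
          then have "majorant x powr 1 \<le> majorant x powr p" using p1 by (intro powr_mono) auto
          then show ?thesis using mb(2) by simp
        qed (simp add: add_increasing2)
        then have "ennreal (majorant x) \<le> ennreal (1 + majorant x powr p)" by (rule ennreal_leI)
        also have "\<dots> = 1 + ennreal (majorant x powr p)" by (subst ennreal_plus) auto
        also have "\<dots> \<le> 1 + ennreal (2 powr p) * T x" using mb(3) by (rule add_left_mono)
        finally have "ennreal (majorant x) \<le> 1 + ennreal (2 powr p) * T x" .
        moreover have "x \<in> cball 0 R" using True R by blast
        ultimately show ?thesis using True mb(2) by (simp only: indicator_simps real_norm_def mult_1 mult_1_right abs_of_nonneg)
      qed simp
    qed
  qed
  also have "\<dots> = (\<integral>\<^sup>+ x. indicator (cball (0::real^'n) R) x \<partial>lborel) + (\<integral>\<^sup>+ x. ennreal (2 powr p) * (T x * indicator (cball 0 R) x) \<partial>lborel)"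
    by (rule nn_integral_add) measurable
  also have "(\<integral>\<^sup>+ x. indicator (cball (0::real^'n) R) x \<partial>lborel) = emeasure lborel (cball (0::real^'n) R)"
    by (rule nn_integral_indicator) simp
  also have "(\<integral>\<^sup>+ x. ennreal (2 powr p) * (T x * indicator (cball 0 R) x) \<partial>lborel) = ennreal (2 powr p) * (\<integral>\<^sup>+ x\<in>cball 0 R. T x \<partial>lborel)"
    by (rule nn_integral_cmult) measurable
  finally have "(\<integral>\<^sup>+ x. ennreal (norm (indicator K x * majorant x)) \<partial>lborel) \<le>
      emeasure lborel (cball (0::real^'n) R) + ennreal (2 powr p) * (\<integral>\<^sup>+ x\<in>cball 0 R. T x \<partial>lborel)" .
  also have "\<dots> < \<infinity>"
    using T_locally_integrable[of R] emeasure_bounded_finite[OF bounded_cball, of "0::real^'n" R]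
    by (simp add: ennreal_mult_less_top)
  finally show "(\<integral>\<^sup>+ x. ennreal (norm (indicator K x * majorant x)) \<partial>lborel) < \<infinity>" .
qed

text \<open>The regularised functions satisfy integration by parts exactly, and both sides pass to
  the limit by dominated convergence: the left because \<open>\<psi>_reg\<close> is bounded by 1,
  the right because the gradients are dominated by the majorant on the compact support.\<close>

lemma weak_partial_\<psi>: "weak_partial UNIV \<psi> i (h i)"
proof (rule weak_partial_UNIV_I[OF measurable_\<psi> measurable_h])
  fix \<phi> :: "real^'n \<Rightarrow> real" and D K
  assume \<phi>: "\<And>x. (\<phi> has_derivative (\<lambda>v. D x \<bullet> v)) (at x)" "\<And>i. continuous_on UNIV (\<lambda>x. D x $ i)"
    and K: "compact K" "\<And>x. x \<notin> K \<Longrightarrow> \<phi> x = 0 \<and> D x = 0"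
  have \<phi>c: "continuous_on UNIV \<phi>"
    using \<phi>(1) by (intro continuous_at_imp_continuous_on ballI has_derivative_continuous) auto
  have [measurable]: "\<phi> \<in> borel_measurable borel" "(\<lambda>x. D x $ i) \<in> borel_measurable borel"
    "\<psi>_reg N \<in> borel_measurable borel" "(\<lambda>x. grad_reg N x $ i) \<in> borel_measurable borel" for N
    by (auto intro!: borel_measurable_continuous_onI \<phi>c \<phi> continuous_\<psi>_reg continuous_grad_reg)
  have Dint: "integrable lborel (\<lambda>x. D x $ i)"
    by (rule integrable_compact_support[OF K(1) \<phi>(2)]) (simp add: K)
  obtain B where B: "\<And>x. x \<in> K \<Longrightarrow> \<bar>\<phi> x\<bar> \<le> B"
  proof -
    have "bounded (\<phi> ` K)"
      by (intro compact_imp_bounded compact_continuous_image K continuous_on_subset[OF \<phi>c]) auto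
    then show ?thesis using that by (auto simp: bounded_iff)
  qed
  have lim1: "(\<lambda>N. LINT x|lborel. \<psi>_reg N x * (D x $ i)) \<longlonglongrightarrow> (LINT x|lborel. \<psi> x * (D x $ i))"
  proof (rule integral_dominated_convergence[where w = "\<lambda>x. \<bar>D x $ i\<bar>"])
    show "AE x in lborel. (\<lambda>N. \<psi>_reg N x * (D x $ i)) \<longlonglongrightarrow> \<psi> x * (D x $ i)"
      using AE_good
      by eventually_elim (auto simp: \<psi>_reg_def \<psi>_def intro!: tendsto_intros u_reg_tendsto)
    show "AE x in lborel. norm (\<psi>_reg N x * (D x $ i)) \<le> \<bar>D x $ i\<bar>" for N
      using \<psi>_reg_bounds[of N] by (intro AE_I2) (simp add: abs_mult mult_left_le_one_le)
  qed (use Dint in auto)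
  have lim2: "(\<lambda>N. LINT x|lborel. grad_reg N x $ i * \<phi> x) \<longlonglongrightarrow> (LINT x|lborel. h i x * \<phi> x)"
  proof (rule integral_dominated_convergence[where w = "\<lambda>x. 3 / 2 * B * (indicator K x * majorant x)"])
    show "integrable lborel (\<lambda>x. 3 / 2 * B * (indicator K x * majorant x))"
      by (intro integrable_mult_right majorant_locally_integrable K)
    show "AE x in lborel. (\<lambda>N. grad_reg N x $ i * \<phi> x) \<longlonglongrightarrow> h i x * \<phi> x"
      using AE_good by eventually_elim (intro tendsto_intros grad_reg_tendsto)
    show "AE x in lborel. norm (grad_reg N x $ i * \<phi> x) \<le> 3 / 2 * B * (indicator K x * majorant x)" for N
      using AE_good
    proof eventually_elim
      case (elim x)
      show ?case
      proof (cases "x \<in> K")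
        case True
        have "\<bar>grad_reg N x $ i\<bar> * \<bar>\<phi> x\<bar> \<le> 3 / 2 * majorant x * B"
          using majorant_bound(2)[OF elim] by (intro mult_mono grad_reg_bound elim B True) auto
        then show ?thesis using True by (simp add: abs_mult mult_ac)
      qed (use K in simp)
    qed
  qed measurable
  have parts: "(LINT x|lborel. \<psi>_reg N x * (D x $ i)) = - (LINT x|lborel. grad_reg N x $ i * \<phi> x)" for N
    by (rule integral_by_parts_reg[OF \<phi> K])
  have "(\<lambda>N. LINT x|lborel. \<psi>_reg N x * (D x $ i)) \<longlonglongrightarrow> - (LINT x|lborel. h i x * \<phi> x)"
    unfolding parts by (rule tendsto_minus[OF lim2])
  with lim1 show "(LINT x|lborel. \<psi> x * (D x $ i)) = - (LINT x|lborel. h i x * \<phi> x)"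
    by (rule LIMSEQ_unique)
qed

lemma W1p_loc_\<psi>: "W1p_loc UNIV p \<psi>"
  unfolding W1p_loc_def
proof (intro conjI allI exI)
  show "Lp_loc UNIV p \<psi>"
  proof (rule Lp_loc_UNIV_I[where W = "\<lambda>_. 1"])
    show "AE x in lborel. ennreal (\<bar>\<psi> x\<bar> powr p) \<le> 1"
    proof (rule AE_I2)
      fix x
      have "\<bar>\<psi> x\<bar> powr p \<le> 1" using \<psi>_bounds[of x] p1 by (intro powr_le1) auto
      then show "ennreal (\<bar>\<psi> x\<bar> powr p) \<le> 1" using ennreal_leI by fastforce
    qed
    show "(\<integral>\<^sup>+ x\<in>cball (0::real^'n) R. 1 \<partial>lborel) < \<infinity>" for R
      using emeasure_bounded_finite[OF bounded_cball, of "0::real^'n" R] by simp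
  qed simp
  fix i
  show "weak_partial UNIV \<psi> i (h i)" by (rule weak_partial_\<psi>)
  show "Lp_loc UNIV p (h i)"
  proof (rule Lp_loc_UNIV_I[where W = "\<lambda>x. ennreal (3 powr p) * T x"])
    show "AE x in lborel. ennreal (\<bar>h i x\<bar> powr p) \<le> ennreal (3 powr p) * T x"
      using AE_good
    proof eventually_elim
      case (elim x)
      have "\<bar>h i x\<bar> powr p \<le> (3 / 2 * majorant x) powr p"
        using p1 by (intro powr_mono2 h_bound elim) auto
      also have "\<dots> = (3 / 2) powr p * majorant x powr p"
        using majorant_bound(2)[OF elim] by (intro powr_mult)
      finally have "ennreal (\<bar>h i x\<bar> powr p) \<le> ennreal ((3 / 2) powr p) * ennreal (majorant x powr p)"
        by (simp add: ennreal_leI ennreal_mult'[symmetric])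
      also have "\<dots> \<le> ennreal ((3 / 2) powr p) * (ennreal (2 powr p) * T x)"
        using majorant_bound(3)[OF elim] by (intro mult_left_mono) auto
      also have "\<dots> = ennreal ((3 / 2) powr p * 2 powr p) * T x"
        by (simp add: ennreal_mult' mult.assoc)
      also have "(3 / 2) powr p * 2 powr p = (3::real) powr p"
        by (simp add: powr_mult[symmetric])
      finally show ?case .
    qed
    show "(\<integral>\<^sup>+ x\<in>cball 0 R. ennreal (3 powr p) * T x \<partial>lborel) < \<infinity>" for R
    proof -
      have "(\<integral>\<^sup>+ x\<in>cball 0 R. ennreal (3 powr p) * T x \<partial>lborel) = ennreal (3 powr p) * (\<integral>\<^sup>+ x\<in>cball 0 R. T x \<partial>lborel)"
        unfolding mult.assoc by (rule nn_integral_cmult) measurable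
      then show ?thesis using T_locally_integrable[of R] by (simp add: ennreal_mult_less_top)
    qed
  qed simp
qed

text \<open>All terms of \<open>u\<close> are nonnegative, so the j-th one alone can force u \<ge> -
  ln \<epsilon> near the j-th line. Then exp (- u) is at most \<epsilon> there, whatever the other
  lines do.\<close>

lemma tube:
  assumes \<epsilon>: "0 < \<epsilon>"
  shows "\<exists>z r. 0 < r \<and> dist y z < \<epsilon> \<and> (AE x in lborel. norm (off_axis k (x - z)) < r \<longrightarrow> \<psi> x \<le> 1 / 4 + \<epsilon>)"
proof -
  obtain j where j: "dist y (q j) < \<epsilon>" using dense[OF \<epsilon>] by blast
  define M where "M = - ln \<epsilon>"
  \<comment> \<open>Solves 4^-j ln (1 / r^2) = M, so within distance r of the line the j-th term of
    \<open>u\<close> is at least M.\<close>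
  define r where "r = exp (- (4 ^ j * M / 2))"
  have r: "0 < r" by (simp add: r_def)
  have "AE x in lborel. norm (off_axis k (x - q j)) < r \<longrightarrow> \<psi> x \<le> 1 / 4 + \<epsilon>"
    using AE_good
  proof eventually_elim
    case (elim x)
    show ?case
    proof
      assume "norm (off_axis k (x - q j)) < r"
      then have less: "\<sigma> j x < r" by (simp add: \<sigma>_def)
      have \<sigma>: "0 < \<sigma> i x" for i using elim by (simp add: good_def)
      have "(\<sigma> j x)\<^sup>2 \<le> r\<^sup>2" using less \<sigma>[of j] by (intro power_mono) auto
      then have "1 / r\<^sup>2 \<le> 1 / (\<sigma> j x)\<^sup>2" using \<sigma>[of j] r by (intro divide_left_mono) auto
      moreover have "1 / r\<^sup>2 = exp (4 ^ j * M)"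
        by (simp add: r_def power2_eq_square exp_minus field_simps flip: exp_add)
      ultimately have "exp (4 ^ j * M) \<le> 1 + 1 / (\<sigma> j x)\<^sup>2" by linarith
      then have "4 ^ j * M \<le> ln (1 + 1 / (\<sigma> j x)\<^sup>2)"
        by (subst ln_ge_iff) (auto simp: add_pos_nonneg)
      then have "M \<le> (1 / 4) ^ j * ln (1 + 1 / (\<sigma> j x)\<^sup>2)"
        by (simp add: power_divide field_simps)
      also have "\<dots> = (\<Sum>i\<in>{j}. (1 / 4) ^ i * ln (1 + 1 / (\<sigma> i x)\<^sup>2))" by simp
      also have "\<dots> \<le> u x"
        unfolding u_good[OF elim] using ln_term_bound(1)[OF \<sigma>, of 0]
        by (intro sum_le_suminf summable_ln_terms elim) auto
      finally have "exp (- u x) \<le> exp (- M)" by simp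
      also have "\<dots> = \<epsilon>" using \<epsilon> by (simp add: M_def)
      finally show "\<psi> x \<le> 1 / 4 + \<epsilon>" using \<epsilon> by (simp add: \<psi>_def)
    qed
  qed
  then show ?thesis using j r by blast
qed

sublocale highways \<psi> k
  by unfold_locales (rule measurable_\<psi> \<psi>_bounds tube | assumption)+

lemma W1p_loc_g: "W1p_loc UNIV p (\<lambda>x. g x $ i $ j)"
proof (cases "i = j")
  case True
  then show ?thesis using W1p_loc_\<psi> by (simp add: g_def mat_def)
next
  case False
  then show ?thesis using W1p_loc_0[of p] by (simp add: g_def mat_def)
qed

end

theorem theorem1:
  fixes p :: real
  assumes "CARD('n::finite) \<ge> 3" and "1 \<le> p" and "p < real CARD('n) - 1"
  shows "\<exists>(U :: (real^'n) set) g.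
     open U \<and> connected U \<and> U \<noteq> {} \<and>
     riem_metric U g \<and> metric_Linf U g \<and> (\<forall>i j. W1p_loc U p (\<lambda>x. g x $ i $ j)) \<and>
     (\<exists>\<pi>. test_plan U g \<pi> \<and>
        (\<exists>S\<in>sets \<pi>. emeasure \<pi> S > 0 \<and>
           (\<forall>\<gamma>\<in>S. AE t in lborel. t \<in> {0..1} \<longrightarrow>
               \<gamma> differentiable (at t within {0..1}) \<and>
               metric_speed U g \<gamma> t < g_speed g \<gamma> t))) \<and>
     (\<exists>f D. (\<forall>x\<in>U. (f has_derivative (\<lambda>v. D x \<bullet> v)) (at x)) \<and> continuous_on U D \<and>
        (\<exists>G. minimal_wug U g f G) \<and>
        (\<forall>G. minimal_wug U g f G \<longrightarrow>
           (\<exists>A\<in>sets (vol_g U g). emeasure (vol_g U g) A > 0 \<and>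
              (AE x in vol_g U g. x \<in> A \<longrightarrow>
                  slope U g f x > ereal (sqrt (grad_norm_sq g x (D x))) \<and>
                  G x > sqrt (grad_norm_sq g x (D x))))))"
proof -
  obtain q :: "nat \<Rightarrow> real^'n" where q: "\<And>y \<epsilon>. 0 < \<epsilon> \<Longrightarrow> \<exists>j. dist y (q j) < \<epsilon>"
    by (rule dense_sequence) blast
  \<comment> \<open>The direction of the lines may be any coordinate axis; \<open>undefined\<close>
    is simply some element of the index type.\<close>
  interpret singular_lines q "undefined :: 'n" p
    by unfold_locales (use assms q in auto)
  show ?thesis
    using riem_metric_g metric_Linf_g W1p_loc_g slow_test_plan steep_function
    by (intro exI[of _ UNIV] exI[of _ g] conjI) auto
qed

end
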